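(* Let $H_1$ be a single edge and $H_2$ a finite simple graph with $p\ge2$ edges. Call a probability measure $\mu$ admissible if it is non-degenerate, supported on $[0,1]$ with $0$ and $1$ in its support, symmetric about the line $u=1/2$, and such that the equation $K'''(\theta)K'(\theta)=-(p-2)\left(K''(\theta)\right)^2$ has exactly one solution $\theta\in\mathbb{R}$, where $K(\theta)=\log\int e^{\theta x}\mu(dx)$. Let $\mu$ be admissible and consider $\beta=(\beta_1,\beta_2)$ with $\beta_1<-\beta_2$ and $\beta_2\ge0$. Then for $\beta$ sufficiently far away from the origin, a graph $G_n$ drawn from the $2$-parameter edge-weighted exponential random graph model $\mathbb{P}_n^\beta$ with edge-weight distribution $\mu$ behaves like an Erdős–Rényi graph $G(n,u)$ as $n\to\infty$, i.e. $\lim_{n\to\infty}\delta_\square(\tilde h^{G_n},\tilde u)=0$ almost surely, where $u=u_\mu(\beta)\in(0,1)$ is the maximizer of $\beta_1u+\beta_2u^p-\frac12I(u)$, and the dual $\theta=\theta_\mu(\beta)$ of $u$ (defined by $K'(\theta)=u$) universally satisfies $\theta\asymp 2\beta_1$, that is, $\theta_\mu(\beta)/(2\beta_1)\to1$ as $|\beta|\to\infty$ within the region $\{\beta_1<-\beta_2,\ \beta_2\ge0\}$. On the other hand $u$ depends on the distribution $\mu$: there exist admissible $\mu,\nu$ such that $u_\mu(\beta)/u_\nu(\beta)$ does not tend to $1$ as $|\beta|\to\infty$ in this region.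
   Context: $I(u)=\sup_{\theta\in\mathbb{R}}\{\theta u-K(\theta)\}$ is the Cramér rate function of $\mu$. Model: $\mathcal{G}_n$ is the set of edge-weighted complete labeled graphs $G_n$ on $n$ vertices (undirected, no loops or multiple edges), where the edge weights $x_{ij}=x_{ji}$, $i<j$, are iid with distribution $\mu$ (and $x_{ii}=0$); this gives a probability measure $\mathbb{P}_n$ on $\mathcal{G}_n$ with expectation $\mathbb{E}_n$. The graphon of $G_n$ is $h^{G_n}:[0,1]^2\to[0,1]$, $h^{G_n}(x,y)=x_{\lceil nx\rceil\lceil ny\rceil}$. For a finite simple graph $H$ with vertex set $\{1,\dots,k\}$ and edge set $E(H)$, $t(H,G_n)=\int_{[0,1]^k}\prod_{\{i,j\}\in E(H)}h^{G_n}(x_i,x_j)\,dx_1\cdots dx_k$. The measure $\mathbb{P}_n^\beta$ on $\mathcal{G}_n$ has density $\exp\left(n^2\left(\beta_1t(H_1,G_n)+\beta_2t(H_2,G_n)-\psi_n^\beta\right)\right)$ with respect to $\mathbb{P}_n$, where $\psi_n^\beta=\frac{1}{n^2}\log\mathbb{E}_n\left(\exp\left(n^2(\beta_1t(H_1,G_n)+\beta_2t(H_2,G_n))\right)\right)$. Cut distance: for symmetric measurable $f,h:[0,1]^2\to[0,1]$, $d_\square(f,h)=\sup_{S,T\subseteq[0,1]}\left|\int_{S\times T}(f-h)\,dx\,dy\right|$; $f\sim h$ if $f(x,y)=h(\sigma x,\sigma y)$ for a measure preserving bijection $\sigma$ of $[0,1]$; $\tilde h$ denotes the equivalence class of $h$,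 and $\delta_\square(\tilde f,\tilde h)=\inf_{\sigma_1,\sigma_2}d_\square(f_{\sigma_1},h_{\sigma_2})$ with $h_\sigma(x,y)=h(\sigma x,\sigma y)$. $\tilde u$ is the class of the constant graphon $u$. It is known that for $\beta_2\ge0$, $\delta_\square(\tilde h^{G_n},\tilde u)\to0$ almost surely, where $u$ is picked from the set of maximizers of $\beta_1u+\beta_2u^p-\frac12I(u)$ over $\{I<\infty\}$. *)

theory Defs
  imports "HOL-Probability.Probability" "HOL-Library.Ramsey"
begin

section \<open>Edge-weight distributions\<close>

definition cumulant :: "real measure \<Rightarrow> real \<Rightarrow> real" where
  "cumulant \<mu> \<theta> = ln (\<integral>x. exp (\<theta> * x) \<partial>\<mu>)"

definition rate_fun :: "real measure \<Rightarrow> real \<Rightarrow> ereal" where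
  "rate_fun \<mu> u = (SUP \<theta>. ereal (\<theta> * u - cumulant \<mu> \<theta>))"

definition topological_support :: "real measure \<Rightarrow> real set" where
  "topological_support \<mu> = {x. \<forall>U. open U \<longrightarrow> x \<in> U \<longrightarrow> emeasure \<mu> U \<noteq> 0}"

definition admissible :: "nat \<Rightarrow> real measure \<Rightarrow> bool" where
  "admissible p \<mu> \<longleftrightarrow>
     prob_space \<mu> \<and> sets \<mu> = sets borel \<and>
     \<not> (\<exists>c. AE x in \<mu>. x = c) \<and>
     (AE x in \<mu>. x \<in> {0..1}) \<and>
     0 \<in> topological_support \<mu> \<and> 1 \<in> topological_support \<mu> \<and>
     distr \<mu> borel (\<lambda>x. 1 - x) = \<mu> \<and>
     (\<exists>!\<theta>. (deriv ^^ 3) (cumulant \<mu>) \<theta> * deriv (cumulant \<mu>) \<theta>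
              = - (real p - 2) * ((deriv ^^ 2) (cumulant \<mu>) \<theta>)\<^sup>2)"


section \<open>Graphons and cut distance\<close>

text \<open>Graphons are functions \<open>real \<Rightarrow> real \<Rightarrow> real\<close>; only their values on the unit square matter.\<close>

definition cut_dist :: "(real \<Rightarrow> real \<Rightarrow> real) \<Rightarrow> (real \<Rightarrow> real \<Rightarrow> real) \<Rightarrow> real" where
  "cut_dist f h =
     (SUP (S, T) \<in> {S \<in> sets lebesgue. S \<subseteq> {0..1}} \<times> {T \<in> sets lebesgue. T \<subseteq> {0..1}}.
        \<bar>set_lebesgue_integral lebesgue (S \<times> T) (\<lambda>(x, y). f x y - h x y)\<bar>)"

definition mp_bijection :: "(real \<Rightarrow> real) \<Rightarrow> bool" where
  "mp_bijection \<sigma> \<longleftrightarrow>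
     bij_betw \<sigma> {0..1} {0..1} \<and>
     \<sigma> \<in> lebesgue_on {0..1} \<rightarrow>\<^sub>M lebesgue_on {0..1} \<and>
     distr (lebesgue_on {0..1}) (lebesgue_on {0..1}) \<sigma> = lebesgue_on {0..1}"

definition graphon_class :: "(real \<Rightarrow> real \<Rightarrow> real) \<Rightarrow> (real \<Rightarrow> real \<Rightarrow> real) set" where
  "graphon_class h = {(\<lambda>x y. h (\<sigma> x) (\<sigma> y)) | \<sigma>. mp_bijection \<sigma>}"

definition class_dist ::
    "(real \<Rightarrow> real \<Rightarrow> real) set \<Rightarrow> (real \<Rightarrow> real \<Rightarrow> real) set \<Rightarrow> real" where
  "class_dist F H = (INF (f, h) \<in> F \<times> H. cut_dist f h)"


section \<open>Weighted graphs and the exponential model\<close>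

text \<open>
  Unordered pairs of vertices are two-element sets, i.e. elements of \<open>nsets {1..n} 2\<close>. A weighted
  graph on \<open>{1..n}\<close> is a function \<open>G\<close> on these pairs, with \<open>G {i, j}\<close> playing the role
  of \<open>x\<^sub>i\<^sub>j = x\<^sub>j\<^sub>i\<close>.
\<close>

type_synonym wgraph = "nat set \<Rightarrow> real"

definition weight :: "nat \<Rightarrow> wgraph \<Rightarrow> nat \<Rightarrow> nat \<Rightarrow> real" where
  "weight n G i j = (if {i, j} \<in> nsets {1..n} 2 then G {i, j} else 0)"

text \<open>On the null set where a coordinate is 0, the rounded index 0 is not a vertex and the value is 0.\<close>

definition graphon_of :: "nat \<Rightarrow> wgraph \<Rightarrow> real \<Rightarrow> real \<Rightarrow> real" where
  "graphon_of n G x y = weight n G (nat \<lceil>real n * x\<rceil>) (nat \<lceil>real n * y\<rceil>)"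

text \<open>
  Homomorphism density of the graph with vertex set \<open>{1..k}\<close> and edge set \<open>E\<close>. As \<open>h\<close> is
  symmetric, the orientation of an edge chosen through \<open>Min\<close> and \<open>Max\<close> is irrelevant.
\<close>

definition hom_density :: "nat \<Rightarrow> nat set set \<Rightarrow> (real \<Rightarrow> real \<Rightarrow> real) \<Rightarrow> real" where
  "hom_density k E h =
     set_lebesgue_integral (PiM {1..k} (\<lambda>_. lborel)) (PiE {1..k} (\<lambda>_. {0..1}))
       (\<lambda>x. \<Prod>e\<in>E. h (x (Min e)) (x (Max e)))"

definition graph_law :: "real measure \<Rightarrow> nat \<Rightarrow> wgraph measure" where
  "graph_law \<mu> n = PiM (nsets {1..n} 2) (\<lambda>_. \<mu>)"

text \<open>The first graph \<open>H\<^sub>1\<close> is the single edge on two vertices; \<open>H\<^sub>2\<close> is given by \<open>k\<close> and \<open>E\<close>.\<close>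

definition hamiltonian :: "nat \<Rightarrow> nat set set \<Rightarrow> real \<times> real \<Rightarrow> nat \<Rightarrow> wgraph \<Rightarrow> real" where
  "hamiltonian k E \<beta> n G =
     fst \<beta> * hom_density 2 {{1, 2}} (graphon_of n G) + snd \<beta> * hom_density k E (graphon_of n G)"

definition psi :: "real measure \<Rightarrow> nat \<Rightarrow> nat set set \<Rightarrow> real \<times> real \<Rightarrow> nat \<Rightarrow> real" where
  "psi \<mu> k E \<beta> n =
     1 / (real n)\<^sup>2 * ln (\<integral>G. exp ((real n)\<^sup>2 * hamiltonian k E \<beta> n G) \<partial>graph_law \<mu> n)"

definition exp_graph_law ::
    "real measure \<Rightarrow> nat \<Rightarrow> nat set set \<Rightarrow> real \<times> real \<Rightarrow> nat \<Rightarrow> wgraph measure" where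
  "exp_graph_law \<mu> k E \<beta> n =
     density (graph_law \<mu> n)
       (\<lambda>G. ennreal (exp ((real n)\<^sup>2 * (hamiltonian k E \<beta> n G - psi \<mu> k E \<beta> n))))"

text \<open>
  The individual laws do not determine a joint law of the sequence \<open>G\<^sub>1, G\<^sub>2, \<dots>\<close>. Almost sure
  statements about the sequence are therefore made for every joint law with the given marginals.
\<close>

definition joint_laws :: "(nat \<Rightarrow> 'a measure) \<Rightarrow> (nat \<Rightarrow> 'a) measure set" where
  "joint_laws P = {Q. prob_space Q \<and> sets Q = sets (PiM UNIV P) \<and>
                      (\<forall>n. distr Q (P n) (\<lambda>\<omega>. \<omega> n) = P n)}"


section \<open>The variational problem\<close>

definition objective :: "real measure \<Rightarrow> nat \<Rightarrow> real \<times> real \<Rightarrow> real \<Rightarrow> ereal" where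
  "objective \<mu> p \<beta> u = ereal (fst \<beta> * u + snd \<beta> * u ^ p) - ereal (1 / 2) * rate_fun \<mu> u"

definition is_maximizer :: "real measure \<Rightarrow> nat \<Rightarrow> real \<times> real \<Rightarrow> real \<Rightarrow> bool" where
  "is_maximizer \<mu> p \<beta> u \<longleftrightarrow>
     rate_fun \<mu> u < \<infinity> \<and> (\<forall>v. rate_fun \<mu> v < \<infinity> \<longrightarrow> objective \<mu> p \<beta> v \<le> objective \<mu> p \<beta> u)"

definition opt_u :: "real measure \<Rightarrow> nat \<Rightarrow> real \<times> real \<Rightarrow> real" where
  "opt_u \<mu> p \<beta> = (THE u. is_maximizer \<mu> p \<beta> u)"

definition is_dual :: "real measure \<Rightarrow> real \<Rightarrow> real \<Rightarrow> bool" where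
  "is_dual \<mu> u \<theta> \<longleftrightarrow> deriv (cumulant \<mu>) \<theta> = u"

definition opt_theta :: "real measure \<Rightarrow> nat \<Rightarrow> real \<times> real \<Rightarrow> real" where
  "opt_theta \<mu> p \<beta> = (THE \<theta>. is_dual \<mu> (opt_u \<mu> p \<beta>) \<theta>)"

definition region :: "(real \<times> real) set" where
  "region = {\<beta>. fst \<beta> < - snd \<beta> \<and> snd \<beta> \<ge> 0}"

text \<open>The filter of \<open>\<bar>\<beta>\<bar> \<rightarrow> \<infinity>\<close> inside the region.\<close>

definition far_in_region :: "(real \<times> real) filter" where
  "far_in_region = inf at_infinity (principal region)"

end

theory Submission
  imports Defs
begin

text \<open>
  The proof has two independent halves, a one-dimensional variational problem and a large
  deviation estimate in cut norm; an explicit pair of edge-weight laws settles the last claim.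

  \<^bold>\<open>The variational problem.\<close> Every \<open>u \<in> (0, 1)\<close> is \<open>K'(\<theta>)\<close> for a unique \<open>\<theta>\<close>, and there
  \<open>I(u) = \<theta> u - K(\<theta>)\<close>. Since \<open>\<mu>\<close> is symmetric and \<open>\<beta>\<^sub>1 + \<beta>\<^sub>2 < 0\<close>, reflecting \<open>u > 1/2\<close> to \<open>1 - u\<close>
  increases the objective, so maximizers lie in \<open>(0, 1/2]\<close>. There \<open>\<beta>\<^sub>1 u + \<beta>\<^sub>2 u\<^sup>p \<le> \<beta>\<^sub>1 u / 2\<close>, and
  comparison with a fixed small density forces every maximizer to \<open>0\<close> as \<open>\<beta>\<^sub>1 \<rightarrow> -\<infinity>\<close>
  (\<open>maximizer_small\<close>). The stationarity equation \<open>\<theta> = 2 (\<beta>\<^sub>1 + \<beta>\<^sub>2 p u\<^bsup>p-1\<^esup>)\<close> then yields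
  \<open>\<theta> / (2 \<beta>\<^sub>1) \<rightarrow> 1\<close>. Uniqueness needs that \<open>\<beta>\<^sub>1 + \<beta>\<^sub>2 p K'(\<theta>)\<^bsup>p-1\<^esup> - \<theta>/2\<close> is strictly decreasing on
  \<open>[2 \<beta>\<^sub>1, \<beta>\<^sub>1]\<close>, that is, \<open>\<bar>\<theta>\<bar> K'(\<theta>)\<^bsup>p-2\<^esup> K''(\<theta>) \<rightarrow> 0\<close>. The equation in the definition of admissibility
  says where the derivative of \<open>g = (K')\<^bsup>p-2\<^esup> K''\<close> vanishes; having only one such point, \<open>g\<close>
  increases near \<open>-\<infinity>\<close>, and then \<open>\<bar>\<theta>\<bar> g(\<theta>) / 2\<close> is at most the integral of \<open>g\<close> over
  \<open>[\<theta>, \<theta>/2]\<close>, which is at most \<open>K'(\<theta>/2)\<^bsup>p-1\<^esup>\<close> and tends to \<open>0\<close> (\<open>theta_curvature_vanishes\<close>).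

  \<^bold>\<open>The large deviation estimate.\<close> By Borel--Cantelli it suffices that the probability of a fixed
  cut-norm deviation from the maximizer \<open>u\<close> decays like \<open>exp (-c n\<^sup>2)\<close> (\<open>deviation_probability\<close>);
  this is the only place where the law of single graphs enters, so every joint law will do. The
  normalizing constant is bounded below by Jensen's inequality under the product law tilted by
  \<open>\<theta>\<close> (\<open>partition_function_lower_bound\<close>). For the upper bound, the weak regularity lemma replaces the
  weights by block averages over boundedly many blocks at a small cost in cut norm, hence,
  by the counting lemma, at a small cost in the density of \<open>H\<^sub>2\<close>. As \<open>\<beta>\<^sub>2 \<ge> 0\<close>, the inequality of
  arithmetic and geometric means bounds the density of the averaged matrix by its mean \<open>p\<close>-th power.
  The exponent is now a sum of one-variable expressions \<open>\<beta>\<^sub>1 y + \<beta>\<^sub>2 y\<^sup>p\<close>, each of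
  which is at most the maximum of the objective, minus a fixed amount if \<open>y\<close> is far from \<open>u\<close>, plus half of
  \<open>t y - K(t)\<close> for a suitable \<open>t\<close> in a finite set (\<open>separating_tilts\<close>). Since block averages are
  exact against functions of the blocks, these last terms add up to the logarithm of a tilting
  density of integral \<open>1\<close>. Only \<open>exp (O(n))\<close> choices of blocks and tilts occur, so a union bound
  finishes the estimate.

  \<^bold>\<open>Non-universality.\<close> For the mean of \<open>m\<close> fair coins, \<open>K'\<close> is the logistic function of \<open>\<theta>/m\<close>. Along
  \<open>\<beta>\<^sub>2 = 0\<close> the dual is exactly \<open>2 \<beta>\<^sub>1\<close>, so the densities for \<open>m = 1\<close> and \<open>m = 2\<close> are of the
  different orders \<open>exp (2 \<beta>\<^sub>1)\<close> and \<open>exp \<beta>\<^sub>1\<close>.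
\<close>


section \<open>Exponential tilting of an edge weight\<close>

lemma exp_second_order_bound:
  fixes y :: real
  assumes "\<bar>y\<bar> \<le> 1"
  shows "\<bar>exp y - 1 - y\<bar> \<le> y\<^sup>2"
proof (cases "0 \<le> y")
  case True
  have "exp y \<le> 1 + y + y\<^sup>2" using exp_bound[of y] True assms by simp
  then show ?thesis
    using exp_ge_add_one_self[of y] zero_le_power2[of y] unfolding abs_le_iff by linarith
next
  case False
  have "1 + (-y) + (-y)\<^sup>2 / 2 \<le> exp (-y)"
    using exp_lower_Taylor_quadratic[of "-y"] False by simp
  moreover have "(1 + y + y\<^sup>2) * (1 + (-y) + (-y)\<^sup>2 / 2) = 1 + (y\<^sup>2 / 2) * (1 - y + y\<^sup>2)"
    by (simp add: power2_eq_square field_simps)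
  moreover have "0 \<le> (y\<^sup>2 / 2) * (1 - y + y\<^sup>2)"
    using False by (intro mult_nonneg_nonneg) auto
  moreover have pos: "0 \<le> 1 + y + y\<^sup>2"
    using assms zero_le_power2[of y] by linarith
  ultimately have "1 \<le> (1 + y + y\<^sup>2) * exp (-y)"
    by (smt (verit) mult_left_mono)
  then have "exp y \<le> 1 + y + y\<^sup>2"
    by (simp add: exp_minus field_simps)
  then show ?thesis
    using exp_ge_add_one_self[of y] zero_le_power2[of y] unfolding abs_le_iff by linarith
qed

text \<open>
  The unnormalized moments of the law with density proportional to \<open>exp (\<theta> x)\<close>; in particular
  \<open>moment \<mu> 0\<close> is the moment generating function, and \<open>tilted_mean\<close> and \<open>tilted_var\<close> will turn
  out to be \<open>K'\<close> and \<open>K''\<close>.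
\<close>

definition moment :: "real measure \<Rightarrow> nat \<Rightarrow> real \<Rightarrow> real" where
  "moment \<mu> k \<theta> = (\<integral>x. x ^ k * exp (\<theta> * x) \<partial>\<mu>)"

definition tilted_mean :: "real measure \<Rightarrow> real \<Rightarrow> real" where
  "tilted_mean \<mu> \<theta> = moment \<mu> 1 \<theta> / moment \<mu> 0 \<theta>"

definition tilted_var :: "real measure \<Rightarrow> real \<Rightarrow> real" where
  "tilted_var \<mu> \<theta> = moment \<mu> 2 \<theta> / moment \<mu> 0 \<theta> - (tilted_mean \<mu> \<theta>)\<^sup>2"

locale edge_weight = prob_space \<mu> for \<mu> :: "real measure" +
  assumes sets_mu [measurable_cong]: "sets \<mu> = sets borel"
    and weight_in_unit: "AE x in \<mu>. x \<in> {0..1}"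
    and nondegenerate: "\<not> (\<exists>c. AE x in \<mu>. x = c)"
begin

lemma space_mu [simp]: "space \<mu> = UNIV"
  using sets_eq_imp_space_eq[OF sets_mu] by simp

lemma integrable_moment: "integrable \<mu> (\<lambda>x. x ^ k * exp (\<theta> * x))"
proof (rule integrable_const_bound)
  show "AE x in \<mu>. norm (x ^ k * exp (\<theta> * x)) \<le> exp \<bar>\<theta>\<bar>"
    using weight_in_unit
  proof eventually_elim
    case (elim x)
    have "x ^ k \<le> 1" "0 \<le> x ^ k" using elim by (auto intro: power_le_one)
    moreover have "\<theta> * x \<le> \<bar>\<theta>\<bar>"
      using elim by (smt (verit) atLeastAtMost_iff mult_left_le mult_minus_left mult_nonneg_nonneg)
    ultimately show ?case
      by (simp add: abs_mult) (smt (verit) exp_gt_zero exp_le_cancel_iff mult_left_le_one_le)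
  qed
qed measurable

lemma integrable_exp: "integrable \<mu> (\<lambda>x. exp (\<theta> * x))"
  using integrable_moment[of 0 \<theta>] by simp

lemma integrable_times_exp: "integrable \<mu> (\<lambda>x. x * exp (\<theta> * x))"
  using integrable_moment[of 1 \<theta>] by simp

lemma moment_pos: "0 < moment \<mu> 0 \<theta>"
proof -
  have "emeasure \<mu> {x \<in> space \<mu>. 0 < exp (\<theta> * x)} \<noteq> 0"
    using emeasure_space_1 by simp
  then have "moment \<mu> 0 \<theta> \<noteq> 0"
    unfolding moment_def using integral_nonneg_eq_0_iff_AE[OF integrable_exp[of \<theta>]] by simp
  moreover have "0 \<le> moment \<mu> 0 \<theta>" unfolding moment_def by simp
  ultimately show ?thesis by simp
qed

text \<open>
  Dominated convergence in quantitative form: the second-order remainder of the exponential is at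
  most \<open>(h x)\<^sup>2\<close>, so the error of the difference quotient is at most \<open>\<bar>h\<bar>\<close> times the moment of
  order \<open>k + 2\<close>.
\<close>

lemma DERIV_moment: "(moment \<mu> k has_real_derivative moment \<mu> (Suc k) \<theta>) (at \<theta>)"
proof -
  let ?C = "moment \<mu> (k + 2) \<theta>"
  have C: "0 \<le> ?C" unfolding moment_def
    by (rule integral_nonneg_AE) (use weight_in_unit in eventually_elim, auto)
  have bound: "\<bar>(moment \<mu> k (\<theta> + h) - moment \<mu> k \<theta>) / h - moment \<mu> (Suc k) \<theta>\<bar> \<le> ?C * \<bar>h\<bar>"
    if h: "h \<noteq> 0" "\<bar>h\<bar> \<le> 1" for h
  proof -
    have "moment \<mu> k (\<theta> + h) - moment \<mu> k \<theta> - h * moment \<mu> (Suc k) \<theta>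
        = (\<integral>x. x ^ k * exp ((\<theta> + h) * x) - x ^ k * exp (\<theta> * x) - h * (x ^ Suc k * exp (\<theta> * x)) \<partial>\<mu>)"
      unfolding moment_def
      using integrable_moment[of k "\<theta> + h"] integrable_moment[of k \<theta>] integrable_moment[of "Suc k" \<theta>]
      by simp
    also have "\<bar>\<dots>\<bar> \<le> (\<integral>x. h\<^sup>2 * (x ^ (k + 2) * exp (\<theta> * x)) \<partial>\<mu>)"
    proof (rule order_trans[OF integral_abs_bound], rule integral_mono_AE)
      show "AE x in \<mu>. \<bar>x ^ k * exp ((\<theta> + h) * x) - x ^ k * exp (\<theta> * x) - h * (x ^ Suc k * exp (\<theta> * x))\<bar>
          \<le> h\<^sup>2 * (x ^ (k + 2) * exp (\<theta> * x))"
        using weight_in_unit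
      proof eventually_elim
        case (elim x)
        have "\<bar>h * x\<bar> \<le> 1" using h elim by (simp add: abs_mult mult_le_one)
        then have b: "\<bar>exp (h * x) - 1 - h * x\<bar> \<le> (h * x)\<^sup>2" by (rule exp_second_order_bound)
        have "x ^ k * exp ((\<theta> + h) * x) - x ^ k * exp (\<theta> * x) - h * (x ^ Suc k * exp (\<theta> * x))
            = x ^ k * exp (\<theta> * x) * (exp (h * x) - 1 - h * x)"
          by (simp add: ring_distribs exp_add algebra_simps)
        then have "\<bar>x ^ k * exp ((\<theta> + h) * x) - x ^ k * exp (\<theta> * x) - h * (x ^ Suc k * exp (\<theta> * x))\<bar>
            = x ^ k * exp (\<theta> * x) * \<bar>exp (h * x) - 1 - h * x\<bar>"
          using elim by (simp add: abs_mult)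
        also have "\<dots> \<le> x ^ k * exp (\<theta> * x) * (h * x)\<^sup>2"
          using b elim by (intro mult_left_mono) auto
        finally show ?case by (simp add: power_mult_distrib power_add power2_eq_square mult_ac)
      qed
    qed (use integrable_moment[of k "\<theta> + h"] integrable_moment[of k \<theta>]
          integrable_moment[of "Suc k" \<theta>] integrable_moment[of "k + 2" \<theta>] in
          \<open>auto intro!: Bochner_Integration.integrable_diff integrable_mult_right simp del: power_Suc power_Suc2 power_add add_2_eq_Suc' simp flip: power_Suc\<close>)
    also have "\<dots> = h\<^sup>2 * ?C" by (simp add: moment_def)
    finally have "\<bar>moment \<mu> k (\<theta> + h) - moment \<mu> k \<theta> - h * moment \<mu> (Suc k) \<theta>\<bar> / \<bar>h\<bar> \<le> h\<^sup>2 * ?C / \<bar>h\<bar>"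
      by (rule divide_right_mono) simp
    moreover have "(moment \<mu> k (\<theta> + h) - moment \<mu> k \<theta>) / h - moment \<mu> (Suc k) \<theta>
        = (moment \<mu> k (\<theta> + h) - moment \<mu> k \<theta> - h * moment \<mu> (Suc k) \<theta>) / h"
      using h by (simp add: field_simps)
    moreover have "h\<^sup>2 * ?C / \<bar>h\<bar> = ?C * \<bar>h\<bar>"
      using h by (simp add: power2_eq_square field_simps abs_if)
    ultimately show ?thesis by (simp add: abs_divide)
  qed
  show ?thesis
    unfolding DERIV_def
  proof (rule LIM_zero_cancel, rule tendsto_rabs_zero_cancel, rule tendsto_sandwich[of "\<lambda>_. 0"])
    show "\<forall>\<^sub>F h in at 0. \<bar>(moment \<mu> k (\<theta> + h) - moment \<mu> k \<theta>) / h - moment \<mu> (Suc k) \<theta>\<bar> \<le> ?C * \<bar>h\<bar>"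
      unfolding eventually_at by (rule exI[of _ 1]) (use bound in \<open>auto simp: dist_real_def\<close>)
    show "((\<lambda>h. ?C * \<bar>h\<bar>) \<longlongrightarrow> 0) (at 0)"
      by (auto intro!: tendsto_eq_intros)
  qed auto
qed

lemma DERIV_moment' [derivative_intros]:
  "(f has_real_derivative d) (at x within S) \<Longrightarrow>
    ((\<lambda>x. moment \<mu> k (f x)) has_real_derivative moment \<mu> (Suc k) (f x) * d) (at x within S)"
  by (rule DERIV_chain2[OF DERIV_moment])

lemma cumulant_eq: "cumulant \<mu> \<theta> = ln (moment \<mu> 0 \<theta>)"
  by (simp add: cumulant_def moment_def)

lemma exp_cumulant: "exp (cumulant \<mu> \<theta>) = (\<integral>x. exp (\<theta> * x) \<partial>\<mu>)"
  using moment_pos[of \<theta>] by (simp add: cumulant_def moment_def)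

lemma DERIV_cumulant: "(cumulant \<mu> has_real_derivative tilted_mean \<mu> \<theta>) (at \<theta>)"
  unfolding cumulant_eq[abs_def] tilted_mean_def
  by (rule derivative_eq_intros refl moment_pos | simp)+

lemma DERIV_tilted_mean: "(tilted_mean \<mu> has_real_derivative tilted_var \<mu> \<theta>) (at \<theta>)"
  unfolding tilted_mean_def[abs_def] tilted_var_def using moment_pos[of \<theta>]
  by (auto intro!: derivative_eq_intros simp: field_simps power2_eq_square numeral_2_eq_2)

lemma tilted_var_differentiable: "\<exists>d. (tilted_var \<mu> has_real_derivative d) (at \<theta>)"
  unfolding tilted_var_def[abs_def] tilted_mean_def[abs_def] using moment_pos[of \<theta>]
  by (intro exI) (rule derivative_intros refl | simp)+

lemma DERIV_tilted_var: "(tilted_var \<mu> has_real_derivative (deriv ^^ 3) (cumulant \<mu>) \<theta>) (at \<theta>)"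
  and deriv_cumulant: "deriv (cumulant \<mu>) = tilted_mean \<mu>"
  and deriv2_cumulant: "(deriv ^^ 2) (cumulant \<mu>) = tilted_var \<mu>"
proof -
  show 1: "deriv (cumulant \<mu>) = tilted_mean \<mu>"
    using DERIV_cumulant DERIV_imp_deriv by blast
  have "deriv (tilted_mean \<mu>) = tilted_var \<mu>"
    using DERIV_tilted_mean DERIV_imp_deriv by blast
  then show 2: "(deriv ^^ 2) (cumulant \<mu>) = tilted_var \<mu>"
    by (simp add: numeral_2_eq_2 1)
  have "(deriv ^^ 3) (cumulant \<mu>) = deriv (tilted_var \<mu>)"
    using 2 by (simp add: numeral_3_eq_3 numeral_2_eq_2)
  then show "(tilted_var \<mu> has_real_derivative (deriv ^^ 3) (cumulant \<mu>) \<theta>) (at \<theta>)"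
    using tilted_var_differentiable DERIV_imp_deriv by metis
qed

lemma tilted_var_eq:
  "tilted_var \<mu> \<theta> * moment \<mu> 0 \<theta> = (\<integral>x. (x - tilted_mean \<mu> \<theta>)\<^sup>2 * exp (\<theta> * x) \<partial>\<mu>)"
proof -
  let ?m = "tilted_mean \<mu> \<theta>"
  have "(\<integral>x. (x - ?m)\<^sup>2 * exp (\<theta> * x) \<partial>\<mu>)
     = (\<integral>x. x ^ 2 * exp (\<theta> * x) - 2 * ?m * (x ^ 1 * exp (\<theta> * x)) + ?m\<^sup>2 * (x ^ 0 * exp (\<theta> * x)) \<partial>\<mu>)"
    by (rule Bochner_Integration.integral_cong) (auto simp: power2_eq_square algebra_simps)
  also have "\<dots> = moment \<mu> 2 \<theta> - 2 * ?m * moment \<mu> 1 \<theta> + ?m\<^sup>2 * moment \<mu> 0 \<theta>"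
    unfolding moment_def
    using integrable_moment[of 2 \<theta>] integrable_moment[of 1 \<theta>] integrable_moment[of 0 \<theta>]
    by (subst Bochner_Integration.integral_add Bochner_Integration.integral_diff; simp)+
  also have "\<dots> = tilted_var \<mu> \<theta> * moment \<mu> 0 \<theta>"
    using moment_pos[of \<theta>] by (simp add: tilted_var_def tilted_mean_def field_simps power2_eq_square)
  finally show ?thesis by simp
qed

text \<open>
  The variance of the tilted law vanishes only if the weight is almost surely constant.
\<close>

lemma tilted_var_pos: "0 < tilted_var \<mu> \<theta>"
proof -
  let ?f = "\<lambda>x. (x - tilted_mean \<mu> \<theta>)\<^sup>2 * exp (\<theta> * x)"
  have i: "integrable \<mu> ?f"
  proof -
    have "integrable \<mu> (\<lambda>x. x ^ 2 * exp (\<theta> * x) - 2 * tilted_mean \<mu> \<theta> * (x ^ 1 * exp (\<theta> * x))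
        + (tilted_mean \<mu> \<theta>)\<^sup>2 * (x ^ 0 * exp (\<theta> * x)))"
      by (intro Bochner_Integration.integrable_add Bochner_Integration.integrable_diff
          integrable_mult_right integrable_moment)
    then show ?thesis
      by (rule Bochner_Integration.integrable_cong[THEN iffD1, rotated 2])
        (auto simp: power2_eq_square algebra_simps)
  qed
  have "integral\<^sup>L \<mu> ?f \<noteq> 0"
  proof
    assume "integral\<^sup>L \<mu> ?f = 0"
    then have "AE x in \<mu>. ?f x = 0"
      using integral_nonneg_eq_0_iff_AE[OF i] by simp
    then have "AE x in \<mu>. x = tilted_mean \<mu> \<theta>" by simp
    then show False using nondegenerate by blast
  qed
  moreover have "0 \<le> integral\<^sup>L \<mu> ?f" by simp
  ultimately have "0 < tilted_var \<mu> \<theta> * moment \<mu> 0 \<theta>"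
    unfolding tilted_var_eq by linarith
  then show ?thesis using moment_pos[of \<theta>] by (simp add: zero_less_mult_iff)
qed

lemma moment_antimono: "moment \<mu> (Suc k) \<theta> \<le> moment \<mu> k \<theta>"
  unfolding moment_def
proof (rule integral_mono_AE[OF integrable_moment integrable_moment])
  show "AE x in \<mu>. x ^ Suc k * exp (\<theta> * x) \<le> x ^ k * exp (\<theta> * x)"
    using weight_in_unit by eventually_elim (auto intro!: mult_right_mono simp: mult_left_le_one_le)
qed

lemma tilted_mean_nonneg: "0 \<le> tilted_mean \<mu> \<theta>"
  unfolding tilted_mean_def using moment_pos[of \<theta>]
  by (intro divide_nonneg_pos) (auto simp: moment_def intro!: integral_nonneg_AE
      eventually_mono[OF weight_in_unit])

text \<open>
  On \<open>[0, 1]\<close> the second moment is at most the first. This makes \<open>K''\<close> vanish at \<open>-\<infinity>\<close> together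
  with \<open>K'\<close>.
\<close>

lemma tilted_var_le_mean: "tilted_var \<mu> \<theta> \<le> tilted_mean \<mu> \<theta>"
proof -
  have "moment \<mu> 2 \<theta> / moment \<mu> 0 \<theta> \<le> tilted_mean \<mu> \<theta>"
    unfolding tilted_mean_def using moment_antimono[of 1 \<theta>] moment_pos[of \<theta>]
    by (intro divide_right_mono) (auto simp: numeral_2_eq_2)
  then show ?thesis unfolding tilted_var_def by (smt (verit) zero_le_power2)
qed

lemma tilted_mean_pos: "0 < tilted_mean \<mu> \<theta>"
  using tilted_var_pos[of \<theta>] tilted_var_le_mean[of \<theta>] by simp

lemma tilted_mean_strict_mono: "a < b \<Longrightarrow> tilted_mean \<mu> a < tilted_mean \<mu> b"
  by (rule DERIV_pos_imp_increasing) (use DERIV_tilted_mean tilted_var_pos in blast)+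

lemma tilted_mean_less_iff: "tilted_mean \<mu> a < tilted_mean \<mu> b \<longleftrightarrow> a < b"
  using tilted_mean_strict_mono by (metis linorder_neqE less_asym less_irrefl)

lemma tilted_mean_le_iff: "tilted_mean \<mu> a \<le> tilted_mean \<mu> b \<longleftrightarrow> a \<le> b"
  using tilted_mean_less_iff by (metis not_le)

lemma tilted_mean_eq_iff: "tilted_mean \<mu> a = tilted_mean \<mu> b \<longleftrightarrow> a = b"
  using tilted_mean_le_iff by (metis order_antisym order_refl)

lemma isCont_tilted_mean: "isCont (tilted_mean \<mu>) \<theta>"
  using DERIV_tilted_mean DERIV_isCont by blast

lemma cumulant_0 [simp]: "cumulant \<mu> 0 = 0"
  using prob_space by (simp add: cumulant_def)

text \<open>
  Convexity of \<open>K\<close>, which makes \<open>\<theta>\<close> the optimal exponent in \<open>I(K'(\<theta>))\<close>.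
\<close>

lemma cumulant_tangent: "cumulant \<mu> \<theta> + tilted_mean \<mu> \<theta> * (s - \<theta>) \<le> cumulant \<mu> s"
proof (cases "\<theta> = s")
  case False
  consider "\<theta> < s" | "s < \<theta>" using False by linarith
  then show ?thesis
  proof cases
    case 1
    obtain z where z: "\<theta> < z" "z < s" "cumulant \<mu> s - cumulant \<mu> \<theta> = (s - \<theta>) * tilted_mean \<mu> z"
      using MVT2[OF 1, of "cumulant \<mu>" "tilted_mean \<mu>"] DERIV_cumulant by blast
    have "tilted_mean \<mu> \<theta> * (s - \<theta>) \<le> (s - \<theta>) * tilted_mean \<mu> z"
      using tilted_mean_strict_mono[OF z(1)] 1 by (simp add: mult.commute)
    then show ?thesis using z by linarith
  next
    case 2
    obtain z where z: "s < z" "z < \<theta>" "cumulant \<mu> \<theta> - cumulant \<mu> s = (\<theta> - s) * tilted_mean \<mu> z"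
      using MVT2[OF 2, of "cumulant \<mu>" "tilted_mean \<mu>"] DERIV_cumulant by blast
    have "(\<theta> - s) * tilted_mean \<mu> z \<le> (\<theta> - s) * tilted_mean \<mu> \<theta>"
      using tilted_mean_strict_mono[OF z(2)] 2 by simp
    then show ?thesis using z by (simp add: algebra_simps)
  qed
qed simp

lemma rate_fun_ge: "ereal (\<theta> * u - cumulant \<mu> \<theta>) \<le> rate_fun \<mu> u"
  unfolding rate_fun_def by (rule SUP_upper) simp

lemma rate_fun_nonneg: "0 \<le> rate_fun \<mu> u"
  using rate_fun_ge[of 0 u] by (simp add: zero_ereal_def)

lemma rate_fun_tilted_mean:
  "rate_fun \<mu> (tilted_mean \<mu> \<theta>) = ereal (\<theta> * tilted_mean \<mu> \<theta> - cumulant \<mu> \<theta>)"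
proof (rule antisym)
  show "rate_fun \<mu> (tilted_mean \<mu> \<theta>) \<le> ereal (\<theta> * tilted_mean \<mu> \<theta> - cumulant \<mu> \<theta>)"
    unfolding rate_fun_def
  proof (rule SUP_least)
    fix s
    show "ereal (s * tilted_mean \<mu> \<theta> - cumulant \<mu> s) \<le> ereal (\<theta> * tilted_mean \<mu> \<theta> - cumulant \<mu> \<theta>)"
      using cumulant_tangent[of \<theta> s] by (simp add: algebra_simps)
  qed
qed (rule rate_fun_ge)

lemma rate_at_mean_nonneg: "0 \<le> \<theta> * tilted_mean \<mu> \<theta> - cumulant \<mu> \<theta>"
  using rate_fun_nonneg[of "tilted_mean \<mu> \<theta>"] by (simp add: rate_fun_tilted_mean)

lemma cumulant_mono: "a \<le> b \<Longrightarrow> cumulant \<mu> a \<le> cumulant \<mu> b"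
  by (rule DERIV_nonneg_imp_nondecreasing) (use DERIV_cumulant tilted_mean_nonneg in blast)+

lemma rate_fun_neg:
  assumes "u < 0"
  shows "rate_fun \<mu> u = \<infinity>"
proof (rule ereal_top)
  fix B
  have "B \<le> (- (\<bar>B\<bar> / \<bar>u\<bar>)) * u - cumulant \<mu> (- (\<bar>B\<bar> / \<bar>u\<bar>))"
  proof -
    have "cumulant \<mu> (- (\<bar>B\<bar> / \<bar>u\<bar>)) \<le> 0"
      using cumulant_mono[of "- (\<bar>B\<bar> / \<bar>u\<bar>)" 0] by simp
    moreover have "(- (\<bar>B\<bar> / \<bar>u\<bar>)) * u = \<bar>B\<bar>" using assms by simp
    ultimately show ?thesis by linarith
  qed
  then show "ereal B \<le> rate_fun \<mu> u" using rate_fun_ge order_trans ereal_less_eq(3) by blast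
qed

end


section \<open>The variational problem\<close>

locale symmetric_weight = edge_weight +
  assumes zero_in_support: "0 \<in> topological_support \<mu>"
    and symmetric: "distr \<mu> borel (\<lambda>x. 1 - x) = \<mu>"
begin

text \<open>
  Under strong negative tilting the mass concentrates near the left end \<open>0\<close> of the support: weights
  above \<open>d\<close> carry at most \<open>exp (\<theta> d)\<close>, while those below \<open>d / 2\<close>, which have positive
  probability, already carry a multiple of \<open>exp (\<theta> d / 2)\<close>.
\<close>

lemma tilted_mean_vanishes:
  assumes \<epsilon>: "0 < \<epsilon>"
  shows "\<exists>R. \<forall>\<theta>\<le>R. tilted_mean \<mu> \<theta> \<le> \<epsilon>"
proof -
  define d where "d = \<epsilon> / 2"
  define q where "q = prob {..<d / 2}"
  have d: "0 < d" using \<epsilon> by (simp add: d_def)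
  have "emeasure \<mu> {..<d / 2} \<noteq> 0"
    using zero_in_support d unfolding topological_support_def by auto
  then have q: "0 < q"
    unfolding q_def using emeasure_eq_measure by (metis ennreal_0 measure_nonneg less_eq_real_def)
  have bound: "tilted_mean \<mu> \<theta> \<le> d + exp (\<theta> * d / 2) / q" if \<theta>: "\<theta> \<le> 0" for \<theta>
  proof -
    have "moment \<mu> 1 \<theta> \<le> (\<integral>x. d * exp (\<theta> * x) + exp (\<theta> * d) \<partial>\<mu>)"
      unfolding moment_def
    proof (rule integral_mono_AE)
      show "AE x in \<mu>. x ^ 1 * exp (\<theta> * x) \<le> d * exp (\<theta> * x) + exp (\<theta> * d)"
        using weight_in_unit
      proof eventually_elim
        case (elim x)
        show ?case
        proof (cases "x \<le> d")
          case True
          then have "x * exp (\<theta> * x) \<le> d * exp (\<theta> * x)" by simp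
          then show ?thesis by (simp add: add_increasing2)
        next
          case False
          have "x * exp (\<theta> * x) \<le> 1 * exp (\<theta> * d)"
            using False elim \<theta> by (intro mult_mono) (auto intro: mult_left_mono_neg)
          then show ?thesis using d by (simp add: add_increasing)
        qed
      qed
    qed (use integrable_moment[of 1 \<theta>] integrable_exp[of \<theta>] in auto)
    also have "\<dots> = d * moment \<mu> 0 \<theta> + exp (\<theta> * d)"
      using integrable_exp[of \<theta>] prob_space by (simp add: moment_def)
    finally have m1: "moment \<mu> 1 \<theta> \<le> d * moment \<mu> 0 \<theta> + exp (\<theta> * d)" .
    have "exp (\<theta> * d / 2) * q = (\<integral>x. exp (\<theta> * d / 2) * indicator {..<d / 2} x \<partial>\<mu>)"
      unfolding q_def by simp
    also have "\<dots> \<le> moment \<mu> 0 \<theta>"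
      unfolding moment_def
    proof (rule integral_mono)
      show "integrable \<mu> (\<lambda>x. exp (\<theta> * d / 2) * indicator {..<d / 2} x)"
        by (intro integrable_mult_right integrable_real_indicator) (auto simp: emeasure_eq_measure)
      show "exp (\<theta> * d / 2) * indicator {..<d / 2} x \<le> x ^ 0 * exp (\<theta> * x)" for x
        using \<theta> by (auto simp: indicator_def intro: mult_left_mono_neg[of x "d / 2" \<theta>, simplified])
    qed (rule integrable_moment)
    finally have m0: "exp (\<theta> * d / 2) * q \<le> moment \<mu> 0 \<theta>" .
    have "tilted_mean \<mu> \<theta> \<le> (d * moment \<mu> 0 \<theta> + exp (\<theta> * d)) / moment \<mu> 0 \<theta>"
      unfolding tilted_mean_def using m1 moment_pos[of \<theta>] by (simp add: divide_right_mono)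
    also have "\<dots> = d + exp (\<theta> * d) / moment \<mu> 0 \<theta>"
      using moment_pos[of \<theta>] by (simp add: add_divide_distrib)
    also have "exp (\<theta> * d) / moment \<mu> 0 \<theta> \<le> exp (\<theta> * d) / (exp (\<theta> * d / 2) * q)"
      using m0 q by (intro divide_left_mono) (auto intro!: mult_pos_pos moment_pos)
    also have "exp (\<theta> * d) = exp (\<theta> * d / 2) * exp (\<theta> * d / 2)"
      by (simp flip: exp_add)
    finally show ?thesis by simp
  qed
  have "tilted_mean \<mu> \<theta> \<le> \<epsilon>" if \<theta>: "\<theta> \<le> min 0 (2 * ln (q * d) / d)" for \<theta>
  proof -
    have "\<theta> * d / 2 \<le> ln (q * d)" using \<theta> d by (simp add: field_simps)
    then have "exp (\<theta> * d / 2) \<le> q * d" using q d by (metis exp_le_cancel_iff exp_ln mult_pos_pos)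
    then have "exp (\<theta> * d / 2) / q \<le> d" using q by (simp add: divide_le_eq mult.commute)
    moreover have "tilted_mean \<mu> \<theta> \<le> d + exp (\<theta> * d / 2) / q" using bound \<theta> by simp
    ultimately show ?thesis unfolding d_def by linarith
  qed
  then show ?thesis by blast
qed

lemma cumulant_reflect: "cumulant \<mu> \<theta> = \<theta> + cumulant \<mu> (- \<theta>)"
proof -
  have "moment \<mu> 0 \<theta> = (\<integral>x. exp (\<theta> * x) \<partial>distr \<mu> borel (\<lambda>x. 1 - x))"
    unfolding symmetric by (simp add: moment_def)
  also have "\<dots> = (\<integral>x. exp (\<theta> * (1 - x)) \<partial>\<mu>)"
    by (rule integral_distr) measurable
  also have "\<dots> = (\<integral>x. exp \<theta> * exp (- \<theta> * x) \<partial>\<mu>)"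
    by (rule Bochner_Integration.integral_cong) (auto simp: algebra_simps simp flip: exp_add)
  also have "\<dots> = exp \<theta> * moment \<mu> 0 (- \<theta>)"
    by (simp add: moment_def)
  finally have "ln (moment \<mu> 0 \<theta>) = ln (exp \<theta> * moment \<mu> 0 (- \<theta>))" by simp
  then show ?thesis using moment_pos[of "-\<theta>"] by (simp add: cumulant_eq ln_mult)
qed

lemma tilted_mean_reflect: "tilted_mean \<mu> (- \<theta>) = 1 - tilted_mean \<mu> \<theta>"
proof -
  have "((\<lambda>t. t + cumulant \<mu> (- t)) has_real_derivative 1 + tilted_mean \<mu> (- \<theta>) * (- 1)) (at \<theta>)"
    by (intro derivative_intros DERIV_chain2[OF DERIV_cumulant]) 
  moreover have "(\<lambda>t. t + cumulant \<mu> (- t)) = cumulant \<mu>"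
    by (rule ext) (rule cumulant_reflect[symmetric])
  ultimately have "tilted_mean \<mu> \<theta> = 1 - tilted_mean \<mu> (- \<theta>)"
    using DERIV_cumulant[of \<theta>] DERIV_unique by fastforce
  then show ?thesis by simp
qed

lemma tilted_mean_0: "tilted_mean \<mu> 0 = 1 / 2"
  using tilted_mean_reflect[of 0] by simp

lemma tilted_mean_less_1: "tilted_mean \<mu> \<theta> < 1"
  using tilted_mean_pos[of "- \<theta>"] tilted_mean_reflect[of \<theta>] by simp

lemma rate_fun_reflect: "rate_fun \<mu> (1 - u) = rate_fun \<mu> u"
proof -
  have le: "rate_fun \<mu> (1 - u) \<le> rate_fun \<mu> u" for u
    unfolding rate_fun_def[of \<mu> "1 - u"]
  proof (rule SUP_least)
    fix \<theta>
    have "\<theta> * (1 - u) - cumulant \<mu> \<theta> = (- \<theta>) * u - cumulant \<mu> (- \<theta>)"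
      using cumulant_reflect[of \<theta>] by (simp add: algebra_simps)
    then show "ereal (\<theta> * (1 - u) - cumulant \<mu> \<theta>) \<le> rate_fun \<mu> u"
      using rate_fun_ge[of "- \<theta>" u] by simp
  qed
  show ?thesis using le[of u] le[of "1 - u"] by simp
qed

lemma rate_fun_finite_imp_unit: "rate_fun \<mu> u < \<infinity> \<Longrightarrow> u \<in> {0..1}"
  using rate_fun_neg[of u] rate_fun_neg[of "1 - u"] rate_fun_reflect[of u]
  by (cases "u < 0"; cases "1 < u") auto

text \<open>
  The intermediate value theorem on a symmetric interval; reflection turns the limit \<open>0\<close> at \<open>-\<infinity>\<close>
  into the limit \<open>1\<close> at \<open>\<infinity>\<close>.
\<close>

lemma tilted_mean_onto:
  assumes "0 < u" "u < 1"
  obtains \<theta> where "tilted_mean \<mu> \<theta> = u"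
proof -
  obtain R where R: "\<forall>\<theta>\<le>R. tilted_mean \<mu> \<theta> \<le> u" using tilted_mean_vanishes assms by blast
  obtain R' where R': "\<forall>\<theta>\<le>R'. tilted_mean \<mu> \<theta> \<le> 1 - u"
    using tilted_mean_vanishes[of "1 - u"] assms by auto
  define a where "a = min R (min R' 0)"
  have a: "a \<le> 0" "a \<le> R" "a \<le> R'" by (auto simp: a_def)
  have "tilted_mean \<mu> (- a) = 1 - tilted_mean \<mu> a" by (rule tilted_mean_reflect)
  moreover have "tilted_mean \<mu> a \<le> u" "tilted_mean \<mu> a \<le> 1 - u" using R R' a by auto
  ultimately have "\<exists>\<theta>\<ge>a. \<theta> \<le> - a \<and> tilted_mean \<mu> \<theta> = u"
    using a by (intro IVT) (auto intro: isCont_tilted_mean)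
  then show ?thesis using that by blast
qed

end

text \<open>
  This says that \<open>v\<^sup>p - (1 - v)\<^sup>p\<close> is largest for \<open>p = 1\<close>, so that on the boundary
  \<open>\<beta>\<^sub>1 = - \<beta>\<^sub>2\<close> of the region the terms in \<open>\<beta>\<close> do not favour \<open>v\<close> over \<open>1 - v\<close>.
\<close>

lemma power_diff_reflect:
  fixes v :: real
  assumes "1 / 2 \<le> v" "v \<le> 1"
  shows "v ^ Suc q - (1 - v) ^ Suc q \<le> 2 * v - 1"
proof (induction q)
  case (Suc q)
  have "(1 - v) ^ q \<le> v ^ q" using assms by (intro power_mono) auto
  then have "0 \<le> v * (1 - v) * (v ^ q - (1 - v) ^ q)" using assms by simp
  moreover have "v ^ Suc (Suc q) - (1 - v) ^ Suc (Suc q)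
      = v ^ Suc q - (1 - v) ^ Suc q - v * (1 - v) * (v ^ q - (1 - v) ^ q)"
    by (simp add: algebra_simps)
  ultimately show ?case using Suc by linarith
qed simp

text \<open>
  The objective in the dual variable, with the rate function replaced by its value
  \<open>\<theta> K'(\<theta>) - K(\<theta>)\<close> at \<open>K'(\<theta>)\<close>.
\<close>

definition dual_objective :: "real measure \<Rightarrow> nat \<Rightarrow> real \<times> real \<Rightarrow> real \<Rightarrow> real" where
  "dual_objective \<mu> p \<beta> \<theta> = fst \<beta> * tilted_mean \<mu> \<theta> + snd \<beta> * tilted_mean \<mu> \<theta> ^ p
     - (\<theta> * tilted_mean \<mu> \<theta> - cumulant \<mu> \<theta>) / 2"

text \<open>
  The derivative of the objective with respect to the density, at \<open>u = K'(\<theta>)\<close>.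
\<close>

definition stationarity :: "real measure \<Rightarrow> nat \<Rightarrow> real \<times> real \<Rightarrow> real \<Rightarrow> real" where
  "stationarity \<mu> p \<beta> \<theta> = fst \<beta> + snd \<beta> * (real p * tilted_mean \<mu> \<theta> ^ (p - 1)) - \<theta> / 2"

lemma (in edge_weight) objective_tilted_mean:
  "objective \<mu> p \<beta> (tilted_mean \<mu> \<theta>) = ereal (dual_objective \<mu> p \<beta> \<theta>)"
  by (simp add: objective_def dual_objective_def rate_fun_tilted_mean)

lemma (in edge_weight) DERIV_dual_objective:
  "(dual_objective \<mu> p \<beta> has_real_derivative tilted_var \<mu> \<theta> * stationarity \<mu> p \<beta> \<theta>) (at \<theta>)"
  unfolding dual_objective_def[abs_def] stationarity_def
  by (auto intro!: derivative_eq_intros DERIV_chain2[OF DERIV_tilted_mean] DERIV_chain2[OF DERIV_cumulant]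
      simp: algebra_simps)

context symmetric_weight
begin

text \<open>
  The rate function is symmetric, so only the terms in \<open>\<beta>\<close> matter; they change by at least
  \<open>- (\<beta>\<^sub>1 + \<beta>\<^sub>2) (2 v - 1) > 0\<close>.
\<close>

lemma objective_reflect:
  assumes \<beta>: "\<beta> \<in> region" and p: "0 < p" and v: "1 / 2 < v" and fin: "rate_fun \<mu> v < \<infinity>"
  shows "objective \<mu> p \<beta> v < objective \<mu> p \<beta> (1 - v)"
proof -
  obtain r where r: "rate_fun \<mu> v = ereal r"
    using fin rate_fun_nonneg[of v] by (cases "rate_fun \<mu> v") auto
  obtain q where q: "p = Suc q" using p by (cases p) auto
  have "v \<le> 1" using rate_fun_finite_imp_unit[OF fin] by simp
  then have "snd \<beta> * (v ^ p - (1 - v) ^ p) \<le> snd \<beta> * (2 * v - 1)"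
    using power_diff_reflect[of v q] v \<beta> by (intro mult_left_mono) (auto simp: q region_def)
  moreover have "(fst \<beta> + snd \<beta>) * (2 * v - 1) < 0"
    using v \<beta> by (simp add: region_def mult_less_0_iff)
  ultimately show ?thesis
    by (simp add: objective_def rate_fun_reflect r algebra_simps)
qed

text \<open>
  The dual objective increases up to \<open>2 \<beta>\<^sub>1\<close>, reflection handles \<open>\<theta> > 0\<close>, and in between
  compactness applies. The boundary density \<open>0\<close>, which has finite rate if \<open>\<mu>\<close> has an atom there,
  is not better than \<open>\<theta> = 2 \<beta>\<^sub>1\<close>.
\<close>

lemma maximizer_exists:
  assumes \<beta>: "\<beta> \<in> region" and p: "0 < p"
  shows "\<exists>\<theta>. is_maximizer \<mu> p \<beta> (tilted_mean \<mu> \<theta>)"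
proof -
  let ?a = "2 * fst \<beta>"
  have a: "?a < 0" and b2: "0 \<le> snd \<beta>" using \<beta> by (auto simp: region_def)
  obtain \<theta>' where \<theta>': "?a \<le> \<theta>'" "\<theta>' \<le> 0"
    "\<And>\<theta>. ?a \<le> \<theta> \<Longrightarrow> \<theta> \<le> 0 \<Longrightarrow> dual_objective \<mu> p \<beta> \<theta> \<le> dual_objective \<mu> p \<beta> \<theta>'"
    using isCont_eq_Ub[of ?a 0 "dual_objective \<mu> p \<beta>"] DERIV_isCont[OF DERIV_dual_objective] a
    by (metis less_imp_le)
  have left: "objective \<mu> p \<beta> v \<le> ereal (dual_objective \<mu> p \<beta> \<theta>')"
    if fin: "rate_fun \<mu> v < \<infinity>" and v: "v \<le> 1 / 2" for v
  proof (cases "v = 0")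
    case True
    obtain r where r: "rate_fun \<mu> v = ereal r"
      using fin rate_fun_nonneg[of v] by (cases "rate_fun \<mu> v") auto
    have "- cumulant \<mu> ?a \<le> r" using rate_fun_ge[of ?a v] True r by simp
    moreover have "0 \<le> snd \<beta> * tilted_mean \<mu> ?a ^ p"
      using b2 tilted_mean_nonneg[of ?a] by simp
    ultimately have "- r / 2 \<le> dual_objective \<mu> p \<beta> ?a"
      by (simp add: dual_objective_def algebra_simps)
    also have "\<dots> \<le> dual_objective \<mu> p \<beta> \<theta>'" using \<theta>'(3)[of ?a] a by simp
    finally show ?thesis using True p r by (simp add: objective_def power_0_left)
  next
    case False
    then have "0 < v" using rate_fun_finite_imp_unit[OF fin] by simp
    then obtain \<theta> where \<theta>: "tilted_mean \<mu> \<theta> = v" using tilted_mean_onto[of v] v by auto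
    have "\<theta> \<le> 0" using v tilted_mean_le_iff[of \<theta> 0] \<theta> tilted_mean_0 by simp
    moreover have "dual_objective \<mu> p \<beta> \<theta> \<le> dual_objective \<mu> p \<beta> ?a" if below: "\<theta> \<le> ?a"
    proof (rule DERIV_nonneg_imp_nondecreasing[OF below])
      fix t assume t: "\<theta> \<le> t" "t \<le> ?a"
      have "0 \<le> snd \<beta> * (real p * tilted_mean \<mu> t ^ (p - 1))"
        using b2 tilted_mean_nonneg[of t] by simp
      then have "0 \<le> stationarity \<mu> p \<beta> t" using t by (simp add: stationarity_def)
      then show "\<exists>y. (dual_objective \<mu> p \<beta> has_real_derivative y) (at t) \<and> 0 \<le> y"
        using DERIV_dual_objective[of p \<beta> t] tilted_var_pos[of t] by (metis mult_nonneg_nonneg less_imp_le)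
    qed
    ultimately have "dual_objective \<mu> p \<beta> \<theta> \<le> dual_objective \<mu> p \<beta> \<theta>'"
      using \<theta>'(3)[of \<theta>] \<theta>'(3)[of ?a] a by fastforce
    then show ?thesis unfolding \<theta>[symmetric] objective_tilted_mean by simp
  qed
  have "objective \<mu> p \<beta> v \<le> ereal (dual_objective \<mu> p \<beta> \<theta>')" if fin: "rate_fun \<mu> v < \<infinity>" for v
  proof (cases "v \<le> 1 / 2")
    case False
    then have "objective \<mu> p \<beta> v < objective \<mu> p \<beta> (1 - v)"
      using objective_reflect[OF \<beta> p _ fin] by simp
    also have "\<dots> \<le> ereal (dual_objective \<mu> p \<beta> \<theta>')"
      using left[of "1 - v"] fin False by (simp add: rate_fun_reflect)
    finally show ?thesis by simp
  qed (use left fin in blast)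
  then have "is_maximizer \<mu> p \<beta> (tilted_mean \<mu> \<theta>')"
    by (simp add: is_maximizer_def objective_tilted_mean rate_fun_tilted_mean)
  then show ?thesis by blast
qed

text \<open>
  The reflection excludes densities above \<open>1/2\<close>, and a dual variable below \<open>2 \<beta>\<^sub>1\<close> beats
  the boundary density \<open>0\<close>. What remains is an interior maximum.
\<close>

lemma maximizer_stationary:
  assumes \<beta>: "\<beta> \<in> region" and p: "0 < p" and u: "is_maximizer \<mu> p \<beta> u"
  obtains \<theta> where "u = tilted_mean \<mu> \<theta>" "u \<le> 1 / 2" "stationarity \<mu> p \<beta> \<theta> = 0"
proof -
  have fin: "rate_fun \<mu> u < \<infinity>" and max: "\<And>v. rate_fun \<mu> v < \<infinity> \<Longrightarrow> objective \<mu> p \<beta> v \<le> objective \<mu> p \<beta> u"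
    using u by (auto simp: is_maximizer_def)
  have half: "u \<le> 1 / 2"
  proof (rule ccontr)
    assume "\<not> u \<le> 1 / 2"
    then have "objective \<mu> p \<beta> u < objective \<mu> p \<beta> (1 - u)" using objective_reflect[OF \<beta> p _ fin] by simp
    then show False using max[of "1 - u"] fin by (simp add: rate_fun_reflect)
  qed
  have "u \<noteq> 0"
  proof
    assume u0: "u = 0"
    let ?t = "2 * fst \<beta> - 1"
    obtain r where r: "rate_fun \<mu> u = ereal r"
      using fin rate_fun_nonneg[of u] by (cases "rate_fun \<mu> u") auto
    have "- cumulant \<mu> ?t \<le> r" using rate_fun_ge[of ?t u] u0 r by simp
    moreover have "0 \<le> snd \<beta> * tilted_mean \<mu> ?t ^ p"
      using \<beta> tilted_mean_nonneg[of ?t] by (simp add: region_def)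
    moreover have "dual_objective \<mu> p \<beta> ?t
        = tilted_mean \<mu> ?t / 2 + snd \<beta> * tilted_mean \<mu> ?t ^ p + cumulant \<mu> ?t / 2"
      by (simp add: dual_objective_def field_simps)
    ultimately have "- r / 2 < dual_objective \<mu> p \<beta> ?t"
      using tilted_mean_pos[of ?t] by linarith
    moreover have "dual_objective \<mu> p \<beta> ?t \<le> - r / 2"
      using max[of "tilted_mean \<mu> ?t"] u0 r p
      by (simp add: rate_fun_tilted_mean objective_tilted_mean) (simp add: objective_def power_0_left)
    ultimately show False by simp
  qed
  then have "0 < u" using rate_fun_finite_imp_unit[OF fin] by simp
  then obtain \<theta> where \<theta>: "tilted_mean \<mu> \<theta> = u" using tilted_mean_onto[of u] half by auto
  have "dual_objective \<mu> p \<beta> t \<le> dual_objective \<mu> p \<beta> \<theta>" for t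
    using max[of "tilted_mean \<mu> t"] by (simp add: \<theta>[symmetric] rate_fun_tilted_mean objective_tilted_mean)
  then have "tilted_var \<mu> \<theta> * stationarity \<mu> p \<beta> \<theta> = 0"
    using DERIV_local_max[OF DERIV_dual_objective[of p \<beta> \<theta>], of 1] by simp
  then have "stationarity \<mu> p \<beta> \<theta> = 0" using tilted_var_pos[of \<theta>] by simp
  then show ?thesis using that \<theta> half by blast
qed

text \<open>
  For \<open>u \<le> 1/2\<close> the interaction gains at most half of what the edge term costs, so the objective
  at \<open>u\<close> is at most \<open>\<beta>\<^sub>1 u / 2\<close>. A fixed density \<open>m \<le> \<epsilon> / 4\<close> of finite rate \<open>I\<close> achieves
  at least \<open>\<beta>\<^sub>1 m - I / 2\<close>.
\<close>

lemma maximizer_small: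
  assumes \<epsilon>: "0 < \<epsilon>" and p: "2 \<le> p"
  shows "\<exists>R. \<forall>\<beta>\<in>region. fst \<beta> \<le> R \<longrightarrow> (\<forall>u. is_maximizer \<mu> p \<beta> u \<longrightarrow> u \<le> \<epsilon>)"
proof -
  obtain \<theta> where \<theta>: "tilted_mean \<mu> \<theta> \<le> \<epsilon> / 4"
    using tilted_mean_vanishes[of "\<epsilon> / 4"] \<epsilon> by auto
  define m I where "m = tilted_mean \<mu> \<theta>" and "I = \<theta> * m - cumulant \<mu> \<theta>"
  have I: "0 \<le> I" unfolding I_def m_def by (rule rate_at_mean_nonneg)
  have m: "0 < m" "m \<le> \<epsilon> / 4" using tilted_mean_pos \<theta> by (auto simp: m_def)
  have "u \<le> \<epsilon>" if \<beta>: "\<beta> \<in> region" and R: "fst \<beta> \<le> - (2 * I / \<epsilon>)" and u: "is_maximizer \<mu> p \<beta> u" for \<beta> u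
  proof -
    obtain s where s: "u = tilted_mean \<mu> s" "u \<le> 1 / 2"
      using maximizer_stationary[OF \<beta> _ u] p by (metis zero_less_numeral order_less_le_trans)
    have b: "fst \<beta> < 0" "0 \<le> snd \<beta>" "snd \<beta> \<le> - fst \<beta>" using \<beta> by (auto simp: region_def)
    have "dual_objective \<mu> p \<beta> \<theta> \<le> dual_objective \<mu> p \<beta> s"
      using u by (auto simp: is_maximizer_def s(1) rate_fun_tilted_mean objective_tilted_mean
          dest: spec[of _ "tilted_mean \<mu> \<theta>"])
    moreover have "fst \<beta> * m - I / 2 \<le> dual_objective \<mu> p \<beta> \<theta>"
      using b m by (simp add: dual_objective_def I_def m_def)
    moreover have "dual_objective \<mu> p \<beta> s \<le> fst \<beta> * u + snd \<beta> * u ^ p"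
      using rate_at_mean_nonneg[of s] by (simp add: dual_objective_def s(1))
    moreover have "snd \<beta> * u ^ p \<le> - fst \<beta> * (u / 2)"
    proof (rule mult_mono)
      have "0 \<le> u" using s(1) tilted_mean_nonneg by simp
      then have "u ^ p \<le> u ^ 2" using p s(2) by (intro power_decreasing) auto
      also have "\<dots> \<le> u / 2" using s(2) \<open>0 \<le> u\<close> mult_right_mono[of u "1/2" u] by (simp add: power2_eq_square)
      finally show "u ^ p \<le> u / 2" .
      show "0 \<le> u ^ p" using \<open>0 \<le> u\<close> by simp
    qed (use b in auto)
    ultimately have "- fst \<beta> * u \<le> I + 2 * (- fst \<beta> * m)" by (simp add: field_simps)
    also have "I \<le> - fst \<beta> * (\<epsilon> / 2)" using R \<epsilon> by (simp add: field_simps)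
    also have "- fst \<beta> * m \<le> - fst \<beta> * (\<epsilon> / 4)" using m b by (intro mult_left_mono) auto
    finally have "- fst \<beta> * u \<le> - fst \<beta> * \<epsilon>" by (simp add: algebra_simps)
    then show ?thesis by (rule mult_left_le_imp_le) (use b in simp)
  qed
  then show ?thesis by blast
qed

end

locale admissible_weight = symmetric_weight +
  fixes p :: nat
  assumes p: "2 \<le> p"
    and inflection: "\<exists>!\<theta>. (deriv ^^ 3) (cumulant \<mu>) \<theta> * deriv (cumulant \<mu>) \<theta>
              = - (real p - 2) * ((deriv ^^ 2) (cumulant \<mu>) \<theta>)\<^sup>2"
begin

definition curvature :: "real \<Rightarrow> real" where
  "curvature \<theta> = tilted_mean \<mu> \<theta> ^ (p - 2) * tilted_var \<mu> \<theta>"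

lemma curvature_pos: "0 < curvature \<theta>"
  unfolding curvature_def using tilted_mean_pos tilted_var_pos by simp

text \<open>
  Up to a positive factor, the derivative is the difference of the two sides of the equation in the
  definition of admissibility. It is multiplied by the mean because \<open>(K')\<^bsup>p-3\<^esup>\<close> would appear otherwise.
\<close>

lemma DERIV_curvature:
  obtains d where "(curvature has_real_derivative d) (at \<theta>)"
    "d * tilted_mean \<mu> \<theta> = tilted_mean \<mu> \<theta> ^ (p - 2) *
       ((deriv ^^ 3) (cumulant \<mu>) \<theta> * tilted_mean \<mu> \<theta> + (real p - 2) * (tilted_var \<mu> \<theta>)\<^sup>2)"
proof -
  let ?T = "(deriv ^^ 3) (cumulant \<mu>) \<theta>" and ?m = "tilted_mean \<mu> \<theta>" and ?V = "tilted_var \<mu> \<theta>"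
  have "(curvature has_real_derivative
     (real (p - 2) * ?m ^ (p - 2 - 1) * ?V) * ?V + ?T * ?m ^ (p - 2)) (at \<theta>)"
    unfolding curvature_def[abs_def]
    using DERIV_mult[OF DERIV_power[OF DERIV_tilted_mean, of "p - 2" \<theta>] DERIV_tilted_var[of \<theta>]]
    by (simp add: mult_ac)
  moreover have "((real (p - 2) * ?m ^ (p - 2 - 1) * ?V) * ?V + ?T * ?m ^ (p - 2)) * ?m
      = ?m ^ (p - 2) * (?T * ?m + (real p - 2) * ?V\<^sup>2)"
  proof (cases "p = 2")
    case False
    then obtain q where "p = Suc (Suc (Suc q))" using p by (metis Suc_1 le_SucE Suc_le_D le_antisym not_less_eq_eq numeral_2_eq_2)
    then show ?thesis by (simp add: power2_eq_square algebra_simps)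
  qed simp
  ultimately show ?thesis using that by blast
qed

lemma curvature_le: "curvature \<theta> \<le> tilted_mean \<mu> \<theta>"
proof -
  have "tilted_mean \<mu> \<theta> ^ (p - 2) \<le> 1"
    using tilted_mean_nonneg[of \<theta>] tilted_mean_less_1[of \<theta>] by (simp add: power_le_one)
  then have "curvature \<theta> \<le> 1 * tilted_var \<mu> \<theta>"
    unfolding curvature_def using tilted_var_pos[of \<theta>] by (intro mult_right_mono) auto
  then show ?thesis using tilted_var_le_mean[of \<theta>] by simp
qed

lemma isCont_curvature: "isCont curvature \<theta>"
  using DERIV_curvature DERIV_isCont by metis

text \<open>
  To the left of the only critical point the curvature is injective by Rolle's theorem, hence
  monotone. It cannot decrease, being positive with limit \<open>0\<close> at \<open>-\<infinity>\<close>.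
\<close>

lemma curvature_increasing: "\<exists>R. \<forall>a b. a < b \<longrightarrow> b \<le> R \<longrightarrow> curvature a \<le> curvature b"
proof -
  obtain \<theta>\<^sub>0 where uniq: "\<And>\<theta>. (deriv ^^ 3) (cumulant \<mu>) \<theta> * tilted_mean \<mu> \<theta>
              = - (real p - 2) * (tilted_var \<mu> \<theta>)\<^sup>2 \<Longrightarrow> \<theta> = \<theta>\<^sub>0"
    using inflection unfolding deriv_cumulant deriv2_cumulant by (metis (no_types, lifting))
  have inj: "curvature a \<noteq> curvature b" if ab: "a < b" "b \<le> \<theta>\<^sub>0" for a b
  proof
    assume "curvature a = curvature b"
    then obtain z where z: "a < z" "z < b" "(curvature has_real_derivative 0) (at z)"
      using Rolle[OF ab(1), of curvature] isCont_curvature DERIV_curvature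
      by (metis continuous_at_imp_continuous_on real_differentiable_def)
    obtain d where d: "(curvature has_real_derivative d) (at z)"
      "d * tilted_mean \<mu> z = tilted_mean \<mu> z ^ (p - 2) *
       ((deriv ^^ 3) (cumulant \<mu>) z * tilted_mean \<mu> z + (real p - 2) * (tilted_var \<mu> z)\<^sup>2)"
      by (rule DERIV_curvature)
    have "d = 0" using z d(1) DERIV_unique by blast
    moreover have "tilted_mean \<mu> z ^ (p - 2) \<noteq> 0" using tilted_mean_pos[of z] by simp
    ultimately have "(deriv ^^ 3) (cumulant \<mu>) z * tilted_mean \<mu> z + (real p - 2) * (tilted_var \<mu> z)\<^sup>2 = 0"
      using d(2) by (metis mult_eq_0_iff)
    then have "(deriv ^^ 3) (cumulant \<mu>) z * tilted_mean \<mu> z = - (real p - 2) * (tilted_var \<mu> z)\<^sup>2"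
      by (simp add: algebra_simps)
    then show False using uniq z ab by fastforce
  qed
  have "curvature a \<le> curvature b" if ab: "a < b" "b \<le> \<theta>\<^sub>0" for a b
  proof (rule ccontr)
    assume "\<not> curvature a \<le> curvature b"
    then have gt: "curvature b < curvature a" by simp
    obtain R where R: "\<And>\<theta>. \<theta> \<le> R \<Longrightarrow> tilted_mean \<mu> \<theta> \<le> curvature b"
      using tilted_mean_vanishes[OF curvature_pos] by blast
    \<comment> \<open>Far to the left the curvature is below its value at \<open>b\<close>, so a value above it at \<open>a < b\<close> would be taken twice.\<close>
    define c where "c = min R a - 1"
    have c: "c \<le> R" "c \<le> a" unfolding c_def by linarith+
    then have "curvature c \<le> curvature b" using R curvature_le order_trans by blast
    then obtain z where z: "c \<le> z" "z \<le> a" "curvature z = curvature b"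
      using IVT[of curvature c "curvature b" a] gt c isCont_curvature by auto
    then show False using inj[of z b] ab by auto
  qed
  then show ?thesis by blast
qed

text \<open>
  By monotonicity \<open>\<bar>\<theta>\<bar> / 2\<close> times the curvature at \<open>\<theta>\<close> is at most the increment of
  \<open>(K')\<^bsup>p-1\<^esup>\<close>, the primitive of \<open>p - 1\<close> times the curvature, over \<open>[\<theta>, \<theta> / 2]\<close>. This is where
  admissibility is essential: without monotonicity \<open>K'\<close> could fall in steps, with \<open>\<bar>\<theta>\<bar> K''(\<theta>)\<close>
  unbounded.
\<close>

lemma theta_curvature_vanishes:
  assumes \<epsilon>: "0 < \<epsilon>"
  shows "\<exists>R. \<forall>\<theta>\<le>R. \<bar>\<theta>\<bar> * curvature \<theta> \<le> \<epsilon>"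
proof -
  obtain R where R: "\<And>a b. a < b \<Longrightarrow> b \<le> R \<Longrightarrow> curvature a \<le> curvature b"
    using curvature_increasing by blast
  obtain R' where R': "\<And>\<theta>. \<theta> \<le> R' \<Longrightarrow> tilted_mean \<mu> \<theta> \<le> \<epsilon> / 2"
    using tilted_mean_vanishes[of "\<epsilon> / 2"] \<epsilon> by auto
  have "\<bar>\<theta>\<bar> * curvature \<theta> \<le> \<epsilon>" if \<theta>: "\<theta> \<le> 2 * min R (min R' (- 1))" for \<theta>
  proof -
    let ?G = "\<lambda>t. tilted_mean \<mu> t ^ (p - 1)"
    have neg: "\<theta> < \<theta> / 2" "\<theta> / 2 \<le> R" "\<theta> / 2 \<le> R'" using \<theta> by auto
    have G: "(?G has_real_derivative real (p - 1) * curvature t) (at t)" for t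
      using DERIV_power[OF DERIV_tilted_mean, of "p - 1" t]
      by (simp add: curvature_def mult_ac numeral_2_eq_2)
    obtain z where z: "\<theta> < z" "z < \<theta> / 2" "?G (\<theta> / 2) - ?G \<theta> = (\<theta> / 2 - \<theta>) * (real (p - 1) * curvature z)"
      using MVT2[OF neg(1), of ?G "\<lambda>t. real (p - 1) * curvature t"] G by blast
    have "\<bar>\<theta>\<bar> / 2 * curvature \<theta> \<le> (\<theta> / 2 - \<theta>) * (real (p - 1) * curvature z)"
    proof (rule mult_mono)
      have "1 * curvature \<theta> \<le> real (p - 1) * curvature z"
        using R[OF z(1)] z(2) neg p curvature_pos[of \<theta>] by (intro mult_mono) auto
      then show "curvature \<theta> \<le> real (p - 1) * curvature z" by simp
    qed (use neg curvature_pos[of \<theta>] in auto)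
    also have "\<dots> \<le> ?G (\<theta> / 2)"
      using z(3) zero_le_power[OF tilted_mean_nonneg[of \<theta>], of "p - 1"] by linarith
    also have "\<dots> \<le> tilted_mean \<mu> (\<theta> / 2)"
      using power_decreasing[of 1 "p - 1" "tilted_mean \<mu> (\<theta> / 2)"] p
        tilted_mean_nonneg[of "\<theta> / 2"] tilted_mean_less_1[of "\<theta> / 2"] by simp
    also have "\<dots> \<le> \<epsilon> / 2" using R' neg by blast
    finally show ?thesis by simp
  qed
  then show ?thesis by blast
qed

lemma DERIV_stationarity:
  "(stationarity \<mu> p \<beta> has_real_derivative
     snd \<beta> * (real p * real (p - 1) * curvature \<theta>) - 1 / 2) (at \<theta>)"
proof -
  have "((\<lambda>t. fst \<beta> + snd \<beta> * (real p * tilted_mean \<mu> t ^ (p - 1)) - t / 2) has_real_derivative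
     0 + snd \<beta> * (real p * (real (p - 1) * (tilted_var \<mu> \<theta> * tilted_mean \<mu> \<theta> ^ (p - 1 - Suc 0)))) - 1 / 2) (at \<theta>)"
    by (intro DERIV_add DERIV_diff DERIV_const DERIV_cmult DERIV_cdivide DERIV_ident
        DERIV_power[OF DERIV_tilted_mean])
  then show ?thesis
    unfolding stationarity_def[abs_def] curvature_def by (simp add: mult_ac numeral_2_eq_2)
qed

text \<open>
  A maximizer with small density satisfies \<open>p u\<^bsup>p-1\<^esup> \<le> 1/2\<close>, so its dual lies in
  \<open>[2 \<beta>\<^sub>1, \<beta>\<^sub>1]\<close> by stationarity. On this interval \<open>\<beta>\<^sub>2 \<le> \<bar>\<theta>\<bar>\<close>, so the vanishing of
  \<open>\<bar>\<theta>\<bar>\<close> times the curvature makes the stationarity function strictly decreasing.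
\<close>

lemma unique_maximizer:
  assumes \<delta>: "0 < \<delta>"
  shows "\<exists>R<0. \<forall>\<beta>\<in>region. fst \<beta> \<le> R \<longrightarrow>
    (\<exists>\<theta>. is_maximizer \<mu> p \<beta> (tilted_mean \<mu> \<theta>) \<and> (\<forall>u. is_maximizer \<mu> p \<beta> u \<longrightarrow> u = tilted_mean \<mu> \<theta>)
       \<and> stationarity \<mu> p \<beta> \<theta> = 0 \<and> tilted_mean \<mu> \<theta> \<le> \<delta>)"
proof -
  have p0: "0 < p" using p by simp
  obtain R1 where R1: "\<And>\<theta>. \<theta> \<le> R1 \<Longrightarrow> \<bar>\<theta>\<bar> * curvature \<theta> \<le> 1 / (4 * (real p * real (p - 1)))"
    using theta_curvature_vanishes[of "1 / (4 * (real p * real (p - 1)))"] p by auto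
  obtain R2 where R2: "\<And>\<beta> u. \<beta> \<in> region \<Longrightarrow> fst \<beta> \<le> R2 \<Longrightarrow> is_maximizer \<mu> p \<beta> u \<Longrightarrow> u \<le> min \<delta> (1 / (2 * real p))"
    using maximizer_small[of "min \<delta> (1 / (2 * real p))" p] \<delta> p by auto
  define R where "R = min (min R1 R2) (- 1)"
  have "\<exists>\<theta>. is_maximizer \<mu> p \<beta> (tilted_mean \<mu> \<theta>) \<and> (\<forall>u. is_maximizer \<mu> p \<beta> u \<longrightarrow> u = tilted_mean \<mu> \<theta>)
       \<and> stationarity \<mu> p \<beta> \<theta> = 0 \<and> tilted_mean \<mu> \<theta> \<le> \<delta>" if \<beta>: "\<beta> \<in> region" and far: "fst \<beta> \<le> R" for \<beta>
  proof -
    have b: "fst \<beta> < 0" "0 \<le> snd \<beta>" "snd \<beta> \<le> - fst \<beta>" using \<beta> by (auto simp: region_def)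
    have loc: "2 * fst \<beta> \<le> \<theta> \<and> \<theta> \<le> fst \<beta> \<and> stationarity \<mu> p \<beta> \<theta> = 0"
      if max: "is_maximizer \<mu> p \<beta> (tilted_mean \<mu> \<theta>)" for \<theta>
    proof -
      let ?m = "tilted_mean \<mu> \<theta>"
      have st: "stationarity \<mu> p \<beta> \<theta> = 0"
        using maximizer_stationary[OF \<beta> p0 max] tilted_mean_eq_iff by metis
      have "?m \<le> 1 / (2 * real p)" using R2[OF \<beta> _ max] far by (simp add: R_def)
      moreover have "?m ^ (p - 1) \<le> ?m"
        using power_decreasing[of 1 "p - 1" ?m] p tilted_mean_nonneg[of \<theta>] tilted_mean_less_1[of \<theta>] by simp
      ultimately have "?m ^ (p - 1) \<le> 1 / (2 * real p)" by linarith
      then have "real p * ?m ^ (p - 1) \<le> 1 / 2" using p0 by (simp add: field_simps)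
      then have "snd \<beta> * (real p * ?m ^ (p - 1)) \<le> - fst \<beta> * (1 / 2)"
        using b tilted_mean_nonneg[of \<theta>] by (intro mult_mono) auto
      moreover have "0 \<le> snd \<beta> * (real p * ?m ^ (p - 1))"
        using b tilted_mean_nonneg[of \<theta>] by simp
      ultimately show ?thesis using st unfolding stationarity_def by auto
    qed
    have decreasing: "stationarity \<mu> p \<beta> y < stationarity \<mu> p \<beta> x"
      if xy: "x < y" "2 * fst \<beta> \<le> x" "y \<le> fst \<beta>" for x y
    proof (rule DERIV_neg_imp_decreasing[OF xy(1)])
      fix t assume t: "x \<le> t" "t \<le> y"
      have "\<bar>t\<bar> * curvature t \<le> 1 / (4 * (real p * real (p - 1)))"
        using t xy far R1[of t] by (simp add: R_def)
      moreover have "snd \<beta> * curvature t \<le> \<bar>t\<bar> * curvature t"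
        using b t xy curvature_pos[of t] by (intro mult_right_mono) auto
      ultimately have "snd \<beta> * curvature t \<le> 1 / (4 * (real p * real (p - 1)))" by (rule order_trans[rotated])
      then have "real p * real (p - 1) * (snd \<beta> * curvature t) \<le> real p * real (p - 1) * (1 / (4 * (real p * real (p - 1))))"
        by (rule mult_left_mono) simp
      also have "\<dots> = 1 / 4" using p by simp
      finally have "snd \<beta> * (real p * real (p - 1) * curvature t) - 1 / 2 < 0" by (simp add: mult_ac)
      then show "\<exists>d. (stationarity \<mu> p \<beta> has_real_derivative d) (at t) \<and> d < 0"
        using DERIV_stationarity by blast
    qed
    obtain \<theta> where \<theta>: "is_maximizer \<mu> p \<beta> (tilted_mean \<mu> \<theta>)"
      using maximizer_exists[OF \<beta> p0] by blast
    have "u = tilted_mean \<mu> \<theta>" if u: "is_maximizer \<mu> p \<beta> u" for u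
    proof -
      obtain s where s: "u = tilted_mean \<mu> s" using maximizer_stationary[OF \<beta> p0 u] by metis
      have "s = \<theta>"
        using loc[OF \<theta>] loc[of s] u s decreasing[of s \<theta>] decreasing[of \<theta> s]
        by (cases s \<theta> rule: linorder_cases) auto
      then show ?thesis using s by simp
    qed
    moreover have "tilted_mean \<mu> \<theta> \<le> \<delta>" using R2[OF \<beta> _ \<theta>] far by (simp add: R_def)
    ultimately show ?thesis using \<theta> loc by blast
  qed
  moreover have "R < 0" by (simp add: R_def)
  ultimately show ?thesis by blast
qed

end


section \<open>Weak regularity and counting on finite matrices\<close>

text \<open>
  The conditional expectation of \<open>f\<close> given \<open>\<rho>\<close>, as a function of the value of \<open>\<rho>\<close>.
\<close>

definition fibre_avg :: "'a set \<Rightarrow> ('a \<Rightarrow> 'b) \<Rightarrow> ('a \<Rightarrow> real) \<Rightarrow> 'b \<Rightarrow> real" where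
  "fibre_avg S \<rho> f y = (\<Sum>s\<in>{s \<in> S. \<rho> s = y}. f s) / real (card {s \<in> S. \<rho> s = y})"

lemma sum_fibre_avg:
  assumes "finite S"
  shows "(\<Sum>s\<in>S. \<phi> (\<rho> s) * fibre_avg S \<rho> f (\<rho> s)) = (\<Sum>s\<in>S. \<phi> (\<rho> s) * f s)"
proof -
  have "(\<Sum>s\<in>{s \<in> S. \<rho> s = y}. \<phi> (\<rho> s) * fibre_avg S \<rho> f (\<rho> s))
      = (\<Sum>s\<in>{s \<in> S. \<rho> s = y}. \<phi> (\<rho> s) * f s)" for y
  proof -
    have "(\<Sum>s\<in>{s \<in> S. \<rho> s = y}. \<phi> (\<rho> s) * fibre_avg S \<rho> f (\<rho> s))
        = real (card {s \<in> S. \<rho> s = y}) * (\<phi> y * fibre_avg S \<rho> f y)"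
      by simp
    also have "\<dots> = \<phi> y * (\<Sum>s\<in>{s \<in> S. \<rho> s = y}. f s)"
    proof (cases "{s \<in> S. \<rho> s = y} = {}")
      case False
      then show ?thesis using assms by (simp add: fibre_avg_def)
    next
      case True
      show ?thesis unfolding True by simp
    qed
    also have "\<dots> = (\<Sum>s\<in>{s \<in> S. \<rho> s = y}. \<phi> (\<rho> s) * f s)"
      by (simp add: sum_distrib_left)
    finally show ?thesis .
  qed
  then show ?thesis
    unfolding sum.image_gen[OF assms, of "\<lambda>s. \<phi> (\<rho> s) * fibre_avg S \<rho> f (\<rho> s)" \<rho>]
      sum.image_gen[OF assms, of "\<lambda>s. \<phi> (\<rho> s) * f s" \<rho>] by simp
qed

lemma fibre_avg_unit:
  assumes "\<And>s. s \<in> S \<Longrightarrow> f s \<in> {0..1}"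
  shows "fibre_avg S \<rho> f y \<in> {0..1}"
proof -
  have "0 \<le> (\<Sum>s\<in>{s \<in> S. \<rho> s = y}. f s)"
    using assms by (intro sum_nonneg) auto
  moreover have "(\<Sum>s\<in>{s \<in> S. \<rho> s = y}. f s) \<le> real (card {s \<in> S. \<rho> s = y}) * 1"
    using assms by (intro sum_bounded_above) auto
  ultimately show ?thesis by (auto simp: fibre_avg_def divide_le_eq)
qed

text \<open>
  Conditional expectation is the orthogonal projection onto functions of \<open>\<rho>\<close>.
\<close>

lemma fibre_avg_best_approximation:
  assumes "finite S"
  shows "(\<Sum>s\<in>S. (f s - fibre_avg S \<rho> f (\<rho> s))\<^sup>2) \<le> (\<Sum>s\<in>S. (f s - w (\<rho> s))\<^sup>2)"
proof -
  let ?a = "fibre_avg S \<rho> f"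
  have "(\<Sum>s\<in>S. (?a (\<rho> s) - w (\<rho> s)) * ?a (\<rho> s)) = (\<Sum>s\<in>S. (?a (\<rho> s) - w (\<rho> s)) * f s)"
    by (rule sum_fibre_avg[OF assms, of "\<lambda>y. ?a y - w y"])
  then have "0 = (\<Sum>s\<in>S. (?a (\<rho> s) - w (\<rho> s)) * (f s - ?a (\<rho> s)))"
    by (simp add: sum_subtractf right_diff_distrib)
  moreover have "(\<Sum>s\<in>S. (f s - w (\<rho> s))\<^sup>2) = (\<Sum>s\<in>S. (f s - ?a (\<rho> s))\<^sup>2)
      + 2 * (\<Sum>s\<in>S. (?a (\<rho> s) - w (\<rho> s)) * (f s - ?a (\<rho> s))) + (\<Sum>s\<in>S. (?a (\<rho> s) - w (\<rho> s))\<^sup>2)"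
    by (simp add: sum_distrib_left flip: sum.distrib)
      (rule sum.cong, auto simp: power2_eq_square algebra_simps)
  moreover have "0 \<le> (\<Sum>s\<in>S. (?a (\<rho> s) - w (\<rho> s))\<^sup>2)" by (rule sum_nonneg) simp
  ultimately show ?thesis by linarith
qed

text \<open>
  The cut norm of \<open>z\<close>, scaled by \<open>n\<^sup>2\<close>, is at most \<open>\<epsilon>\<close>. Stating this for all rectangles avoids the
  maximum and is visibly measurable in \<open>z\<close>.
\<close>

definition cut_small :: "nat \<Rightarrow> real \<Rightarrow> (nat \<times> nat \<Rightarrow> real) \<Rightarrow> bool" where
  "cut_small n \<epsilon> z \<longleftrightarrow>
     (\<forall>A B. A \<subseteq> {1..n} \<longrightarrow> B \<subseteq> {1..n} \<longrightarrow> \<bar>\<Sum>s\<in>A \<times> B. z s\<bar> \<le> \<epsilon> * (real n)\<^sup>2)"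

lemma cut_small_uminus: "cut_small n \<epsilon> (\<lambda>s. - z s) = cut_small n \<epsilon> z"
  by (simp add: cut_small_def sum_negf)

lemma sum_unit_weights_le:
  fixes \<phi> w :: "'a \<Rightarrow> real"
  assumes "finite A" "\<And>i. i \<in> A \<Longrightarrow> \<phi> i \<in> {0..1}"
  shows "(\<Sum>i\<in>A. \<phi> i * w i) \<le> (\<Sum>i\<in>{i \<in> A. 0 < w i}. w i)"
proof -
  have "(\<Sum>i\<in>A. \<phi> i * w i) \<le> (\<Sum>i\<in>A. if 0 < w i then w i else 0)"
  proof (rule sum_mono)
    fix i assume i: "i \<in> A"
    show "\<phi> i * w i \<le> (if 0 < w i then w i else 0)"
      using assms(2)[OF i] by (auto simp: mult_le_0_iff mult_left_le_one_le)
  qed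
  also have "\<dots> = (\<Sum>i\<in>{i \<in> A. 0 < w i}. w i)"
    using assms(1) by (simp add: sum.inter_filter)
  finally show ?thesis .
qed

text \<open>
  A bilinear form on a cube is extremal at vertices: optimize \<open>\<phi>\<close> for fixed \<open>\<psi>\<close>, then \<open>\<psi>\<close>.
\<close>

lemma cut_small_bilinear:
  assumes z: "cut_small n \<epsilon> z"
    and \<phi>: "\<And>i. i \<in> {1..n} \<Longrightarrow> \<phi> i \<in> {0..1}" and \<psi>: "\<And>i. i \<in> {1..n} \<Longrightarrow> \<psi> i \<in> {0..1}"
  shows "\<bar>\<Sum>i=1..n. \<Sum>j=1..n. \<phi> i * \<psi> j * z (i, j)\<bar> \<le> \<epsilon> * (real n)\<^sup>2"
proof -
  have upper: "(\<Sum>i=1..n. \<Sum>j=1..n. \<phi> i * \<psi> j * z (i, j)) \<le> \<epsilon> * (real n)\<^sup>2" if z: "cut_small n \<epsilon> z" for z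
  proof -
    define A where "A = {i \<in> {1..n}. 0 < (\<Sum>j=1..n. \<psi> j * z (i, j))}"
    define B where "B = {j \<in> {1..n}. 0 < (\<Sum>i\<in>A. z (i, j))}"
    have "(\<Sum>i=1..n. \<Sum>j=1..n. \<phi> i * \<psi> j * z (i, j)) = (\<Sum>i=1..n. \<phi> i * (\<Sum>j=1..n. \<psi> j * z (i, j)))"
      by (simp add: sum_distrib_left mult.assoc)
    also have "\<dots> \<le> (\<Sum>i\<in>A. \<Sum>j=1..n. \<psi> j * z (i, j))"
      unfolding A_def by (rule sum_unit_weights_le) (use \<phi> in auto)
    also have "\<dots> = (\<Sum>j=1..n. \<psi> j * (\<Sum>i\<in>A. z (i, j)))"
      by (subst sum.swap) (simp add: sum_distrib_left)
    also have "\<dots> \<le> (\<Sum>j\<in>B. \<Sum>i\<in>A. z (i, j))"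
      unfolding B_def by (rule sum_unit_weights_le) (use \<psi> in auto)
    also have "\<dots> = (\<Sum>s\<in>A \<times> B. z s)"
      by (subst sum.swap) (simp add: sum.cartesian_product)
    also have "\<dots> \<le> \<epsilon> * (real n)\<^sup>2"
    proof -
      have "A \<subseteq> {1..n}" "B \<subseteq> {1..n}" unfolding A_def B_def by blast+
      then show ?thesis using z unfolding cut_small_def by (meson abs_le_D1)
    qed
    finally show ?thesis .
  qed
  have "- (\<Sum>i=1..n. \<Sum>j=1..n. \<phi> i * \<psi> j * z (i, j)) \<le> \<epsilon> * (real n)\<^sup>2"
    using upper[of "\<lambda>s. - z s"] z by (simp add: cut_small_uminus sum_negf)
  then show ?thesis using upper[OF z] by (simp add: abs_le_iff)
qed

abbreviation square :: "nat \<Rightarrow> (nat \<times> nat) set" where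
  "square n \<equiv> {1..n} \<times> {1..n}"

text \<open>
  The matrix averaged over the blocks of the vertex labelling \<open>\<pi>\<close>, as a function of a pair of labels.
\<close>

definition block_avg :: "nat \<Rightarrow> (nat \<Rightarrow> nat) \<Rightarrow> (nat \<times> nat \<Rightarrow> real) \<Rightarrow> nat \<times> nat \<Rightarrow> real" where
  "block_avg n \<pi> x = fibre_avg (square n) (map_prod \<pi> \<pi>) x"

text \<open>
  The step of the energy increment argument. A rectangle \<open>A \<times> B\<close> witnessing a large cut norm becomes
  a union of blocks when membership in \<open>A\<close> and in \<open>B\<close> is added to the labels; correcting the old
  averages by \<open>\<plusminus>\<epsilon>\<close> on it reduces the squared error by \<open>\<epsilon>\<^sup>2 n\<^sup>2\<close>, and the new averages
  are at least as good as this correction.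
\<close>

lemma residual_decrement:
  assumes \<epsilon>: "0 \<le> \<epsilon>" and not_small: "\<not> cut_small n \<epsilon> (\<lambda>s. x s - block_avg n \<pi> x (map_prod \<pi> \<pi> s))"
    and \<pi>: "\<pi> ` {1..n} \<subseteq> {..<K}"
  obtains \<pi>' where "\<pi>' ` {1..n} \<subseteq> {..<4 * K}"
    and "(\<Sum>s\<in>square n. (x s - block_avg n \<pi>' x (map_prod \<pi>' \<pi>' s))\<^sup>2)
      \<le> (\<Sum>s\<in>square n. (x s - block_avg n \<pi> x (map_prod \<pi> \<pi> s))\<^sup>2) - \<epsilon>\<^sup>2 * (real n)\<^sup>2"
proof -
  let ?r = "\<lambda>s. x s - block_avg n \<pi> x (map_prod \<pi> \<pi> s)"
  obtain A B where AB: "A \<subseteq> {1..n}" "B \<subseteq> {1..n}" and large: "\<epsilon> * (real n)\<^sup>2 < \<bar>\<Sum>s\<in>A \<times> B. ?r s\<bar>"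
    using not_small unfolding cut_small_def by (auto simp: not_le)
  \<comment> \<open>The optimal sign and a sufficient size of the correction on the rectangle.\<close>
  define c where "c = \<epsilon> * sgn (\<Sum>s\<in>A \<times> B. ?r s)"
  \<comment> \<open>The two lowest binary digits of the new label record membership in \<open>A\<close> and \<open>B\<close>.\<close>
  define \<pi>' where "\<pi>' i = 4 * \<pi> i + (if i \<in> A then 2 else 0) + (if i \<in> B then 1 else 0)" for i
  define w where "w = (\<lambda>(a, b). block_avg n \<pi> x (a div 4, b div 4)
      + (if 2 \<le> a mod 4 \<and> odd b then c else 0))"
  have w: "w (map_prod \<pi>' \<pi>' s) = block_avg n \<pi> x (map_prod \<pi> \<pi> s) + (if s \<in> A \<times> B then c else 0)" for s
  proof -
    have labels: "\<pi>' i div 4 = \<pi> i" "2 \<le> \<pi>' i mod 4 \<longleftrightarrow> i \<in> A" "odd (\<pi>' i) \<longleftrightarrow> i \<in> B" for i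
      unfolding \<pi>'_def by (cases "i \<in> A"; cases "i \<in> B"; simp; presburger)+
    show ?thesis by (cases s) (simp add: w_def labels)
  qed
  have "(\<Sum>s\<in>square n. (x s - block_avg n \<pi>' x (map_prod \<pi>' \<pi>' s))\<^sup>2)
      \<le> (\<Sum>s\<in>square n. (x s - w (map_prod \<pi>' \<pi>' s))\<^sup>2)"
    unfolding block_avg_def by (rule fibre_avg_best_approximation) simp
  also have "\<dots> = (\<Sum>s\<in>square n. (?r s)\<^sup>2 + (if s \<in> A \<times> B then c\<^sup>2 - 2 * c * ?r s else 0))"
    by (rule sum.cong) (auto simp: w power2_eq_square algebra_simps)
  also have "\<dots> = (\<Sum>s\<in>square n. (?r s)\<^sup>2) + (\<Sum>s\<in>A \<times> B. c\<^sup>2 - 2 * c * ?r s)"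
  proof -
    have "square n \<inter> A \<times> B = A \<times> B" using AB by auto
    then show ?thesis by (simp add: sum.distrib sum.inter_restrict[symmetric])
  qed
  also have "(\<Sum>s\<in>A \<times> B. c\<^sup>2 - 2 * c * ?r s) = real (card (A \<times> B)) * c\<^sup>2 - 2 * c * (\<Sum>s\<in>A \<times> B. ?r s)"
    by (subst sum_subtractf) (simp only: sum_constant sum_distrib_left)
  also have "2 * c * (\<Sum>s\<in>A \<times> B. ?r s) = 2 * \<epsilon> * \<bar>\<Sum>s\<in>A \<times> B. ?r s\<bar>"
    unfolding c_def abs_sgn[of "\<Sum>s\<in>A \<times> B. ?r s"] by (simp only: mult_ac)
  also have "real (card (A \<times> B)) * c\<^sup>2 \<le> (real n)\<^sup>2 * \<epsilon>\<^sup>2"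
  proof (rule mult_mono)
    have "card (A \<times> B) \<le> card (square n)" using AB by (intro card_mono) auto
    then have "real (card (A \<times> B)) \<le> real (n * n)" by (subst of_nat_le_iff) (simp add: card_cartesian_product)
    then show "real (card (A \<times> B)) \<le> (real n)\<^sup>2" by (simp add: power2_eq_square)
    show "c\<^sup>2 \<le> \<epsilon>\<^sup>2" unfolding c_def by (simp add: power_mult_distrib sgn_if)
  qed auto
  also have "(real n)\<^sup>2 * \<epsilon>\<^sup>2 - 2 * \<epsilon> * \<bar>\<Sum>s\<in>A \<times> B. ?r s\<bar> \<le> - (\<epsilon>\<^sup>2 * (real n)\<^sup>2)"
  proof -
    have "\<epsilon> * (\<epsilon> * (real n)\<^sup>2) \<le> \<epsilon> * \<bar>\<Sum>s\<in>A \<times> B. ?r s\<bar>"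
      using large \<epsilon> by (intro mult_left_mono) auto
    then show ?thesis by (simp add: power2_eq_square algebra_simps)
  qed
  finally have "(\<Sum>s\<in>square n. (x s - block_avg n \<pi>' x (map_prod \<pi>' \<pi>' s))\<^sup>2)
      \<le> (\<Sum>s\<in>square n. (?r s)\<^sup>2) - \<epsilon>\<^sup>2 * (real n)\<^sup>2" by simp
  moreover have "\<pi>' ` {1..n} \<subseteq> {..<4 * K}"
  proof (rule image_subsetI)
    fix i assume "i \<in> {1..n}"
    then have "\<pi> i < K" using \<pi> by blast
    then show "\<pi>' i \<in> {..<4 * K}" by (simp add: \<pi>'_def)
  qed
  ultimately show ?thesis using that by blast
qed

text \<open>
  The Frieze--Kannan weak regularity lemma. The squared error starts at most \<open>n\<^sup>2\<close> and stays
  nonnegative, so the refinement stops within \<open>m > 1 / \<epsilon>\<^sup>2\<close> steps; the number of blocks is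
  independent of \<open>n\<close>.
\<close>

lemma weak_regularity:
  assumes \<epsilon>: "0 < \<epsilon>" and m: "1 < real m * \<epsilon>\<^sup>2" and x: "\<And>s. s \<in> square n \<Longrightarrow> x s \<in> {0..1}"
  shows "\<exists>\<pi>. \<pi> ` {1..n} \<subseteq> {..<4 ^ m} \<and> cut_small n \<epsilon> (\<lambda>s. x s - block_avg n \<pi> x (map_prod \<pi> \<pi> s))"
proof -
  let ?r = "\<lambda>\<pi>. \<Sum>s\<in>square n. (x s - block_avg n \<pi> x (map_prod \<pi> \<pi> s))\<^sup>2"
  have "\<exists>\<pi>. \<pi> ` {1..n} \<subseteq> {..<4 ^ l} \<and>
      (cut_small n \<epsilon> (\<lambda>s. x s - block_avg n \<pi> x (map_prod \<pi> \<pi> s)) \<or> ?r \<pi> \<le> (1 - real l * \<epsilon>\<^sup>2) * (real n)\<^sup>2)" for l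
  proof (induction l)
    case 0
    have "?r (\<lambda>_. 0) \<le> (\<Sum>s\<in>square n. (x s - 0)\<^sup>2)"
      unfolding block_avg_def by (rule fibre_avg_best_approximation) simp
    also have "\<dots> \<le> real (card (square n)) * 1"
      using x by (intro sum_bounded_above) (auto simp: power_le_one)
    finally show ?case
      by (intro exI[of _ "\<lambda>_. 0"]) (auto simp: card_cartesian_product power2_eq_square)
  next
    case (Suc l)
    then obtain \<pi> where \<pi>: "\<pi> ` {1..n} \<subseteq> {..<4 ^ l}"
      and alt: "cut_small n \<epsilon> (\<lambda>s. x s - block_avg n \<pi> x (map_prod \<pi> \<pi> s)) \<or> ?r \<pi> \<le> (1 - real l * \<epsilon>\<^sup>2) * (real n)\<^sup>2"
      by blast
    show ?case
    proof (cases "cut_small n \<epsilon> (\<lambda>s. x s - block_avg n \<pi> x (map_prod \<pi> \<pi> s))")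
      case True
      have "{..<4 ^ l} \<subseteq> {..<(4::nat) ^ Suc l}" by auto
      with \<pi> have "\<pi> ` {1..n} \<subseteq> {..<4 ^ Suc l}" by (rule order_trans)
      then show ?thesis using True by (intro exI[of _ \<pi>] conjI disjI1)
    next
      case False
      obtain \<pi>' where "\<pi>' ` {1..n} \<subseteq> {..<4 * 4 ^ l}" "?r \<pi>' \<le> ?r \<pi> - \<epsilon>\<^sup>2 * (real n)\<^sup>2"
        using residual_decrement[OF less_imp_le[OF \<epsilon>] False \<pi>] by blast
      then show ?thesis using alt False by (intro exI[of _ \<pi>']) (auto simp: algebra_simps)
    qed
  qed
  then obtain \<pi> where \<pi>: "\<pi> ` {1..n} \<subseteq> {..<4 ^ m}"
    and alt: "cut_small n \<epsilon> (\<lambda>s. x s - block_avg n \<pi> x (map_prod \<pi> \<pi> s)) \<or> ?r \<pi> \<le> (1 - real m * \<epsilon>\<^sup>2) * (real n)\<^sup>2"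
    by blast
  have "cut_small n \<epsilon> (\<lambda>s. x s - block_avg n \<pi> x (map_prod \<pi> \<pi> s))"
  proof (cases "n = 0")
    case True
    then show ?thesis by (auto simp: cut_small_def)
  next
    case False
    then have "(1 - real m * \<epsilon>\<^sup>2) * (real n)\<^sup>2 < 0" using m by (simp add: mult_less_0_iff)
    moreover have "0 \<le> ?r \<pi>" by (rule sum_nonneg) simp
    ultimately show ?thesis using alt by linarith
  qed
  with \<pi> show ?thesis by (intro exI[of _ \<pi>] conjI)
qed

text \<open>
  The number of homomorphisms in the weighted sense. Every edge is read in the order from its smaller
  to its larger endpoint.
\<close>

definition hom_sum :: "nat \<Rightarrow> nat \<Rightarrow> nat set set \<Rightarrow> (nat \<times> nat \<Rightarrow> real) \<Rightarrow> real" where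
  "hom_sum k n E x = (\<Sum>v\<in>PiE {1..k} (\<lambda>_. {1..n}). \<Prod>e\<in>E. x (v (Min e), v (Max e)))"

lemma edge_endpoints:
  assumes "e \<in> nsets {1..k::nat} 2"
  shows "Min e \<in> {1..k}" "Max e \<in> {1..k}" "Min e < Max e" "e = {Min e, Max e}"
proof -
  obtain a b where ab: "a < b" "a \<in> {1..k}" "b \<in> {1..k}" "e = {a, b}"
    using assms by (auto simp: ordered_nsets_2_eq)
  then have "Min e = a" "Max e = b" by auto
  then show "Min e \<in> {1..k}" "Max e \<in> {1..k}" "Min e < Max e" "e = {Min e, Max e}" using ab by auto
qed

text \<open>
  The pairs \<open>(v, s)\<close> are permuted by exchanging \<open>s\<close> with the value of \<open>v\<close> at \<open>i\<close>.
\<close>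

lemma sum_PiE_resample:
  fixes F :: "('i \<Rightarrow> 'a) \<Rightarrow> real"
  assumes "i \<in> I"
  shows "real (card A) * (\<Sum>v\<in>PiE I (\<lambda>_. A). F v) = (\<Sum>v\<in>PiE I (\<lambda>_. A). \<Sum>s\<in>A. F (v(i := s)))"
proof -
  have "(\<Sum>v\<in>PiE I (\<lambda>_. A). \<Sum>s\<in>A. F (v(i := s))) = (\<Sum>(v, s)\<in>PiE I (\<lambda>_. A) \<times> A. F (v(i := s)))"
    by (simp add: sum.cartesian_product)
  also have "\<dots> = (\<Sum>(v, s)\<in>PiE I (\<lambda>_. A) \<times> A. F v)"
    by (rule sum.reindex_bij_witness[of _ "\<lambda>(v, s). (v(i := s), v i)" "\<lambda>(v, s). (v(i := s), v i)"])
      (use assms in \<open>auto simp: PiE_def extensional_def\<close>)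
  also have "\<dots> = (\<Sum>v\<in>PiE I (\<lambda>_. A). \<Sum>s\<in>A. F v)"
    by (simp only: sum.cartesian_product)
  also have "\<dots> = real (card A) * (\<Sum>v\<in>PiE I (\<lambda>_. A). F v)"
    by (simp add: sum_distrib_left)
  finally show ?thesis by simp
qed

lemma sum_PiE_resample2:
  fixes F :: "('i \<Rightarrow> nat) \<Rightarrow> real"
  assumes "i \<in> I" "j \<in> I"
  shows "(real n)\<^sup>2 * (\<Sum>v\<in>PiE I (\<lambda>_. {1..n}). F v)
    = (\<Sum>v\<in>PiE I (\<lambda>_. {1..n}). \<Sum>s=1..n. \<Sum>t=1..n. F (v(i := s, j := t)))"
proof -
  have "(real n)\<^sup>2 * (\<Sum>v\<in>PiE I (\<lambda>_. {1..n}). F v)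
      = real n * (\<Sum>v\<in>PiE I (\<lambda>_. {1..n}). \<Sum>t=1..n. F (v(j := t)))"
    using sum_PiE_resample[OF assms(2), of "{1..n}" F] by (simp add: power2_eq_square)
  also have "\<dots> = (\<Sum>v\<in>PiE I (\<lambda>_. {1..n}). \<Sum>s=1..n. \<Sum>t=1..n. F (v(i := s, j := t)))"
    using sum_PiE_resample[OF assms(1), of "{1..n}" "\<lambda>v. \<Sum>t=1..n. F (v(j := t))"] by simp
  finally show ?thesis .
qed

lemma card_tuples: "card (PiE {1..k} (\<lambda>_. {1..n})) = n ^ k"
  by (simp add: card_PiE)

lemma sum_two_coordinates:
  assumes "i \<in> {1..k}" "j \<in> {1..k}" "i \<noteq> j"
  shows "(real n)\<^sup>2 * (\<Sum>v\<in>PiE {1..k} (\<lambda>_. {1..n}). f (v i, v j)) = real n ^ k * (\<Sum>s\<in>square n. f s)"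
proof -
  have "(real n)\<^sup>2 * (\<Sum>v\<in>PiE {1..k} (\<lambda>_. {1..n}). f (v i, v j))
      = (\<Sum>v\<in>PiE {1..k} (\<lambda>_. {1..n}). \<Sum>s=1..n. \<Sum>t=1..n. f (s, t))"
    using sum_PiE_resample2[OF assms(1,2), of n "\<lambda>v. f (v i, v j)"] assms(3) by simp
  then show ?thesis unfolding sum_constant card_tuples by (simp add: sum.cartesian_product)
qed

text \<open>
  With all other vertices fixed, the remaining edges factor into a function of one endpoint of \<open>e\<close>
  and a function of the other, because a simple graph has no second edge between them. The cut norm
  bounds such a bilinear sum.
\<close>

lemma single_edge_bound:
  assumes d: "cut_small n \<epsilon> d" and n: "0 < n"
    and E: "insert e E \<subseteq> nsets {1..k} 2" "e \<notin> E"
    and z: "\<And>f s. f \<in> E \<Longrightarrow> s \<in> square n \<Longrightarrow> z f s \<in> {0..1}"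
  shows "\<bar>\<Sum>v\<in>PiE {1..k} (\<lambda>_. {1..n}). d (v (Min e), v (Max e)) * (\<Prod>f\<in>E. z f (v (Min f), v (Max f)))\<bar>
    \<le> \<epsilon> * real n ^ k"
proof -
  let ?V = "PiE {1..k} (\<lambda>_. {1..n})"
  let ?F = "\<lambda>v. d (v (Min e), v (Max e)) * (\<Prod>f\<in>E. z f (v (Min f), v (Max f)))"
  define i j where "i = Min e" and "j = Max e"
  have ij: "i \<in> {1..k}" "j \<in> {1..k}" "i < j" "e = {i, j}"
    using edge_endpoints[of e k] E(1) unfolding i_def j_def by blast+
  have fin: "finite E"
    using E(1) finite_imp_finite_nsets[of "{1..k}" 2] by (meson finite_atLeastAtMost finite_subset insert_subset)
  have inner: "\<bar>\<Sum>s=1..n. \<Sum>t=1..n. ?F (v(i := s, j := t))\<bar> \<le> \<epsilon> * (real n)\<^sup>2" if v: "v \<in> ?V" for v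
  proof -
    \<comment> \<open>The edges avoiding \<open>j\<close> depend only on the value at \<open>i\<close>; those containing \<open>j\<close> avoid \<open>i\<close>.\<close>
    define \<phi> where "\<phi> s = (\<Prod>f\<in>{f \<in> E. j \<notin> f}. z f ((v(i := s)) (Min f), (v(i := s)) (Max f)))" for s
    define \<psi> where "\<psi> t = (\<Prod>f\<in>{f \<in> E. j \<in> f}. z f ((v(j := t)) (Min f), (v(j := t)) (Max f)))" for t
    have split: "?F (v(i := s, j := t)) = \<phi> s * \<psi> t * d (s, t)" for s t
    proof -
      let ?v = "v(i := s, j := t)"
      have "(\<Prod>f\<in>E. z f (?v (Min f), ?v (Max f))) =
          (\<Prod>f\<in>{f \<in> E. j \<notin> f}. z f (?v (Min f), ?v (Max f))) * (\<Prod>f\<in>{f \<in> E. j \<in> f}. z f (?v (Min f), ?v (Max f)))"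
        by (subst prod.union_disjoint[symmetric]) (use fin in \<open>auto intro!: prod.cong\<close>)
      also have "(\<Prod>f\<in>{f \<in> E. j \<notin> f}. z f (?v (Min f), ?v (Max f))) = \<phi> s"
        unfolding \<phi>_def
      proof (rule prod.cong)
        fix f assume "f \<in> {f \<in> E. j \<notin> f}"
        then have "Min f \<noteq> j" "Max f \<noteq> j" using edge_endpoints(4)[of f k] E(1) by blast+
        then show "z f (?v (Min f), ?v (Max f)) = z f ((v(i := s)) (Min f), (v(i := s)) (Max f))" by simp
      qed simp
      also have "(\<Prod>f\<in>{f \<in> E. j \<in> f}. z f (?v (Min f), ?v (Max f))) = \<psi> t"
        unfolding \<psi>_def
      proof (rule prod.cong)
        fix f assume f: "f \<in> {f \<in> E. j \<in> f}"
        have ends: "f = {Min f, Max f}" using edge_endpoints(4)[of f k] f E(1) by blast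
        have "i \<notin> f"
        proof
          assume "i \<in> f"
          moreover have "j \<in> f" using f by simp
          ultimately have "i = Min f \<or> i = Max f" "j = Min f \<or> j = Max f" using ends by blast+
          then have "f = {i, j}" using ends ij(3) by (metis insert_commute less_irrefl)
          then show False using f ij E(2) by simp
        qed
        then have "Min f \<noteq> i" "Max f \<noteq> i" using ends by blast+
        then show "z f (?v (Min f), ?v (Max f)) = z f ((v(j := t)) (Min f), (v(j := t)) (Max f))" by simp
      qed simp
      finally have prod: "(\<Prod>f\<in>E. z f (?v (Min f), ?v (Max f))) = \<phi> s * \<psi> t" .
      have "?v (Min e) = s" "?v (Max e) = t" using ij(3) by (auto simp: i_def j_def)
      then show ?thesis unfolding prod by (simp only: mult.commute)
    qed
    have vi: "(v(i := s)) a \<in> {1..n}" if "s \<in> {1..n}" "a \<in> {1..k}" for s a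
      using that v by (auto simp: PiE_iff)
    have vj: "(v(j := s)) a \<in> {1..n}" if "s \<in> {1..n}" "a \<in> {1..k}" for s a
      using that v by (auto simp: PiE_iff)
    have fE: "Min f \<in> {1..k}" "Max f \<in> {1..k}" if "f \<in> E" for f
      using edge_endpoints[of f k] that E(1) by blast+
    have "\<phi> s \<in> {0..1}" if s: "s \<in> {1..n}" for s
    proof -
      have "z f ((v(i := s)) (Min f), (v(i := s)) (Max f)) \<in> {0..1}" if "f \<in> E" for f
        by (rule z[OF that]) (use vi[OF s] fE[OF that] in blast)
      then show ?thesis unfolding \<phi>_def by (auto intro!: prod_nonneg prod_le_1)
    qed
    moreover have "\<psi> s \<in> {0..1}" if s: "s \<in> {1..n}" for s
    proof -
      have "z f ((v(j := s)) (Min f), (v(j := s)) (Max f)) \<in> {0..1}" if "f \<in> E" for f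
        by (rule z[OF that]) (use vj[OF s] fE[OF that] in blast)
      then show ?thesis unfolding \<psi>_def by (auto intro!: prod_nonneg prod_le_1)
    qed
    ultimately show ?thesis
      unfolding split using cut_small_bilinear[OF d, of \<phi> \<psi>] by blast
  qed
  have resample: "(real n)\<^sup>2 * (\<Sum>v\<in>?V. ?F v) = (\<Sum>v\<in>?V. \<Sum>s=1..n. \<Sum>t=1..n. ?F (v(i := s, j := t)))"
    by (rule sum_PiE_resample2) (use ij in auto)
  have "(real n)\<^sup>2 * \<bar>\<Sum>v\<in>?V. ?F v\<bar> = \<bar>(real n)\<^sup>2 * (\<Sum>v\<in>?V. ?F v)\<bar>"
    by (simp only: abs_mult abs_power2)
  then have "(real n)\<^sup>2 * \<bar>\<Sum>v\<in>?V. ?F v\<bar> = \<bar>\<Sum>v\<in>?V. \<Sum>s=1..n. \<Sum>t=1..n. ?F (v(i := s, j := t))\<bar>"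
    unfolding resample .
  also have "\<dots> \<le> (\<Sum>v\<in>?V. \<epsilon> * (real n)\<^sup>2)"
    using inner by (rule order_trans[OF sum_abs sum_mono])
  also have "\<dots> = (real n)\<^sup>2 * (\<epsilon> * real n ^ k)"
    unfolding sum_constant card_tuples by simp
  finally show ?thesis using n by simp
qed

text \<open>
  The edges are switched from \<open>y\<close> to \<open>x\<close> one at a time.
\<close>

lemma counting_lemma:
  assumes E: "E \<subseteq> nsets {1..k} 2" and n: "0 < n"
    and x: "\<And>s. s \<in> square n \<Longrightarrow> x s \<in> {0..1}" and y: "\<And>s. s \<in> square n \<Longrightarrow> y s \<in> {0..1}"
    and close: "cut_small n \<epsilon> (\<lambda>s. x s - y s)"
  shows "\<bar>hom_sum k n E x - hom_sum k n E y\<bar> \<le> real (card E) * (\<epsilon> * real n ^ k)"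
proof -
  let ?V = "PiE {1..k} (\<lambda>_. {1..n})"
  let ?at = "\<lambda>v f. (v (Min f), v (Max f))"
  \<comment> \<open>Edges in \<open>F\<close> have been switched to \<open>x\<close> already.\<close>
  define hyb where "hyb F = (\<Sum>v\<in>?V. \<Prod>f\<in>E. (if f \<in> F then x else y) (?at v f))" for F
  have finE: "finite E" using E finite_imp_finite_nsets[of "{1..k}" 2] finite_subset by blast
  have "\<bar>hyb F - hyb {}\<bar> \<le> real (card F) * (\<epsilon> * real n ^ k)" if "finite F" "F \<subseteq> E" for F
    using that
  proof (induction F)
    case (insert e F)
    have ins: "E = insert e (E - {e})" using insert by auto
    have P: "(\<Prod>f\<in>E. g f) = g e * (\<Prod>f\<in>E - {e}. g f)" for g :: "nat set \<Rightarrow> real"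
      using insert finE by (simp add: prod.remove)
    have "hyb (insert e F) - hyb F
        = (\<Sum>v\<in>?V. (x (?at v e) - y (?at v e)) * (\<Prod>f\<in>E - {e}. (if f \<in> F then x else y) (?at v f)))"
      unfolding hyb_def sum_subtractf[symmetric]
    proof (rule sum.cong)
      fix v
      have "(\<Prod>f\<in>E - {e}. (if f \<in> insert e F then x else y) (?at v f)) = (\<Prod>f\<in>E - {e}. (if f \<in> F then x else y) (?at v f))"
        by (rule prod.cong) auto
      then show "(\<Prod>f\<in>E. (if f \<in> insert e F then x else y) (?at v f)) - (\<Prod>f\<in>E. (if f \<in> F then x else y) (?at v f))
        = (x (?at v e) - y (?at v e)) * (\<Prod>f\<in>E - {e}. (if f \<in> F then x else y) (?at v f))"
        using insert.hyps by (simp add: P left_diff_distrib)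
    qed simp
    also have "\<bar>\<dots>\<bar> \<le> \<epsilon> * real n ^ k"
      by (rule single_edge_bound[where z = "\<lambda>f. if f \<in> F then x else y", OF close n])
        (use E x y insert in auto)
    finally have "\<bar>hyb (insert e F) - hyb F\<bar> \<le> \<epsilon> * real n ^ k" .
    then show ?case using insert by (simp add: algebra_simps)
  qed simp
  from this[OF finE order_refl] show ?thesis by (simp add: hyb_def hom_sum_def)
qed

lemma prod_le_avg_power:
  fixes a :: "'a \<Rightarrow> real"
  assumes "finite S" "S \<noteq> {}" "\<And>i. i \<in> S \<Longrightarrow> 0 \<le> a i"
  shows "(\<Prod>i\<in>S. a i) \<le> (\<Sum>i\<in>S. a i ^ card S) / card S"
proof -
  have c: "0 < card S" using assms by (simp add: card_gt_0_iff)
  have "(\<Prod>i\<in>S. a i ^ card S) powr (1 / card S) \<le> (\<Sum>i\<in>S. a i ^ card S) / card S"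
    using arith_geom_mean[OF assms(1,2), of "\<lambda>i. a i ^ card S"] assms(3)
    by (simp add: sum_divide_distrib)
  moreover have "(\<Prod>i\<in>S. a i ^ card S) powr (1 / card S) = (\<Prod>i\<in>S. a i)"
  proof -
    have "0 \<le> (\<Prod>i\<in>S. a i)" using assms by (simp add: prod_nonneg)
    then have "(\<Prod>i\<in>S. a i) = root (card S) ((\<Prod>i\<in>S. a i) ^ card S)"
      using c by (simp add: real_root_power_cancel)
    also have "\<dots> = ((\<Prod>i\<in>S. a i) ^ card S) powr (1 / card S)"
      using c \<open>0 \<le> (\<Prod>i\<in>S. a i)\<close> by (simp add: root_powr_inverse)
    finally show ?thesis by (simp only: prod_power_distrib)
  qed
  ultimately show ?thesis by simp
qed

text \<open>
  The product over the edges is at most the mean of their \<open>p\<close>-th powers, and each edge alone averages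
  to the mean over all pairs. Equality for constant matrices is the reason why constants are optimal
  when \<open>\<beta>\<^sub>2 \<ge> 0\<close>.
\<close>

lemma hom_sum_le_power_sum:
  assumes E: "E \<subseteq> nsets {1..k} 2" "E \<noteq> {}" and n: "0 < n"
    and y: "\<And>s. s \<in> square n \<Longrightarrow> 0 \<le> y s"
  shows "(real n)\<^sup>2 * hom_sum k n E y \<le> real n ^ k * (\<Sum>s\<in>square n. y s ^ card E)"
proof -
  let ?V = "PiE {1..k} (\<lambda>_. {1..n})"
  have fin: "finite E" using E finite_imp_finite_nsets[of "{1..k}" 2] finite_subset by blast
  then have c: "0 < card E" using E by (simp add: card_gt_0_iff)
  have "hom_sum k n E y \<le> (\<Sum>v\<in>?V. (\<Sum>e\<in>E. y (v (Min e), v (Max e)) ^ card E) / card E)"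
    unfolding hom_sum_def
  proof (intro sum_mono prod_le_avg_power)
    fix v e assume "v \<in> ?V" "e \<in> E"
    then show "0 \<le> y (v (Min e), v (Max e))"
      using edge_endpoints(1,2)[of e k] E(1) by (intro y) (auto simp: PiE_iff subset_iff)
  qed (use fin E in auto)
  also have "\<dots> = (\<Sum>e\<in>E. \<Sum>v\<in>?V. y (v (Min e), v (Max e)) ^ card E) / card E"
    by (subst sum.swap) (simp add: sum_divide_distrib)
  finally have "(real n)\<^sup>2 * hom_sum k n E y
      \<le> (real n)\<^sup>2 * ((\<Sum>e\<in>E. \<Sum>v\<in>?V. y (v (Min e), v (Max e)) ^ card E) / card E)"
    by (rule mult_left_mono) simp
  also have "\<dots> = (\<Sum>e\<in>E. (real n)\<^sup>2 * (\<Sum>v\<in>?V. y (v (Min e), v (Max e)) ^ card E)) / card E"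
    by (simp add: sum_distrib_left)
  also have "\<dots> = (\<Sum>e\<in>E. real n ^ k * (\<Sum>s\<in>square n. y s ^ card E)) / card E"
  proof -
    have "(real n)\<^sup>2 * (\<Sum>v\<in>?V. y (v (Min e), v (Max e)) ^ card E)
        = real n ^ k * (\<Sum>s\<in>square n. y s ^ card E)" if "e \<in> E" for e
      using edge_endpoints[of e k] that E(1)
      by (intro sum_two_coordinates[of "Min e" k "Max e" n "\<lambda>s. y s ^ card E"]) (auto simp: subset_iff)
    then show ?thesis by simp
  qed
  also have "\<dots> = real n ^ k * (\<Sum>s\<in>square n. y s ^ card E)" using c by simp
  finally show ?thesis .
qed


section \<open>Cut distance and homomorphism densities of step graphons\<close>

text \<open>
  The two factors are Lebesgue but possibly not Borel measurable; each is a Borel set up to a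
  subset of a Borel null set, and these null sets produce null strips in the plane.
\<close>

lemma lebesgue_rectangle:
  fixes A B :: "real set"
  assumes A: "A \<in> sets lebesgue" and B: "B \<in> sets lebesgue"
  shows "A \<times> B \<in> sets lebesgue" "emeasure lebesgue (A \<times> B) = emeasure lebesgue A * emeasure lebesgue B"
proof -
  obtain A' M M' where A': "A = A' \<union> M" "M \<subseteq> M'" "M' \<in> null_sets lborel" "A' \<in> sets lborel"
    using sets_completionE[OF A] by metis
  obtain B' N N' where B': "B = B' \<union> N" "N \<subseteq> N'" "N' \<in> null_sets lborel" "B' \<in> sets lborel"
    using sets_completionE[OF B] by metis
  have UN: "(UNIV :: real set) \<in> sets lborel" by simp
  have M: "M' \<times> UNIV \<in> null_sets (lborel \<Otimes>\<^sub>M lborel :: (real \<times> real) measure)"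
    using A'(3) UN by (intro lborel.times_in_null_sets1)
  have N: "UNIV \<times> N' \<in> null_sets (lborel \<Otimes>\<^sub>M lborel :: (real \<times> real) measure)"
    using B'(3) UN by (intro lborel.times_in_null_sets2)
  have null: "(M' \<times> UNIV) \<union> (UNIV \<times> N') \<in> null_sets (lborel :: (real \<times> real) measure)"
    using null_sets.Un[OF M N] by (simp add: lborel_prod)
  have rect: "A' \<times> B' \<in> sets (lborel :: (real \<times> real) measure)"
    using A'(4) B'(4) by (simp add: borel_Times)
  define R where "R = A \<times> B - A' \<times> B'"
  have R: "R \<in> null_sets (lebesgue :: (real \<times> real) measure)"
    by (rule null_sets_completionI[OF null, THEN null_sets_completion_subset[rotated]])
      (use A'(1,2) B'(1,2) in \<open>auto simp: R_def\<close>)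
  have eq: "A \<times> B = A' \<times> B' \<union> R" using A'(1) B'(1) by (auto simp: R_def)
  show "A \<times> B \<in> sets lebesgue"
    unfolding eq using rect R by (intro sets.Un) auto
  have "emeasure lebesgue (A \<times> B) = emeasure lebesgue (A' \<times> B')"
    unfolding eq using rect R by (intro emeasure_Un_null_set) auto
  also have "\<dots> = emeasure (lborel \<Otimes>\<^sub>M lborel) (A' \<times> B')"
    using rect by (simp add: lborel_prod)
  also have "\<dots> = emeasure lborel A' * emeasure lborel B'"
    using A'(4) B'(4) by (rule lborel.emeasure_pair_measure_Times)
  also have "emeasure lborel A' = emeasure lebesgue A"
    unfolding A'(1) using A'(2-4) by (subst emeasure_Un_null_set) (auto intro: null_sets_completionI null_sets_completion_subset)
  also have "emeasure lborel B' = emeasure lebesgue B"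
    unfolding B'(1) using B'(2-4) by (subst emeasure_Un_null_set) (auto intro: null_sets_completionI null_sets_completion_subset)
  finally show "emeasure lebesgue (A \<times> B) = emeasure lebesgue A * emeasure lebesgue B" .
qed

text \<open>
  The points which the rounding in the graphon sends to \<open>i\<close>. The cell of the spurious index \<open>0\<close> is
  the null set \<open>{0}\<close>; keeping it makes the identities below hold at every point.
\<close>

definition cell :: "nat \<Rightarrow> nat \<Rightarrow> real set" where
  "cell n i = (if i = 0 then {0} else {(real i - 1) / real n <.. real i / real n})"

lemma cell_iff:
  assumes n: "0 < n"
  shows "x \<in> cell n i \<and> i \<le> n \<longleftrightarrow> x \<in> {0..1} \<and> nat \<lceil>real n * x\<rceil> = i"
proof (cases "i = 0")
  case True
  have "x = 0 \<longleftrightarrow> 0 \<le> x \<and> x \<le> 1 \<and> real n * x \<le> 0"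
    using n by (auto simp: mult_le_0_iff)
  then show ?thesis using True by (auto simp: cell_def)
next
  case False
  have "nat \<lceil>real n * x\<rceil> = i \<longleftrightarrow> \<lceil>real n * x\<rceil> = int i" using False by auto
  also have "\<dots> \<longleftrightarrow> real i - 1 < real n * x \<and> real n * x \<le> real i"
    by (simp add: ceiling_eq_iff)
  also have "\<dots> \<longleftrightarrow> x \<in> cell n i"
    using n False by (simp add: cell_def field_simps)
  finally have iff: "nat \<lceil>real n * x\<rceil> = i \<longleftrightarrow> x \<in> cell n i" .
  have lower: "0 < x" if "x \<in> cell n i"
  proof -
    have "0 \<le> (real i - 1) / real n" using False by simp
    also have "\<dots> < x" using that False by (simp add: cell_def)
    finally show ?thesis .
  qed
  have upper: "x \<le> 1" if "x \<in> cell n i" "i \<le> n"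
  proof -
    have "x \<le> real i / real n" using that False by (simp add: cell_def)
    also have "\<dots> \<le> 1" using n that by simp
    finally show ?thesis .
  qed
  have "i \<le> n" if "x \<in> cell n i" "x \<le> 1"
  proof -
    have "real i - 1 < real n * x" using that n False by (simp add: cell_def field_simps)
    also have "\<dots> \<le> real n * 1" using that by (intro mult_left_mono) auto
    finally show ?thesis by simp
  qed
  then show ?thesis using iff lower upper by (auto simp: less_imp_le)
qed

lemma cell_borel [measurable]: "cell n i \<in> sets borel"
  by (simp add: cell_def)

lemma measure_cell: "0 < n \<Longrightarrow> measure lborel (cell n i) = (if i = 0 then 0 else 1 / real n)"
  by (simp add: cell_def divide_right_mono diff_divide_distrib)

lemma cell_lmeasurable: "cell n i \<in> lmeasurable"
proof (rule bounded_set_imp_lmeasurable)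
  show "bounded (cell n i)"
    by (rule bounded_subset[of "{(real i - 1) / real n..real i / real n} \<union> {0}"]) (auto simp: cell_def)
qed simp

definition weight_matrix :: "nat \<Rightarrow> wgraph \<Rightarrow> nat \<times> nat \<Rightarrow> real" where
  "weight_matrix n G = (\<lambda>(i, j). weight n G i j)"

text \<open>
  The integrand is a linear combination of products of indicators of cells, which integrate to
  \<open>n\<^bsup>-k\<^esup>\<close> unless one of the indices is \<open>0\<close>.
\<close>

lemma hom_density_eq_hom_sum:
  assumes n: "0 < n" and E: "E \<subseteq> nsets {1..k} 2"
  shows "hom_density k E (graphon_of n G) = hom_sum k n E (weight_matrix n G) / real n ^ k"
proof -
  interpret product_sigma_finite "\<lambda>_::nat. lborel :: real measure" by standard
  let ?M = "PiM {1..k} (\<lambda>_. lborel :: real measure)"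
  let ?V = "PiE {1..k} (\<lambda>_. {0..n})"
  let ?c = "\<lambda>v. \<Prod>e\<in>E. weight_matrix n G (v (Min e), v (Max e))"
  let ?f = "\<lambda>v x. ?c v * (\<Prod>i\<in>{1..k}. indicator (cell n (v i)) (x i) :: real)"
  have pointwise: "indicator (PiE {1..k} (\<lambda>_. {0..1})) x *\<^sub>R (\<Prod>e\<in>E. graphon_of n G (x (Min e)) (x (Max e)))
      = (\<Sum>v\<in>?V. ?f v x)" if x: "x \<in> space ?M" for x
  proof (cases "x \<in> PiE {1..k} (\<lambda>_. {0..1})")
    case True
    define v0 where "v0 = restrict (\<lambda>i. nat \<lceil>real n * x i\<rceil>) {1..k}"
    have cells: "x i \<in> cell n j \<and> j \<le> n \<longleftrightarrow> nat \<lceil>real n * x i\<rceil> = j" if "i \<in> {1..k}" for i j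
      using cell_iff[OF n, of "x i" j] True that by (auto simp: PiE_iff)
    have "nat \<lceil>real n * x i\<rceil> \<le> n" if "i \<in> {1..k}" for i using cells[OF that] by blast
    then have v0: "v0 \<in> ?V" by (auto simp: v0_def)
    have "?f v x = (if v = v0 then ?c v0 else 0)" if v: "v \<in> ?V" for v
    proof (cases "v = v0")
      case True
      have "indicator (cell n (v i)) (x i) = (1 :: real)" if "i \<in> {1..k}" for i
        using cells[OF that, of "v i"] that by (simp add: True v0_def)
      then show ?thesis using True by simp
    next
      case False
      then obtain i where i: "i \<in> {1..k}" "v i \<noteq> v0 i" using v v0 by (metis PiE_ext)
      then have "x i \<notin> cell n (v i)" using cells[OF i(1), of "v i"] v by (auto simp: v0_def PiE_iff)
      then have "(\<Prod>i\<in>{1..k}. indicator (cell n (v i)) (x i) :: real) = 0"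
        using i(1) by (intro prod_zero bexI[of _ i]) auto
      then show ?thesis using False by simp
    qed
    then have "(\<Sum>v\<in>?V. ?f v x) = (\<Sum>v\<in>?V. if v = v0 then ?c v0 else 0)" by (rule sum.cong[OF refl])
    also have "\<dots> = ?c v0" using v0 by (simp add: finite_PiE)
    also have "\<dots> = (\<Prod>e\<in>E. graphon_of n G (x (Min e)) (x (Max e)))"
    proof (rule prod.cong)
      fix e assume "e \<in> E"
      then have "Min e \<in> {1..k}" "Max e \<in> {1..k}" using edge_endpoints[of e k] E by blast+
      then show "weight_matrix n G (v0 (Min e), v0 (Max e)) = graphon_of n G (x (Min e)) (x (Max e))"
        by (simp add: weight_matrix_def graphon_of_def v0_def)
    qed simp
    finally show ?thesis using True by simp
  next
    case False
    then obtain i where i: "i \<in> {1..k}" "x i \<notin> {0..1}" using x by (auto simp: space_PiM PiE_iff)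
    have "?f v x = 0" if v: "v \<in> ?V" for v
    proof -
      have "v i \<le> n" using v i by (auto simp: PiE_iff)
      then have "x i \<notin> cell n (v i)" using cell_iff[OF n, of "x i" "v i"] i by blast
      then have "(\<Prod>i\<in>{1..k}. indicator (cell n (v i)) (x i) :: real) = 0"
        using i(1) by (intro prod_zero bexI[of _ i]) auto
      then show ?thesis by simp
    qed
    then have "(\<Sum>v\<in>?V. ?f v x) = 0" by (rule sum.neutral[OF ballI])
    then show ?thesis using False by simp
  qed
  have int: "integrable lborel (\<lambda>t. indicator (cell n i) t :: real)" for i
    by (rule integrable_real_indicator) (auto simp: cell_def divide_right_mono)
  have "hom_density k E (graphon_of n G) = (\<integral>x. (\<Sum>v\<in>?V. ?f v x) \<partial>?M)"
    unfolding hom_density_def set_lebesgue_integral_def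
    by (rule Bochner_Integration.integral_cong[OF refl pointwise])
  also have "\<dots> = (\<Sum>v\<in>?V. \<integral>x. ?f v x \<partial>?M)"
    by (rule Bochner_Integration.integral_sum)
      (intro integrable_mult_right product_integrable_prod int finite_atLeastAtMost)
  also have "\<dots> = (\<Sum>v\<in>?V. ?c v * (\<Prod>i\<in>{1..k}. measure lborel (cell n (v i))))"
    by (simp add: product_integral_prod[OF finite_atLeastAtMost int])
  also have "\<dots> = (\<Sum>v\<in>PiE {1..k} (\<lambda>_. {1..n}). ?c v * (\<Prod>i\<in>{1..k}. measure lborel (cell n (v i))))"
  proof (rule sum.mono_neutral_right)
    show "\<forall>v\<in>?V - PiE {1..k} (\<lambda>_. {1..n}). ?c v * (\<Prod>i\<in>{1..k}. measure lborel (cell n (v i))) = 0"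
    proof
      fix v assume v: "v \<in> ?V - PiE {1..k} (\<lambda>_. {1..n})"
      then obtain i where i: "i \<in> {1..k}" "v i \<notin> {1..n}" by (auto simp: PiE_iff)
      have "v i \<le> n" using v i(1) by (auto simp: PiE_iff)
      then have "v i = 0" using i(2) by auto
      then have "measure lborel (cell n (v i)) = 0" using measure_cell[OF n] by simp
      then have "(\<Prod>i\<in>{1..k}. measure lborel (cell n (v i))) = 0"
        using i by (intro prod_zero) auto
      then show "?c v * (\<Prod>i\<in>{1..k}. measure lborel (cell n (v i))) = 0" by simp
    qed
    have "{1..n} \<subseteq> {0..n}" by auto
    then show "PiE {1..k} (\<lambda>_. {1..n}) \<subseteq> ?V" by (intro PiE_mono)
  qed (simp add: finite_PiE)
  also have "\<dots> = (\<Sum>v\<in>PiE {1..k} (\<lambda>_. {1..n}). ?c v * (1 / real n) ^ k)"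
  proof (rule sum.cong)
    fix v assume v: "v \<in> PiE {1..k} (\<lambda>_. {1..n})"
    have "measure lborel (cell n (v i)) = 1 / real n" if "i \<in> {1..k}" for i
    proof -
      have "v i \<in> {1..n}" using v that by (rule PiE_mem)
      then show ?thesis using measure_cell[OF n, of "v i"] by simp
    qed
    then show "?c v * (\<Prod>i\<in>{1..k}. measure lborel (cell n (v i))) = ?c v * (1 / real n) ^ k" by simp
  qed simp
  also have "\<dots> = hom_sum k n E (weight_matrix n G) / real n ^ k"
    by (simp only: hom_sum_def sum_distrib_right[symmetric] power_one_over) simp
  finally show ?thesis .
qed

text \<open>
  The integral is a bilinear sum over pairs of cells in which the \<open>i\<close>-th cell has the weight
  \<open>n \<bar>S \<inter> cell n i\<bar> \<in> [0, 1]\<close>.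
\<close>

lemma rectangle_integral_bound:
  assumes n: "0 < n" and small: "cut_small n \<epsilon> (\<lambda>s. weight_matrix n G s - u)"
    and S: "S \<in> sets lebesgue" "S \<subseteq> {0..1}" and T: "T \<in> sets lebesgue" "T \<subseteq> {0..1}"
  shows "\<bar>set_lebesgue_integral lebesgue (S \<times> T) (\<lambda>(x, y). graphon_of n G x y - u)\<bar> \<le> \<epsilon>"
proof -
  let ?d = "\<lambda>s. weight_matrix n G s - u"
  have cut: "A \<inter> cell n i \<in> lmeasurable" if "A \<in> sets lebesgue" for A i
    using fmeasurable_Int_fmeasurable[OF cell_lmeasurable that, of n i] by (simp add: Int_commute)
  have rect: "(S \<inter> cell n i) \<times> (T \<inter> cell n j) \<in> lmeasurable"
    "measure lebesgue ((S \<inter> cell n i) \<times> (T \<inter> cell n j)) = measure lebesgue (S \<inter> cell n i) * measure lebesgue (T \<inter> cell n j)" for i j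
  proof -
    note sets = fmeasurableD[OF cut[OF S(1)], of i] fmeasurableD[OF cut[OF T(1)], of j]
    show "(S \<inter> cell n i) \<times> (T \<inter> cell n j) \<in> lmeasurable"
      using lebesgue_rectangle[OF sets] cut[OF S(1), of i] cut[OF T(1), of j]
      by (intro fmeasurableI) (auto simp: fmeasurable_def ennreal_mult_less_top)
    show "measure lebesgue ((S \<inter> cell n i) \<times> (T \<inter> cell n j)) = measure lebesgue (S \<inter> cell n i) * measure lebesgue (T \<inter> cell n j)"
      using lebesgue_rectangle(2)[OF sets] by (simp add: measure_def enn2real_mult)
  qed
  have pointwise: "indicator (S \<times> T) z *\<^sub>R (case z of (x, y) \<Rightarrow> graphon_of n G x y - u)
      = (\<Sum>s\<in>{0..n} \<times> {0..n}. ?d s * indicator ((S \<inter> cell n (fst s)) \<times> (T \<inter> cell n (snd s))) z)" for z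
  proof (cases "z \<in> S \<times> T")
    case True
    obtain x y where z: "z = (x, y)" by (cases z)
    let ?s = "(nat \<lceil>real n * x\<rceil>, nat \<lceil>real n * y\<rceil>)"
    have x: "x \<in> {0..1}" "y \<in> {0..1}" using True z S T by auto
    have cx: "x \<in> cell n i \<and> i \<le> n \<longleftrightarrow> nat \<lceil>real n * x\<rceil> = i" for i using cell_iff[OF n] x by blast
    have cy: "y \<in> cell n i \<and> i \<le> n \<longleftrightarrow> nat \<lceil>real n * y\<rceil> = i" for i using cell_iff[OF n] x by blast
    have "(\<Sum>s\<in>{0..n} \<times> {0..n}. ?d s * indicator ((S \<inter> cell n (fst s)) \<times> (T \<inter> cell n (snd s))) z)
        = (\<Sum>s\<in>{0..n} \<times> {0..n}. if s = ?s then ?d ?s else 0)"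
    proof (rule sum.cong)
      fix s assume s: "s \<in> {0..n} \<times> {0..n}"
      have "z \<in> (S \<inter> cell n (fst s)) \<times> (T \<inter> cell n (snd s)) \<longleftrightarrow> s = ?s"
        using True z cx[of "fst s"] cy[of "snd s"] s by (cases s) auto
      then show "?d s * indicator ((S \<inter> cell n (fst s)) \<times> (T \<inter> cell n (snd s))) z = (if s = ?s then ?d ?s else 0)"
        by (simp add: indicator_def)
    qed simp
    also have "\<dots> = ?d ?s"
    proof -
      have "?s \<in> {0..n} \<times> {0..n}" using cx cy by (metis SigmaI atLeastAtMost_iff zero_le)
      then show ?thesis by (subst sum.delta) auto
    qed
    finally show ?thesis using True z by (simp add: weight_matrix_def graphon_of_def)
  next
    case False
    then have "indicator ((S \<inter> cell n (fst s)) \<times> (T \<inter> cell n (snd s))) z = (0 :: real)" for s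
      by (auto simp: indicator_def)
    then show ?thesis using False by simp
  qed
  have "set_lebesgue_integral lebesgue (S \<times> T) (\<lambda>(x, y). graphon_of n G x y - u)
      = (\<integral>z. (\<Sum>s\<in>{0..n} \<times> {0..n}. ?d s * indicator ((S \<inter> cell n (fst s)) \<times> (T \<inter> cell n (snd s))) z) \<partial>lebesgue)"
    unfolding set_lebesgue_integral_def pointwise ..
  also have "\<dots> = (\<Sum>s\<in>{0..n} \<times> {0..n}. \<integral>z. ?d s * indicator ((S \<inter> cell n (fst s)) \<times> (T \<inter> cell n (snd s))) z \<partial>lebesgue)"
    by (intro Bochner_Integration.integral_sum integrable_mult_right integrable_real_indicator
        fmeasurableD[OF rect(1)]) (use fmeasurableD2[OF rect(1)] in \<open>simp add: less_top del: emeasure_completion\<close>)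
  also have "\<dots> = (\<Sum>s\<in>{0..n} \<times> {0..n}. ?d s * (measure lebesgue (S \<inter> cell n (fst s)) * measure lebesgue (T \<inter> cell n (snd s))))"
    by (simp add: rect(2))
  also have "\<dots> = (\<Sum>s\<in>square n. ?d s * (measure lebesgue (S \<inter> cell n (fst s)) * measure lebesgue (T \<inter> cell n (snd s))))"
  proof (rule sum.mono_neutral_right)
    have "measure lebesgue (A \<inter> cell n 0) = 0" if "A \<in> sets lebesgue" for A
    proof -
      have "measure lebesgue (A \<inter> cell n 0) \<le> measure lebesgue (cell n 0)"
        using that cell_lmeasurable cut by (intro measure_mono_fmeasurable) auto
      then show ?thesis by (simp add: cell_def measure_le_0_iff)
    qed
    then have zero: "measure lebesgue (S \<inter> cell n 0) = 0" "measure lebesgue (T \<inter> cell n 0) = 0" using S T by auto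
    show "\<forall>s\<in>{0..n} \<times> {0..n} - square n. ?d s * (measure lebesgue (S \<inter> cell n (fst s)) * measure lebesgue (T \<inter> cell n (snd s))) = 0"
    proof
      fix s assume "s \<in> {0..n} \<times> {0..n} - square n"
      then have "fst s = 0 \<or> snd s = 0" by (cases s) auto
      then show "?d s * (measure lebesgue (S \<inter> cell n (fst s)) * measure lebesgue (T \<inter> cell n (snd s))) = 0"
        using zero by auto
    qed
  qed auto
  also have "\<dots> = (\<Sum>i=1..n. \<Sum>j=1..n. (real n * measure lebesgue (S \<inter> cell n i)) * (real n * measure lebesgue (T \<inter> cell n j)) * ?d (i, j)) / (real n)\<^sup>2"
    using n by (simp add: sum.cartesian_product sum_divide_distrib power2_eq_square mult_ac split_def)
  finally have eq: "set_lebesgue_integral lebesgue (S \<times> T) (\<lambda>(x, y). graphon_of n G x y - u) = \<dots>" .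
  have unit: "real n * measure lebesgue (A \<inter> cell n i) \<in> {0..1}" if "A \<in> sets lebesgue" "i \<in> {1..n}" for A i
  proof -
    have "measure lebesgue (A \<inter> cell n i) \<le> measure lebesgue (cell n i)"
      using that cell_lmeasurable cut by (intro measure_mono_fmeasurable) auto
    also have "\<dots> = 1 / real n" using measure_cell[OF n, of i] that by simp
    finally show ?thesis using n by (simp add: field_simps)
  qed
  have "\<bar>\<Sum>i=1..n. \<Sum>j=1..n. (real n * measure lebesgue (S \<inter> cell n i)) * (real n * measure lebesgue (T \<inter> cell n j)) * ?d (i, j)\<bar> \<le> \<epsilon> * (real n)\<^sup>2"
    using cut_small_bilinear[OF small unit[OF S(1)] unit[OF T(1)]] .
  then show ?thesis unfolding eq using n by (simp add: abs_divide pos_divide_le_eq)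
qed

lemma cut_dist_le:
  assumes "0 < n" "cut_small n \<epsilon> (\<lambda>s. weight_matrix n G s - u)"
  shows "cut_dist (graphon_of n G) (\<lambda>x y. u) \<le> \<epsilon>"
  unfolding cut_dist_def
proof (rule cSUP_least)
  show "{S \<in> sets lebesgue. S \<subseteq> {0..1::real}} \<times> {T \<in> sets lebesgue. T \<subseteq> {0..1::real}} \<noteq> {}"
    by blast
qed (use rectangle_integral_bound[OF assms] in auto)

text \<open>
  Boundedness makes the supremum in the cut distance one of a bounded set, which it has to be for the
  supremum in the reals to be meaningful.
\<close>

lemma cut_dist_nonneg:
  assumes bound: "\<And>x y. \<bar>f x y - h x y\<bar> \<le> C"
  shows "0 \<le> cut_dist f h"
proof -
  let ?R = "{S \<in> sets lebesgue. S \<subseteq> {0..1::real}} \<times> {T \<in> sets lebesgue. T \<subseteq> {0..1::real}}"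
  let ?I = "\<lambda>S T. set_lebesgue_integral lebesgue (S \<times> T) (\<lambda>(x, y). f x y - h x y)"
  have C: "0 \<le> C" using bound[of 0 0] by linarith
  have "\<bar>?I S T\<bar> \<le> C * measure lebesgue (cbox (0, 0) (1, 1::real) :: (real \<times> real) set)"
    if "S \<subseteq> {0..1}" "T \<subseteq> {0..1}" for S T :: "real set"
  proof -
    have "\<bar>?I S T\<bar> \<le> (\<integral>z. \<bar>indicator (S \<times> T) z *\<^sub>R (case z of (x, y) \<Rightarrow> f x y - h x y)\<bar> \<partial>lebesgue)"
      unfolding set_lebesgue_integral_def by (rule integral_abs_bound)
    also have "\<dots> \<le> (\<integral>z. C * indicator (cbox (0, 0) (1, 1::real)) (z :: real \<times> real) \<partial>lebesgue)"
    proof (rule Bochner_Integration.integral_mono')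
      show "integrable lebesgue (\<lambda>z. C * indicator (cbox (0, 0) (1, 1::real) :: (real \<times> real) set) z)"
        by (intro integrable_mult_right integrable_real_indicator) (auto simp: emeasure_lborel_cbox_eq)
      show "\<bar>indicator (S \<times> T) z *\<^sub>R (case z of (x, y) \<Rightarrow> f x y - h x y)\<bar> \<le> C * indicator (cbox (0, 0) (1, 1)) z" for z
        using bound C that by (cases z) (force simp: indicator_def cbox_Pair_eq)
    qed (use C in simp)
    finally show ?thesis by simp
  qed
  then have "bdd_above ((\<lambda>(S, T). \<bar>?I S T\<bar>) ` ?R)" by (intro bdd_aboveI2) auto
  then have "(case ({}, {}) of (S, T) \<Rightarrow> \<bar>?I S T\<bar>) \<le> cut_dist f h"
    unfolding cut_dist_def by (intro cSUP_upper) auto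
  then show ?thesis by (simp add: set_lebesgue_integral_def)
qed

lemma graphon_self: "h \<in> graphon_class h"
proof -
  have "mp_bijection (\<lambda>x. x)"
    using distr_id[of "lebesgue_on {0..1}"] by (simp add: mp_bijection_def bij_betw_def)
  then show ?thesis unfolding graphon_class_def by (intro CollectI exI[of _ "\<lambda>x. x"]) auto
qed

text \<open>
  The upper bound uses the representatives without relabelling; the lower bound needs all of them.
\<close>

lemma class_dist_constant_bounds:
  assumes n: "0 < n" and small: "cut_small n \<epsilon> (\<lambda>s. weight_matrix n G s - u)"
  shows "class_dist (graphon_class (graphon_of n G)) (graphon_class (\<lambda>x y. u)) \<in> {0..\<epsilon>}"
proof -
  define C where "C = (\<Sum>e\<in>nsets {1..n} 2. \<bar>G e\<bar>) + \<bar>u\<bar>"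
  have w: "\<bar>weight n G i j - u\<bar> \<le> C" for i j
  proof -
    have "\<bar>weight n G i j\<bar> \<le> (\<Sum>e\<in>nsets {1..n} 2. \<bar>G e\<bar>)"
      unfolding weight_def using finite_imp_finite_nsets[of "{1..n}" 2]
      by (auto intro!: member_le_sum[of "{i, j}" _ "\<lambda>e. \<bar>G e\<bar>"] sum_nonneg)
    then show ?thesis unfolding C_def by linarith
  qed
  have nonneg: "0 \<le> (case z of (f, h) \<Rightarrow> cut_dist f h)"
    if "z \<in> graphon_class (graphon_of n G) \<times> graphon_class (\<lambda>x y. u)" for z
    using that w by (auto simp: graphon_class_def graphon_of_def intro!: cut_dist_nonneg[of _ _ C])
  have "0 \<le> class_dist (graphon_class (graphon_of n G)) (graphon_class (\<lambda>x y. u))"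
    unfolding class_dist_def using graphon_self nonneg by (intro cINF_greatest) auto
  moreover have "class_dist (graphon_class (graphon_of n G)) (graphon_class (\<lambda>x y. u))
      \<le> (case (graphon_of n G, \<lambda>x y. u) of (f, h) \<Rightarrow> cut_dist f h)"
    unfolding class_dist_def using graphon_self nonneg
    by (intro cINF_lower bdd_belowI2[of _ 0]) auto
  ultimately show ?thesis using cut_dist_le[OF n small] by simp
qed


section \<open>Tilted graphs and the partition function\<close>

lemma sum_edges_eq_sum_pairs:
  fixes h :: "nat set \<Rightarrow> real"
  shows "(\<Sum>e\<in>nsets {1..n::nat} 2. h e) = (\<Sum>s\<in>{s \<in> square n. fst s < snd s}. h {fst s, snd s})"
proof (rule sum.reindex_bij_witness[of _ "\<lambda>s. {fst s, snd s}" "\<lambda>e. (Min e, Max e)"])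
  fix e assume "e \<in> nsets {1..n} 2"
  note e = edge_endpoints[OF this]
  show "{fst (Min e, Max e), snd (Min e, Max e)} = e" using e(4) by simp
  show "(Min e, Max e) \<in> {s \<in> square n. fst s < snd s}" using e by simp
  show "h {fst (Min e, Max e), snd (Min e, Max e)} = h e" using e(4) by simp
qed auto

lemma sum_offdiagonal_eq_sum_edges:
  fixes h :: "nat set \<Rightarrow> real"
  shows "(\<Sum>s\<in>square n. if fst s = snd s then 0 else h {fst s, snd s}) = 2 * (\<Sum>e\<in>nsets {1..n} 2. h e)"
proof -
  let ?U = "{s \<in> square n. fst s < snd s}" and ?L = "{s \<in> square n. snd s < fst s}"
  have "(\<Sum>s\<in>square n. if fst s = snd s then 0 else h {fst s, snd s})
      = (\<Sum>s\<in>?U \<union> ?L. h {fst s, snd s})"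
    by (rule sum.mono_neutral_cong_right) auto
  also have "\<dots> = (\<Sum>s\<in>?U. h {fst s, snd s}) + (\<Sum>s\<in>?L. h {fst s, snd s})"
    by (rule sum.union_disjoint) auto
  also have "(\<Sum>s\<in>?L. h {fst s, snd s}) = (\<Sum>s\<in>?U. h {fst s, snd s})"
    by (rule sum.reindex_bij_witness[of _ prod.swap prod.swap]) (auto simp: insert_commute)
  finally show ?thesis by (simp only: sum_edges_eq_sum_pairs mult_2)
qed

lemma card_edges: "real (card (nsets {1..n} 2)) = real n * (real n - 1) / 2"
proof -
  have "2 * real (card (nsets {1..n} 2)) = (\<Sum>s\<in>square n. if fst s = snd s then 0 else (1::real))"
    using sum_offdiagonal_eq_sum_edges[where n = n and h = "\<lambda>_. 1"] by simp
  also have "\<dots> = (\<Sum>i=1..n. \<Sum>j=1..n. 1 - (if i = j then 1 else 0))"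
    by (simp add: sum.cartesian_product) (rule sum.cong, auto)
  also have "\<dots> = real n * (real n - 1)"
    by (simp add: sum_subtractf algebra_simps)
  finally show ?thesis by simp
qed

lemma finite_edges: "finite (nsets {1..n::nat} 2)"
  by (simp add: finite_imp_finite_nsets)

definition unit_weights :: "nat \<Rightarrow> wgraph \<Rightarrow> bool" where
  "unit_weights n G \<longleftrightarrow> (\<forall>e\<in>nsets {1..n} 2. G e \<in> {0..1})"

lemma weight_matrix_unit: "unit_weights n G \<Longrightarrow> weight_matrix n G s \<in> {0..1}"
  by (cases s) (auto simp: weight_matrix_def weight_def unit_weights_def)

lemma weight_matrix_eq:
  "s \<in> square n \<Longrightarrow> weight_matrix n G s = (if fst s = snd s then 0 else G {fst s, snd s})"
  by (cases s) (auto simp: weight_matrix_def weight_def)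

lemma sum_weight_matrix: "(\<Sum>s\<in>square n. weight_matrix n G s) = 2 * (\<Sum>e\<in>nsets {1..n} 2. G e)"
  unfolding sum_offdiagonal_eq_sum_edges[symmetric] by (rule sum.cong) (auto simp: weight_matrix_eq)

lemma hom_sum_single_edge: "hom_sum 2 n {{1, 2}} x = (\<Sum>s\<in>square n. x s)"
proof (cases "n = 0")
  case True
  have "PiE {1..2::nat} (\<lambda>_. {1..0::nat}) = {}" by (auto simp: PiE_eq_empty_iff)
  then show ?thesis using True by (simp add: hom_sum_def)
next
  case False
  have "(real n)\<^sup>2 * (\<Sum>v\<in>PiE {1..2} (\<lambda>_. {1..n}). x (v 1, v (2::nat))) = real n ^ 2 * (\<Sum>s\<in>square n. x s)"
    by (rule sum_two_coordinates) auto
  moreover have "Min {1, 2::nat} = 1" "Max {1, 2::nat} = 2" by (simp_all add: numeral_2_eq_2)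
  then have "hom_sum 2 n {{1, 2}} x = (\<Sum>v\<in>PiE {1..2} (\<lambda>_. {1..n}). x (v 1, v (2::nat)))"
    by (simp only: hom_sum_def prod.insert[OF finite.emptyI] prod.empty empty_iff not_False_eq_True mult_1_right)
  ultimately show ?thesis using False by simp
qed

text \<open>
  In the scale of the exponent each edge contributes its weight twice, once for either orientation.
\<close>

lemma hamiltonian_eq:
  assumes n: "0 < n" and E: "E \<subseteq> nsets {1..k} 2"
  shows "(real n)\<^sup>2 * hamiltonian k E \<beta> n G = fst \<beta> * (2 * (\<Sum>e\<in>nsets {1..n} 2. G e))
    + snd \<beta> * ((real n)\<^sup>2 * (hom_sum k n E (weight_matrix n G) / real n ^ k))"
proof -
  have "hom_density 2 {{1, 2}} (graphon_of n G) = hom_sum 2 n {{1, 2}} (weight_matrix n G) / real n ^ 2"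
    by (rule hom_density_eq_hom_sum[OF n]) auto
  then have "(real n)\<^sup>2 * hom_density 2 {{1, 2}} (graphon_of n G) = 2 * (\<Sum>e\<in>nsets {1..n} 2. G e)"
    unfolding hom_sum_single_edge sum_weight_matrix using n by simp
  moreover have "(real n)\<^sup>2 * hamiltonian k E \<beta> n G
      = fst \<beta> * ((real n)\<^sup>2 * hom_density 2 {{1, 2}} (graphon_of n G))
      + snd \<beta> * ((real n)\<^sup>2 * hom_density k E (graphon_of n G))"
    by (simp add: hamiltonian_def algebra_simps)
  ultimately show ?thesis using hom_density_eq_hom_sum[OF n E] by simp
qed

lemma hom_sum_unit:
  assumes "E \<subseteq> nsets {1..k} 2" "unit_weights n G"
  shows "hom_sum k n E (weight_matrix n G) \<in> {0..real n ^ k}"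
proof -
  have "(\<Prod>e\<in>E. weight_matrix n G (v (Min e), v (Max e))) \<in> {0..1}" for v
    using weight_matrix_unit[OF assms(2)] by (auto intro!: prod_nonneg prod_le_1)
  then have p: "0 \<le> (\<Prod>e\<in>E. weight_matrix n G (v (Min e), v (Max e)))"
    "(\<Prod>e\<in>E. weight_matrix n G (v (Min e), v (Max e))) \<le> 1" for v by auto
  have "0 \<le> hom_sum k n E (weight_matrix n G)"
    unfolding hom_sum_def by (rule sum_nonneg) (rule p)
  moreover have "hom_sum k n E (weight_matrix n G) \<le> real (card (PiE {1..k} (\<lambda>_. {1..n}))) * 1"
    unfolding hom_sum_def by (rule sum_bounded_above) (rule p)
  ultimately show ?thesis unfolding card_tuples by simp
qed

text \<open>
  A union bound over pairs of coordinates. These tuples can see diagonal entries or the same edge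
  twice, so their expectation under a tilted product law is not \<open>u\<^sup>p\<close>.
\<close>

lemma noninjective_tuples:
  assumes n: "0 < n"
  shows "real (card {v \<in> PiE {1..k} (\<lambda>_. {1..n}). \<not> inj_on v {1..k}}) \<le> (real k)\<^sup>2 * (real n ^ k / real n)"
proof -
  let ?V = "PiE {1..k} (\<lambda>_. {1..n})" and ?P = "{s \<in> square k. fst s \<noteq> snd s}"
  have coincide: "(\<Sum>v\<in>?V. if v (fst s) = v (snd s) then 1 else 0) = real n ^ k / real n" if "s \<in> ?P" for s
  proof -
    have s: "fst s \<in> {1..k}" "snd s \<in> {1..k}" "fst s \<noteq> snd s" using that by auto
    have "(real n)\<^sup>2 * (\<Sum>v\<in>?V. if v (fst s) = v (snd s) then 1 else 0)
        = real n ^ k * (\<Sum>s\<in>square n. if fst s = snd s then 1 else 0)"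
      using sum_two_coordinates[OF s, of n "\<lambda>s. if fst s = snd s then 1 else 0"] by simp
    also have "(\<Sum>s\<in>square n. if fst s = snd s then 1 else (0::real)) = (\<Sum>i=1..n. \<Sum>j=1..n. if i = j then 1 else 0)"
      by (simp only: sum.cartesian_product split_def)
    also have "\<dots> = real n" by simp
    finally show ?thesis using n by (simp add: power2_eq_square field_simps)
  qed
  have "real (card {v \<in> ?V. \<not> inj_on v {1..k}}) = (\<Sum>v\<in>{v \<in> ?V. \<not> inj_on v {1..k}}. 1)" by simp
  also have "\<dots> \<le> (\<Sum>v\<in>{v \<in> ?V. \<not> inj_on v {1..k}}. \<Sum>s\<in>?P. if v (fst s) = v (snd s) then 1 else 0)"
  proof (rule sum_mono)
    fix v assume "v \<in> {v \<in> ?V. \<not> inj_on v {1..k}}"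
    then obtain i j where ij: "i \<in> {1..k}" "j \<in> {1..k}" "i \<noteq> j" "v i = v j" by (auto simp: inj_on_def)
    show "1 \<le> (\<Sum>s\<in>?P. if v (fst s) = v (snd s) then 1 else (0::real))"
      using ij member_le_sum[of "(i, j)" ?P "\<lambda>s. if v (fst s) = v (snd s) then 1 else (0::real)"] by auto
  qed
  also have "\<dots> \<le> (\<Sum>v\<in>?V. \<Sum>s\<in>?P. if v (fst s) = v (snd s) then 1 else 0)"
    by (rule sum_mono2) (auto simp: finite_PiE intro: sum_nonneg)
  also have "\<dots> = (\<Sum>s\<in>?P. real n ^ k / real n)"
    by (subst sum.swap) (use coincide in simp)
  also have "\<dots> \<le> (real k)\<^sup>2 * (real n ^ k / real n)"
  proof -
    have "card ?P \<le> card (square k)" by (rule card_mono) auto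
    then have "real (card ?P) \<le> (real k)\<^sup>2"
      by (simp add: card_cartesian_product power2_eq_square flip: of_nat_mult)
    then have "real (card ?P) * (real n ^ k / real n) \<le> (real k)\<^sup>2 * (real n ^ k / real n)"
      by (rule mult_right_mono) simp
    then show ?thesis by simp
  qed
  finally show ?thesis .
qed

text \<open>
  The density, with respect to the product law, under which the weight of the edge \<open>e\<close> is tilted by
  \<open>t e\<close>.
\<close>

definition tilt :: "real measure \<Rightarrow> nat \<Rightarrow> (nat set \<Rightarrow> real) \<Rightarrow> wgraph \<Rightarrow> real" where
  "tilt \<mu> n t G = exp (\<Sum>e\<in>nsets {1..n} 2. t e * G e - cumulant \<mu> (t e))"

context edge_weight
begin

lemma prob_space_graph_law: "prob_space (graph_law \<mu> n)"
  unfolding graph_law_def by (rule prob_space_PiM) (rule prob_space_axioms)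

lemma AE_unit_weights: "AE G in graph_law \<mu> n. unit_weights n G"
  unfolding unit_weights_def
proof (rule AE_finite_allI[OF finite_edges])
  fix e :: "nat set" assume "e \<in> nsets {1..n} 2"
  then show "AE G in graph_law \<mu> n. G e \<in> {0..1}"
    unfolding graph_law_def using weight_in_unit
    by (intro AE_PiM_component) (auto intro: prob_space_axioms)
qed

lemma edge_measurable [measurable]:
  "e \<in> nsets {1..n} 2 \<Longrightarrow> (\<lambda>G. G e) \<in> borel_measurable (graph_law \<mu> n)"
  unfolding graph_law_def by (subst measurable_cong_sets[OF refl sets_mu[symmetric]]) simp

lemma weight_matrix_measurable [measurable]:
  "(\<lambda>G. weight_matrix n G s) \<in> borel_measurable (graph_law \<mu> n)"
proof (cases s)
  case (Pair i j)
  show ?thesis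
  proof (cases "{i, j} \<in> nsets {1..n} 2")
    case True
    then have "(\<lambda>G. weight_matrix n G s) = (\<lambda>G. G {i, j})"
      by (simp add: weight_matrix_def weight_def Pair del: doubleton_in_nsets_2)
    then show ?thesis using edge_measurable[OF True] by simp
  next
    case False
    then have "(\<lambda>G. weight_matrix n G s) = (\<lambda>G. 0)"
      by (simp add: weight_matrix_def weight_def Pair del: doubleton_in_nsets_2)
    then show ?thesis by simp
  qed
qed

lemma hom_sum_measurable [measurable]:
  "(\<lambda>G. hom_sum k n E (weight_matrix n G)) \<in> borel_measurable (graph_law \<mu> n)"
  unfolding hom_sum_def by measurable

lemma tilt_measurable [measurable]: "tilt \<mu> n t \<in> borel_measurable (graph_law \<mu> n)"
  unfolding tilt_def[abs_def] by measurable

lemma tilt_product_integral: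
  assumes D: "D \<subseteq> nsets {1..n} 2"
  shows "integrable (graph_law \<mu> n) (\<lambda>G. tilt \<mu> n t G * (\<Prod>e\<in>D. G e))"
    and "(\<integral>G. tilt \<mu> n t G * (\<Prod>e\<in>D. G e) \<partial>graph_law \<mu> n) = (\<Prod>e\<in>D. tilted_mean \<mu> (t e))"
proof -
  interpret prod: product_sigma_finite "\<lambda>_::nat set. \<mu>"
    by (unfold_locales) 
  let ?f = "\<lambda>e x. exp (t e * x - cumulant \<mu> (t e)) * (if e \<in> D then x else 1)"
  have eq: "tilt \<mu> n t G * (\<Prod>e\<in>D. G e) = (\<Prod>e\<in>nsets {1..n} 2. ?f e (G e))" for G
  proof -
    have "(\<Prod>e\<in>D. G e) = (\<Prod>e\<in>nsets {1..n} 2. if e \<in> D then G e else 1)"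
      by (rule prod.mono_neutral_cong_left) (use D finite_edges in auto)
    then show ?thesis by (simp only: tilt_def exp_sum[OF finite_edges] prod.distrib)
  qed
  have f: "?f e = (\<lambda>x. exp (- cumulant \<mu> (t e)) * (if e \<in> D then x * exp (t e * x) else exp (t e * x)))" for e
    by (auto simp: fun_eq_iff exp_diff exp_minus field_simps)
  have int: "integrable \<mu> (?f e)" for e
    unfolding f using integrable_exp[of "t e"] integrable_times_exp[of "t e"] by (cases "e \<in> D") auto
  have val: "integral\<^sup>L \<mu> (?f e) = (if e \<in> D then tilted_mean \<mu> (t e) else 1)" for e
    unfolding f using exp_cumulant[of "t e"] moment_pos[of "t e"]
    by (auto simp: tilted_mean_def moment_def exp_minus field_simps)
  show "integrable (graph_law \<mu> n) (\<lambda>G. tilt \<mu> n t G * (\<Prod>e\<in>D. G e))"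
    unfolding eq graph_law_def by (rule prod.product_integrable_prod[OF finite_edges int])
  have "(\<integral>G. tilt \<mu> n t G * (\<Prod>e\<in>D. G e) \<partial>graph_law \<mu> n) = (\<Prod>e\<in>nsets {1..n} 2. integral\<^sup>L \<mu> (?f e))"
    unfolding eq graph_law_def by (rule prod.product_integral_prod[OF finite_edges int])
  also have "\<dots> = (\<Prod>e\<in>D. tilted_mean \<mu> (t e))"
    unfolding val by (rule prod.mono_neutral_cong_right) (use D finite_edges in auto)
  finally show "(\<integral>G. tilt \<mu> n t G * (\<Prod>e\<in>D. G e) \<partial>graph_law \<mu> n) = (\<Prod>e\<in>D. tilted_mean \<mu> (t e))" .
qed

lemma tilt_integrable: "integrable (graph_law \<mu> n) (tilt \<mu> n t)"
  and tilt_integral: "(\<integral>G. tilt \<mu> n t G \<partial>graph_law \<mu> n) = 1"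
  using tilt_product_integral[of "{}" n t] by simp_all

lemma tilt_edge_integral:
  assumes "e \<in> nsets {1..n} 2"
  shows "integrable (graph_law \<mu> n) (\<lambda>G. tilt \<mu> n t G * G e)"
    and "(\<integral>G. tilt \<mu> n t G * G e \<partial>graph_law \<mu> n) = tilted_mean \<mu> (t e)"
  using tilt_product_integral[of "{e}" n t] assms by simp_all

text \<open>
  Under an injective map the edges of \<open>H\<^sub>2\<close> go to distinct edges, whose weights are independent with
  mean \<open>u\<close>. All other maps contribute a nonnegative amount and are rare.
\<close>

lemma tilted_hom_sum:
  assumes E: "E \<subseteq> nsets {1..k} 2" and n: "0 < n"
  shows "integrable (graph_law \<mu> n) (\<lambda>G. tilt \<mu> n (\<lambda>_. \<theta>) G * hom_sum k n E (weight_matrix n G))" (is ?int)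
    and "tilted_mean \<mu> \<theta> ^ card E * (1 - (real k)\<^sup>2 / real n) * real n ^ k
      \<le> (\<integral>G. tilt \<mu> n (\<lambda>_. \<theta>) G * hom_sum k n E (weight_matrix n G) \<partial>graph_law \<mu> n)"
proof -
  let ?V = "PiE {1..k} (\<lambda>_. {1..n})" and ?P = "graph_law \<mu> n" and ?Z = "tilt \<mu> n (\<lambda>_. \<theta>)"
  let ?u = "tilted_mean \<mu> \<theta> ^ card E"
  define A where "A v G = (\<Prod>e\<in>E. weight_matrix n G (v (Min e), v (Max e)))" for v G
  have A_meas [measurable]: "A v \<in> borel_measurable ?P" for v
    unfolding A_def[abs_def] by measurable
  have A_unit: "AE G in ?P. A v G \<in> {0..1}" for v
    using AE_unit_weights
  proof eventually_elim
    case (elim G)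
    then show ?case unfolding A_def using weight_matrix_unit[OF elim] by (auto intro!: prod_nonneg prod_le_1)
  qed
  have int: "integrable ?P (\<lambda>G. ?Z G * A v G)" for v
  proof (rule Bochner_Integration.integrable_bound[OF tilt_integrable])
    show "AE G in ?P. norm (?Z G * A v G) \<le> norm (?Z G)"
      using A_unit[of v] by eventually_elim (auto simp: abs_mult tilt_def mult_left_le)
  qed measurable
  have nonneg: "0 \<le> (\<integral>G. ?Z G * A v G \<partial>?P)" for v
    by (rule integral_nonneg_AE) (use A_unit[of v] in eventually_elim, auto simp: tilt_def)
  have inj_value: "(\<integral>G. ?Z G * A v G \<partial>?P) = ?u" if v: "v \<in> ?V" "inj_on v {1..k}" for v
  proof -
    let ?D = "(\<lambda>e. v ` e) ` E"
    have sub: "e \<subseteq> {1..k}" if "e \<in> E" for e using E that by (auto simp: nsets_def)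
    have inj: "inj_on (\<lambda>e. v ` e) E"
    proof (rule inj_onI)
      fix e e' assume "e \<in> E" "e' \<in> E" "v ` e = v ` e'"
      then show "e = e'" using inj_on_image_eq_iff[OF v(2) sub sub] by simp
    qed
    have img: "v ` e = {v (Min e), v (Max e)}" if "e \<in> E" for e
    proof -
      have "e = {Min e, Max e}" using edge_endpoints(4)[of e k] E that by blast
      then have "v ` e = v ` {Min e, Max e}" by (rule arg_cong)
      then show ?thesis by simp
    qed
    have D: "?D \<subseteq> nsets {1..n} 2"
    proof (rule image_subsetI)
      fix e assume e: "e \<in> E"
      have m: "Min e \<in> {1..k}" "Max e \<in> {1..k}" "Min e \<noteq> Max e"
        using edge_endpoints(1-3)[of e k] E e by (blast, blast, fastforce)
      then have "v (Min e) \<noteq> v (Max e)" using v(2) by (auto dest: inj_onD)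
      moreover have "v (Min e) \<in> {1..n}" "v (Max e) \<in> {1..n}" using PiE_mem[OF v(1) m(1)] PiE_mem[OF v(1) m(2)] by blast+
      ultimately show "v ` e \<in> nsets {1..n} 2" by (simp add: img[OF e])
    qed
    have "A v G = (\<Prod>d\<in>?D. G d)" for G
    proof -
      have "A v G = (\<Prod>e\<in>E. G (v ` e))"
        unfolding A_def
      proof (rule prod.cong)
        fix e assume e: "e \<in> E"
        have "{v (Min e), v (Max e)} \<in> nsets {1..n} 2" using D e unfolding img[OF e, symmetric] by blast
        then show "weight_matrix n G (v (Min e), v (Max e)) = G (v ` e)"
          by (simp add: weight_matrix_def weight_def img[OF e] del: doubleton_in_nsets_2)
      qed simp
      then show ?thesis using inj by (simp add: prod.reindex)
    qed
    then show ?thesis using tilt_product_integral(2)[OF D, of "\<lambda>_. \<theta>"] inj by (simp add: card_image)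
  qed
  have eq: "?Z G * hom_sum k n E (weight_matrix n G) = (\<Sum>v\<in>?V. ?Z G * A v G)" for G
    by (simp add: hom_sum_def A_def sum_distrib_left)
  show ?int unfolding eq by (intro Bochner_Integration.integrable_sum int)
  have u: "0 \<le> ?u" using tilted_mean_nonneg by simp
  have fin: "finite ?V" by (simp add: finite_PiE)
  have "real (card {v \<in> ?V. inj_on v {1..k}}) = real n ^ k - real (card {v \<in> ?V. \<not> inj_on v {1..k}})"
  proof -
    have "card ?V = card {v \<in> ?V. inj_on v {1..k}} + card {v \<in> ?V. \<not> inj_on v {1..k}}"
      by (subst card_Un_disjoint[symmetric]) (use fin in \<open>auto intro!: arg_cong[where f = card]\<close>)
    then have "real (n ^ k) = real (card {v \<in> ?V. inj_on v {1..k}}) + real (card {v \<in> ?V. \<not> inj_on v {1..k}})"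
      unfolding card_tuples by (simp only: of_nat_add)
    then show ?thesis by simp
  qed
  also have "\<dots> \<ge> (1 - (real k)\<^sup>2 / real n) * real n ^ k"
    using noninjective_tuples[OF n, of k] by (simp add: algebra_simps)
  finally have count: "(1 - (real k)\<^sup>2 / real n) * real n ^ k \<le> real (card {v \<in> ?V. inj_on v {1..k}})" .
  have "?u * (1 - (real k)\<^sup>2 / real n) * real n ^ k \<le> ?u * real (card {v \<in> ?V. inj_on v {1..k}})"
    unfolding mult.assoc by (rule mult_left_mono[OF count u])
  also have "\<dots> = (\<Sum>v\<in>{v \<in> ?V. inj_on v {1..k}}. \<integral>G. ?Z G * A v G \<partial>?P)"
    using inj_value by simp
  also have "\<dots> \<le> (\<Sum>v\<in>?V. \<integral>G. ?Z G * A v G \<partial>?P)"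
    by (rule sum_mono2) (use fin nonneg in auto)
  also have "\<dots> = (\<integral>G. ?Z G * hom_sum k n E (weight_matrix n G) \<partial>?P)"
    unfolding eq by (rule Bochner_Integration.integral_sum[symmetric]) (rule int)
  finally show "?u * (1 - (real k)\<^sup>2 / real n) * real n ^ k
      \<le> (\<integral>G. ?Z G * hom_sum k n E (weight_matrix n G) \<partial>?P)" .
qed

lemma hamiltonian_measurable:
  assumes n: "0 < n" and E: "E \<subseteq> nsets {1..k} 2"
  shows "(\<lambda>G. (real n)\<^sup>2 * hamiltonian k E \<beta> n G) \<in> borel_measurable (graph_law \<mu> n)"
  unfolding hamiltonian_eq[OF n E] by measurable

lemma exp_hamiltonian_integrable:
  assumes n: "0 < n" and E: "E \<subseteq> nsets {1..k} 2"
  shows "integrable (graph_law \<mu> n) (\<lambda>G. exp ((real n)\<^sup>2 * hamiltonian k E \<beta> n G))"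
proof -
  interpret P: prob_space "graph_law \<mu> n" by (rule prob_space_graph_law)
  let ?B = "\<bar>fst \<beta>\<bar> * (real n * real n) + \<bar>snd \<beta>\<bar> * (real n)\<^sup>2"
  show ?thesis
  proof (rule P.integrable_const_bound)
    show "AE G in graph_law \<mu> n. norm (exp ((real n)\<^sup>2 * hamiltonian k E \<beta> n G)) \<le> exp ?B"
      using AE_unit_weights
    proof eventually_elim
      case (elim G)
      have "0 \<le> (\<Sum>e\<in>nsets {1..n} 2. G e)" using elim by (auto simp: unit_weights_def intro!: sum_nonneg)
      moreover have "2 * (\<Sum>e\<in>nsets {1..n} 2. G e) \<le> real n * real n"
      proof -
        have "(\<Sum>s\<in>square n. weight_matrix n G s) \<le> real (card (square n)) * 1"
          using weight_matrix_unit[OF elim] by (intro sum_bounded_above) auto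
        then show ?thesis unfolding sum_weight_matrix by (simp add: card_cartesian_product)
      qed
      ultimately have "\<bar>2 * (\<Sum>e\<in>nsets {1..n} 2. G e)\<bar> \<le> real n * real n" by simp
      then have 1: "\<bar>fst \<beta> * (2 * (\<Sum>e\<in>nsets {1..n} 2. G e))\<bar> \<le> \<bar>fst \<beta>\<bar> * (real n * real n)"
        unfolding abs_mult[of "fst \<beta>"] by (rule mult_left_mono) simp
      have "hom_sum k n E (weight_matrix n G) / real n ^ k \<in> {0..1}"
        using hom_sum_unit[OF E elim] n by simp
      then have "\<bar>(real n)\<^sup>2 * (hom_sum k n E (weight_matrix n G) / real n ^ k)\<bar> \<le> (real n)\<^sup>2 * 1"
        unfolding abs_mult by (intro mult_mono) auto
      then have 2: "\<bar>snd \<beta> * ((real n)\<^sup>2 * (hom_sum k n E (weight_matrix n G) / real n ^ k))\<bar> \<le> \<bar>snd \<beta>\<bar> * (real n)\<^sup>2"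
        unfolding abs_mult[of "snd \<beta>"] by (intro mult_left_mono) auto
      show ?case
        unfolding hamiltonian_eq[OF n E] real_norm_def abs_exp_cancel exp_le_cancel_iff
        using abs_le_D1[OF 1] abs_le_D1[OF 2] by linarith
    qed
  qed (use hamiltonian_measurable[OF n E] in measurable)
qed

text \<open>
  Gibbs' variational principle with the tilted product law as trial measure. Jensen's inequality is
  applied in the form \<open>exp f \<ge> exp g exp c (1 + (f - g) - c)\<close>, where \<open>exp g\<close> is the tilting density
  and \<open>c\<close> the tilted expectation of \<open>f - g\<close>. The loss of order \<open>n\<close> comes from the missing
  diagonal and from noninjective maps.
\<close>

lemma partition_function_lower_bound:
  assumes n: "0 < n" and E: "E \<subseteq> nsets {1..k} 2" and b: "0 \<le> snd \<beta>"
  shows "exp ((real n)\<^sup>2 * dual_objective \<mu> (card E) \<beta> \<theta> - real n * (\<bar>fst \<beta>\<bar> + snd \<beta> * (real k)\<^sup>2))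
    \<le> (\<integral>G. exp ((real n)\<^sup>2 * hamiltonian k E \<beta> n G) \<partial>graph_law \<mu> n)"
proof -
  let ?P = "graph_law \<mu> n" and ?Z = "tilt \<mu> n (\<lambda>_. \<theta>)" and ?u = "tilted_mean \<mu> \<theta>" and ?Ed = "nsets {1..n} 2"
  let ?h = "\<lambda>G. hom_sum k n E (weight_matrix n G)"
  define r where "r = \<theta> * ?u - cumulant \<mu> \<theta>"
  define f where "f G = (real n)\<^sup>2 * hamiltonian k E \<beta> n G" for G
  define g where "g G = (\<Sum>e\<in>?Ed. \<theta> * G e - cumulant \<mu> \<theta>)" for G
  define I where "I = (\<integral>G. ?Z G * ?h G \<partial>?P)"
  define S where "S G = (\<Sum>e\<in>?Ed. ?Z G * G e)" for G
  have intS: "integrable ?P S" unfolding S_def[abs_def]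
    by (intro Bochner_Integration.integrable_sum tilt_edge_integral)
  have valS: "integral\<^sup>L ?P S = real (card ?Ed) * ?u"
    unfolding S_def[abs_def]
    by (subst Bochner_Integration.integral_sum) (auto simp: tilt_edge_integral)
  have S_eq: "S G = ?Z G * (\<Sum>e\<in>?Ed. G e)" for G by (simp add: S_def sum_distrib_left)
  have split: "?Z G * (f G - g G) = (2 * fst \<beta> - \<theta>) * S G
      + (snd \<beta> * (real n)\<^sup>2 / real n ^ k) * (?Z G * ?h G) + (real (card ?Ed) * cumulant \<mu> \<theta>) * ?Z G" for G
    unfolding f_def g_def S_eq hamiltonian_eq[OF n E] sum_subtractf sum_distrib_left[symmetric]
    by (simp add: algebra_simps)
  have int: "integrable ?P (\<lambda>G. ?Z G * (f G - g G))"
    unfolding split using intS tilted_hom_sum(1)[OF E n] tilt_integrable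
    by (intro Bochner_Integration.integrable_add integrable_mult_right)
  define c where "c = (\<integral>G. ?Z G * (f G - g G) \<partial>?P)"
  have c_val: "c = (2 * fst \<beta> - \<theta>) * (real (card ?Ed) * ?u) + (snd \<beta> * (real n)\<^sup>2 / real n ^ k) * I
      + real (card ?Ed) * cumulant \<mu> \<theta>"
    unfolding c_def split I_def
    using intS tilted_hom_sum(1)[OF E n, of \<theta>] tilt_integrable[of n "\<lambda>_. \<theta>"] valS tilt_integral[of n "\<lambda>_. \<theta>"]
    by (simp add: Bochner_Integration.integral_add)
  have I: "?u ^ card E * (1 - (real k)\<^sup>2 / real n) * real n ^ k \<le> I"
    unfolding I_def by (rule tilted_hom_sum(2)[OF E n])
  have u: "0 \<le> ?u ^ card E" "?u ^ card E \<le> 1" "0 \<le> ?u" "?u \<le> 1"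
  proof -
    have "?u \<le> 1" unfolding tilted_mean_def using moment_antimono[of 0 \<theta>] moment_pos[of \<theta>] by simp
    then show "0 \<le> ?u ^ card E" "?u ^ card E \<le> 1" "0 \<le> ?u" "?u \<le> 1"
      using tilted_mean_nonneg[of \<theta>] by (auto simp: power_le_one)
  qed
  have lower: "(real n)\<^sup>2 * dual_objective \<mu> (card E) \<beta> \<theta> - real n * (\<bar>fst \<beta>\<bar> + snd \<beta> * (real k)\<^sup>2) \<le> c"
  proof -
    have "(snd \<beta> * (real n)\<^sup>2 / real n ^ k) * (?u ^ card E * (1 - (real k)\<^sup>2 / real n) * real n ^ k)
        \<le> (snd \<beta> * (real n)\<^sup>2 / real n ^ k) * I"
      using I b by (intro mult_left_mono) auto
    moreover have "(snd \<beta> * (real n)\<^sup>2 / real n ^ k) * (?u ^ card E * (1 - (real k)\<^sup>2 / real n) * real n ^ k)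
        = snd \<beta> * ?u ^ card E * (real n)\<^sup>2 - real n * (snd \<beta> * (real k)\<^sup>2 * ?u ^ card E)"
      using n by (simp add: field_simps power2_eq_square)
    moreover have "snd \<beta> * (real k)\<^sup>2 * ?u ^ card E \<le> snd \<beta> * (real k)\<^sup>2"
      using b u by (intro mult_left_le) auto
    then have "real n * (snd \<beta> * (real k)\<^sup>2 * ?u ^ card E) \<le> real n * (snd \<beta> * (real k)\<^sup>2)"
      by (rule mult_left_mono) simp
    moreover have "2 * fst \<beta> * real (card ?Ed) * ?u = fst \<beta> * ?u * (real n)\<^sup>2 - real n * (fst \<beta> * ?u)"
      unfolding card_edges by (simp add: power2_eq_square field_simps)
    moreover have "fst \<beta> * ?u \<le> \<bar>fst \<beta>\<bar>"
      using u by (smt (verit) mult_left_le mult_minus_left mult_nonneg_nonneg)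
    then have "real n * (fst \<beta> * ?u) \<le> real n * \<bar>fst \<beta>\<bar>" by (rule mult_left_mono) simp
    moreover have "real (card ?Ed) * r \<le> (real n)\<^sup>2 / 2 * r"
      unfolding card_edges using rate_at_mean_nonneg[of \<theta>]
      by (intro mult_right_mono) (auto simp: r_def power2_eq_square field_simps)
    moreover have "c = 2 * fst \<beta> * real (card ?Ed) * ?u + (snd \<beta> * (real n)\<^sup>2 / real n ^ k) * I - real (card ?Ed) * r"
      unfolding c_val r_def by (simp add: algebra_simps)
    moreover have "(real n)\<^sup>2 * dual_objective \<mu> (card E) \<beta> \<theta>
        = fst \<beta> * ?u * (real n)\<^sup>2 + snd \<beta> * ?u ^ card E * (real n)\<^sup>2 - (real n)\<^sup>2 / 2 * r"
      by (simp add: dual_objective_def r_def algebra_simps)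
    ultimately show ?thesis by (simp add: algebra_simps)
  qed
  have "exp c = (\<integral>G. exp c * (?Z G * (f G - g G) + (1 - c) * ?Z G) \<partial>?P)"
    using int tilt_integrable[of n "\<lambda>_. \<theta>"] tilt_integral[of n "\<lambda>_. \<theta>"] by (simp add: c_def[symmetric])
  also have "\<dots> \<le> (\<integral>G. exp (f G) \<partial>?P)"
  proof (rule integral_mono)
    show "integrable ?P (\<lambda>G. exp c * (?Z G * (f G - g G) + (1 - c) * ?Z G))"
      using int tilt_integrable by (intro integrable_mult_right Bochner_Integration.integrable_add)
    show "integrable ?P (\<lambda>G. exp (f G))" unfolding f_def by (rule exp_hamiltonian_integrable[OF n E])
    fix G
    have Z: "?Z G = exp (g G)" by (simp add: tilt_def g_def)
    have "1 + (f G - g G - c) \<le> exp (f G - g G - c)" by (rule exp_ge_add_one_self)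
    then have "exp c * ?Z G * (1 + (f G - g G - c)) \<le> exp c * ?Z G * exp (f G - g G - c)"
      unfolding Z by (rule mult_left_mono) simp
    also have "\<dots> = exp (f G)" unfolding Z by (simp flip: exp_add)
    finally show "exp c * (?Z G * (f G - g G) + (1 - c) * ?Z G) \<le> exp (f G)" by (simp add: algebra_simps)
  qed
  finally have "exp c \<le> (\<integral>G. exp (f G) \<partial>?P)" .
  moreover have "exp ((real n)\<^sup>2 * dual_objective \<mu> (card E) \<beta> \<theta> - real n * (\<bar>fst \<beta>\<bar> + snd \<beta> * (real k)\<^sup>2)) \<le> exp c"
    using lower by simp
  ultimately show ?thesis unfolding f_def by linarith
qed

end


section \<open>Concentration in cut norm\<close>

text \<open>
  An upper bound for the objective at \<open>m\<close>: the rate function is replaced by the linear function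
  \<open>\<theta> m - K(\<theta>)\<close> below it.
\<close>

definition linearized_objective :: "real measure \<Rightarrow> nat \<Rightarrow> real \<times> real \<Rightarrow> real \<Rightarrow> real \<Rightarrow> real" where
  "linearized_objective \<mu> p \<beta> m \<theta> = fst \<beta> * m + snd \<beta> * m ^ p - (\<theta> * m - cumulant \<mu> \<theta>) / 2"

context edge_weight
begin

lemma linearized_objective_below:
  assumes "objective \<mu> p \<beta> m < ereal L"
  shows "\<exists>\<theta>. linearized_objective \<mu> p \<beta> m \<theta> < L"
proof (rule ccontr)
  assume "\<not> ?thesis"
  then have ge: "\<theta> * m - cumulant \<mu> \<theta> \<le> 2 * (fst \<beta> * m + snd \<beta> * m ^ p - L)" for \<theta>
    by (auto simp: linearized_objective_def not_less field_simps dest: spec[of _ \<theta>])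
  have le: "rate_fun \<mu> m \<le> ereal (2 * (fst \<beta> * m + snd \<beta> * m ^ p - L))"
    unfolding rate_fun_def by (rule SUP_least) (use ge in simp)
  then obtain r where r: "rate_fun \<mu> m = ereal r"
    using rate_fun_nonneg[of m] by (cases "rate_fun \<mu> m") auto
  show False using assms le by (simp add: objective_def r)
qed

text \<open>
  The objective is the infimum of the linearized objectives and stays below its maximum away from the
  unique maximizer; compactness of \<open>[0, 1]\<close> reduces to finitely many exponents. The constant
  \<open>c\<close> is chosen before \<open>\<delta>\<close>, so that the error \<open>\<delta>\<close> can be made small against the gain \<open>c\<close>.
\<close>

lemma separating_tilts:
  assumes max: "is_maximizer \<mu> p \<beta> (tilted_mean \<mu> \<theta>)"
    and unique: "\<And>v. is_maximizer \<mu> p \<beta> v \<Longrightarrow> v = tilted_mean \<mu> \<theta>"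
    and \<eta>: "0 < \<eta>"
  shows "\<exists>c>0. \<forall>\<delta>>0. \<exists>\<Theta>. finite \<Theta> \<and> (\<forall>m\<in>{0..1}. \<exists>t\<in>\<Theta>.
    linearized_objective \<mu> p \<beta> m t \<le> dual_objective \<mu> p \<beta> \<theta> + \<delta> - (if \<eta> \<le> \<bar>m - tilted_mean \<mu> \<theta>\<bar> then c else 0))"
proof -
  let ?u = "tilted_mean \<mu> \<theta>" and ?L = "dual_objective \<mu> p \<beta> \<theta>"
  have le: "objective \<mu> p \<beta> m \<le> ereal ?L" if "rate_fun \<mu> m < \<infinity>" for m
    using max that by (simp add: is_maximizer_def objective_tilted_mean)
  have infinite: "objective \<mu> p \<beta> m = - \<infinity>" if "rate_fun \<mu> m = \<infinity>" for m
    using that by (simp add: objective_def)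
  have less: "objective \<mu> p \<beta> m < ereal ?L" if "m \<noteq> ?u" for m
  proof (cases "rate_fun \<mu> m < \<infinity>")
    case True
    have "objective \<mu> p \<beta> m \<noteq> ereal ?L"
      using unique[of m] that True le by (auto simp: is_maximizer_def)
    then show ?thesis using le[OF True] by simp
  next
    case False
    then show ?thesis using infinite[of m] by simp
  qed
  have open_lin: "open {m. linearized_objective \<mu> p \<beta> m t < y}" for t y
    unfolding linearized_objective_def by (intro open_Collect_less continuous_intros) simp
  \<comment> \<open>On the compact set of densities far from the maximizer the strict inequality becomes uniform.\<close>
  define A where "A = {0..1::real} \<inter> {m. \<eta> \<le> \<bar>m - ?u\<bar>}"
  have compA: "compact A" unfolding A_def
    by (intro compact_Int_closed compact_Icc closed_Collect_le continuous_intros)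
  have coverA: "A \<subseteq> (\<Union>z\<in>UNIV. {m. linearized_objective \<mu> p \<beta> m (fst z) < ?L - 1 / real (Suc (snd z))})"
  proof
    fix m assume "m \<in> A"
    then have "m \<noteq> ?u" using \<eta> by (auto simp: A_def)
    then obtain t where t: "linearized_objective \<mu> p \<beta> m t < ?L" using linearized_objective_below[OF less] by blast
    then obtain j where "inverse (real (Suc j)) < ?L - linearized_objective \<mu> p \<beta> m t"
      using reals_Archimedean[of "?L - linearized_objective \<mu> p \<beta> m t"] by auto
    then have "linearized_objective \<mu> p \<beta> m (fst (t, j)) < ?L - 1 / real (Suc (snd (t, j)))" by (simp add: inverse_eq_divide)
    then show "m \<in> (\<Union>z\<in>UNIV. {m. linearized_objective \<mu> p \<beta> m (fst z) < ?L - 1 / real (Suc (snd z))})" by blast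
  qed
  obtain Z where Z: "finite Z" "A \<subseteq> (\<Union>z\<in>Z. {m. linearized_objective \<mu> p \<beta> m (fst z) < ?L - 1 / real (Suc (snd z))})"
    by (rule compactE_image[OF compA open_lin coverA])
  define c where "c = 1 / real (Suc (Max (insert 0 (snd ` Z))))"
  have c: "0 < c" by (simp add: c_def)
  have far: "\<exists>t\<in>fst ` Z. linearized_objective \<mu> p \<beta> m t \<le> ?L - c" if "m \<in> A" for m
  proof -
    obtain z where z: "z \<in> Z" "linearized_objective \<mu> p \<beta> m (fst z) < ?L - 1 / real (Suc (snd z))" using Z(2) \<open>m \<in> A\<close> by blast
    have "snd z \<le> Max (insert 0 (snd ` Z))" using Z(1) z(1) by (intro Max_ge) auto
    then have "c \<le> 1 / real (Suc (snd z))" unfolding c_def by (intro divide_left_mono) auto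
    then show ?thesis using z by (intro bexI[of _ "fst z"]) auto
  qed
  have "\<exists>\<Theta>. finite \<Theta> \<and> (\<forall>m\<in>{0..1}. \<exists>t\<in>\<Theta>.
    linearized_objective \<mu> p \<beta> m t \<le> ?L + \<delta> - (if \<eta> \<le> \<bar>m - ?u\<bar> then c else 0))" if \<delta>: "0 < \<delta>" for \<delta>
  proof -
    have cover: "{0..1} \<subseteq> (\<Union>t\<in>UNIV. {m. linearized_objective \<mu> p \<beta> m t < ?L + \<delta>})"
    proof
      fix m :: real
      have "objective \<mu> p \<beta> m < ereal (?L + \<delta>)"
      proof (cases "m = ?u")
        case True
        then show ?thesis using \<delta> by (simp add: objective_tilted_mean)
      next
        case False
        have "ereal ?L < ereal (?L + \<delta>)" using \<delta> by simp
        then show ?thesis using less[OF False] by (rule less_trans[rotated])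
      qed
      then show "m \<in> (\<Union>t\<in>UNIV. {m. linearized_objective \<mu> p \<beta> m t < ?L + \<delta>})" using linearized_objective_below by blast
    qed
    obtain \<Theta> where \<Theta>: "finite \<Theta>" "{0..1} \<subseteq> (\<Union>t\<in>\<Theta>. {m. linearized_objective \<mu> p \<beta> m t < ?L + \<delta>})"
      by (rule compactE_image[OF compact_Icc open_lin cover])
    have "\<exists>t\<in>fst ` Z \<union> \<Theta>. linearized_objective \<mu> p \<beta> m t \<le> ?L + \<delta> - (if \<eta> \<le> \<bar>m - ?u\<bar> then c else 0)" if m: "m \<in> {0..1}" for m
    proof (cases "\<eta> \<le> \<bar>m - ?u\<bar>")
      case True
      then have "m \<in> A" using m by (simp add: A_def)
      then obtain t where "t \<in> fst ` Z" "linearized_objective \<mu> p \<beta> m t \<le> ?L - c" using far by blast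
      then show ?thesis using True \<delta> by (intro bexI[of _ t]) auto
    next
      case False
      obtain t where "t \<in> \<Theta>" "linearized_objective \<mu> p \<beta> m t < ?L + \<delta>" using \<Theta>(2) m by blast
      then show ?thesis using False by (intro bexI[of _ t]) auto
    qed
    then show ?thesis using Z(1) \<Theta>(1) by (intro exI[of _ "fst ` Z \<union> \<Theta>"]) auto
  qed
  then show ?thesis using c by blast
qed

end

text \<open>
  The edge tilts that depend only on the blocks of the two endpoints. Their number is
  exponential in \<open>n\<close>, hence negligible against \<open>exp (c n\<^sup>2)\<close>.
\<close>

definition step_tilts :: "nat \<Rightarrow> nat \<Rightarrow> real set \<Rightarrow> (nat set \<Rightarrow> real) set" where
  "step_tilts n K \<Theta> = (\<lambda>(\<pi>, \<tau>). \<lambda>e\<in>nsets {1..n} 2. \<tau> (\<pi> (Min e), \<pi> (Max e)))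
     ` (PiE {1..n} (\<lambda>_. {..<K}) \<times> PiE ({..<K} \<times> {..<K}) (\<lambda>_. \<Theta>))"

lemma card_step_tilts:
  assumes "finite \<Theta>"
  shows "finite (step_tilts n K \<Theta>)" "card (step_tilts n K \<Theta>) \<le> K ^ n * card \<Theta> ^ (K * K)"
proof -
  have fin: "finite (PiE {1..n} (\<lambda>_. {..<K}) \<times> PiE ({..<K} \<times> {..<K}) (\<lambda>_. \<Theta>))"
    using assms by (intro finite_cartesian_product finite_PiE) auto
  then show "finite (step_tilts n K \<Theta>)" unfolding step_tilts_def by (rule finite_imageI)
  have "card (step_tilts n K \<Theta>) \<le> card (PiE {1..n} (\<lambda>_. {..<K}) \<times> PiE ({..<K} \<times> {..<K}) (\<lambda>_. \<Theta>))"
    unfolding step_tilts_def by (rule card_image_le[OF fin])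
  also have "\<dots> = K ^ n * card \<Theta> ^ (K * K)"
    by (simp add: card_cartesian_product card_PiE)
  finally show "card (step_tilts n K \<Theta>) \<le> K ^ n * card \<Theta> ^ (K * K)" .
qed

lemma step_tilts_member:
  assumes "\<pi> ` {1..n} \<subseteq> {..<K}" "\<And>a. \<tau> a \<in> \<Theta>"
  shows "(\<lambda>e\<in>nsets {1..n} 2. \<tau> (\<pi> (Min e), \<pi> (Max e))) \<in> step_tilts n K \<Theta>"
proof -
  let ?z = "(restrict \<pi> {1..n}, restrict \<tau> ({..<K} \<times> {..<K}))"
  have lab: "\<pi> i < K" if "i \<in> {1..n}" for i using assms(1) that by blast
  have "(\<lambda>e\<in>nsets {1..n} 2. \<tau> (\<pi> (Min e), \<pi> (Max e)))
      = (\<lambda>(\<pi>, \<tau>). \<lambda>e\<in>nsets {1..n} 2. \<tau> (\<pi> (Min e), \<pi> (Max e))) ?z"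
    unfolding prod.case
  proof (rule restrict_ext)
    fix e assume "e \<in> nsets {1..n} 2"
    note e = edge_endpoints(1,2)[OF this]
    show "\<tau> (\<pi> (Min e), \<pi> (Max e)) = restrict \<tau> ({..<K} \<times> {..<K}) (restrict \<pi> {1..n} (Min e), restrict \<pi> {1..n} (Max e))"
      using e lab[OF e(1)] lab[OF e(2)] by simp
  qed
  moreover have "?z \<in> PiE {1..n} (\<lambda>_. {..<K}) \<times> PiE ({..<K} \<times> {..<K}) (\<lambda>_. \<Theta>)"
    using lab assms(2) by auto
  ultimately show ?thesis unfolding step_tilts_def by (rule image_eqI)
qed

lemma block_avg_swap:
  assumes sym: "\<And>i j. x (i, j) = x (j, i)"
  shows "block_avg n \<pi> x (a, b) = block_avg n \<pi> x (b, a)"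
proof -
  let ?F = "\<lambda>a b. {s \<in> square n. map_prod \<pi> \<pi> s = (a, b)}"
  have F: "?F a b = prod.swap ` ?F b a" for a b by force
  have "(\<Sum>s\<in>?F a b. x s) = (\<Sum>s\<in>?F b a. x (prod.swap s))"
    unfolding F[of a b] by (rule sum.reindex[unfolded o_def]) simp
  also have "\<dots> = (\<Sum>s\<in>?F b a. x s)"
    by (rule sum.cong) (use sym in \<open>auto simp: prod.swap_def\<close>)
  finally have 1: "(\<Sum>s\<in>?F a b. x s) = (\<Sum>s\<in>?F b a. x s)" .
  have 2: "card (?F a b) = card (?F b a)"
    unfolding F[of a b] by (rule card_image) simp
  show ?thesis unfolding block_avg_def fibre_avg_def 1 2 ..
qed

text \<open>
  The block averages inherit a cut-norm distance \<open>2 \<eta>\<close> from \<open>u\<close>, hence also an \<open>L\<^sup>1\<close> distance, of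
  which pairs closer than \<open>\<eta>\<close> account for at most half.
\<close>

lemma many_deviating_pairs:
  assumes \<eta>: "0 < \<eta>" and u: "u \<in> {0..1}" and y: "\<And>s. s \<in> square n \<Longrightarrow> y s \<in> {0..1}"
    and far: "\<not> cut_small n (3 * \<eta>) (\<lambda>s. x s - u)" and close: "cut_small n \<eta> (\<lambda>s. x s - y s)"
  shows "\<eta> * (real n)\<^sup>2 \<le> real (card {s \<in> square n. \<eta> \<le> \<bar>y s - u\<bar>})"
proof -
  obtain A B where AB: "A \<subseteq> {1..n}" "B \<subseteq> {1..n}" and large: "3 * \<eta> * (real n)\<^sup>2 < \<bar>\<Sum>s\<in>A \<times> B. x s - u\<bar>"
    using far unfolding cut_small_def by (auto simp: not_le)
  have "\<bar>\<Sum>s\<in>A \<times> B. x s - y s\<bar> \<le> \<eta> * (real n)\<^sup>2"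
    using close AB unfolding cut_small_def by blast
  moreover have "(\<Sum>s\<in>A \<times> B. x s - u) = (\<Sum>s\<in>A \<times> B. x s - y s) + (\<Sum>s\<in>A \<times> B. y s - u)"
    by (simp flip: sum.distrib)
  ultimately have "2 * \<eta> * (real n)\<^sup>2 < \<bar>\<Sum>s\<in>A \<times> B. y s - u\<bar>"
    using large by linarith
  also have "\<dots> \<le> (\<Sum>s\<in>A \<times> B. \<bar>y s - u\<bar>)" by (rule sum_abs)
  also have "\<dots> \<le> (\<Sum>s\<in>square n. \<bar>y s - u\<bar>)"
    using AB by (intro sum_mono2) auto
  also have "\<dots> \<le> (\<Sum>s\<in>square n. \<eta> + (if \<eta> \<le> \<bar>y s - u\<bar> then 1 else 0))"
  proof (rule sum_mono)
    fix s assume "s \<in> square n"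
    then have "\<bar>y s - u\<bar> \<le> 1" using y[of s] u by auto
    then show "\<bar>y s - u\<bar> \<le> \<eta> + (if \<eta> \<le> \<bar>y s - u\<bar> then 1 else 0)" using \<eta> by auto
  qed
  also have "\<dots> = \<eta> * (real n)\<^sup>2 + real (card {s \<in> square n. \<eta> \<le> \<bar>y s - u\<bar>})"
    unfolding sum.distrib
    by (simp add: card_cartesian_product power2_eq_square sum.If_cases Int_def)
  finally show ?thesis by simp
qed

context edge_weight
begin

text \<open>
  The heart of the upper bound. After regularization and the power bound, the exponent is a
  sum over pairs of \<open>\<beta>\<^sub>1 y + \<beta>\<^sub>2 y\<^sup>p\<close> for the block averages \<open>y\<close>. Each term is a linearized
  objective plus half of \<open>t y - K(t)\<close>, where \<open>t\<close> depends only on the block average. In the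
  latter terms \<open>y\<close> can be replaced by the weights, and they become the exponent of a tilting density
  up to the diagonal.
\<close>

lemma deviation_exponent_bound:
  assumes n: "0 < n" and E: "E \<subseteq> nsets {1..k} 2" "E \<noteq> {}" and b: "0 \<le> snd \<beta>"
    and G: "unit_weights n G" and u: "u \<in> {0..1}"
    and \<eta>: "0 < \<eta>" and far: "\<not> cut_small n (3 * \<eta>) (\<lambda>s. weight_matrix n G s - u)"
    and \<epsilon>: "0 < \<epsilon>" "\<epsilon> \<le> \<eta>" and m: "1 < real m * \<epsilon>\<^sup>2" and c: "0 < c"
    and \<Theta>: "\<And>a. a \<in> {0..1} \<Longrightarrow> \<exists>t\<in>\<Theta>. linearized_objective \<mu> (card E) \<beta> a t \<le> L + \<delta> - (if \<eta> \<le> \<bar>a - u\<bar> then c else 0)"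
    and B: "\<And>t. t \<in> \<Theta> \<Longrightarrow> \<bar>cumulant \<mu> t\<bar> \<le> B"
  shows "\<exists>t\<in>step_tilts n (4 ^ m) \<Theta>. exp ((real n)\<^sup>2 * hamiltonian k E \<beta> n G)
    \<le> exp ((real n)\<^sup>2 * (L + \<delta> - c * \<eta> + snd \<beta> * real (card E) * \<epsilon>) + real n * B) * tilt \<mu> n t G"
proof -
  let ?W = "weight_matrix n G" and ?p = "card E"
  have W: "?W s \<in> {0..1}" for s by (rule weight_matrix_unit[OF G])
  obtain \<pi> where \<pi>: "\<pi> ` {1..n} \<subseteq> {..<4 ^ m}"
    and close: "cut_small n \<epsilon> (\<lambda>s. ?W s - block_avg n \<pi> ?W (map_prod \<pi> \<pi> s))"
    using weak_regularity[OF \<epsilon>(1) m, of n ?W] W by blast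
  define a where "a = block_avg n \<pi> ?W"
  define y where "y s = a (map_prod \<pi> \<pi> s)" for s
  have a: "a z \<in> {0..1}" for z unfolding a_def block_avg_def by (rule fibre_avg_unit) (rule W)
  have y: "y s \<in> {0..1}" for s unfolding y_def by (rule a)
  obtain sel where sel: "\<And>v. v \<in> {0..1} \<Longrightarrow> sel v \<in> \<Theta>"
    "\<And>v. v \<in> {0..1} \<Longrightarrow> linearized_objective \<mu> ?p \<beta> v (sel v) \<le> L + \<delta> - (if \<eta> \<le> \<bar>v - u\<bar> then c else 0)"
    using \<Theta> by metis
  define \<tau> where "\<tau> z = sel (a z)" for z
  define t where "t = (\<lambda>e\<in>nsets {1..n} 2. \<tau> (\<pi> (Min e), \<pi> (Max e)))"
  have \<tau>: "\<tau> z \<in> \<Theta>" for z unfolding \<tau>_def by (rule sel(1)[OF a])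
  have t_mem: "t \<in> step_tilts n (4 ^ m) \<Theta>"
    unfolding t_def by (rule step_tilts_member[OF \<pi> \<tau>])
  have W_sym: "?W (i, j) = ?W (j, i)" for i j
    by (simp add: weight_matrix_def weight_def insert_commute conj_commute eq_commute[of i j])
  have \<tau>_sym: "\<tau> (i, j) = \<tau> (j, i)" for i j
    unfolding \<tau>_def a_def using block_avg_swap[of ?W, OF W_sym] by metis
  have t_edge: "t {i, j} = \<tau> (\<pi> i, \<pi> j)" if "{i, j} \<in> nsets {1..n} 2" for i j
  proof (cases "i \<le> j")
    case True
    then show ?thesis using that by (simp add: t_def min_def max_def)
  next
    case False
    then show ?thesis using that \<tau>_sym[of "\<pi> i" "\<pi> j"] by (simp add: t_def min_def max_def)
  qed
  \<comment> \<open>Averaging against a function of the blocks does not see the difference between the weights and their block averages.\<close>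
  have average: "(\<Sum>s\<in>square n. \<phi> (map_prod \<pi> \<pi> s) * y s) = (\<Sum>s\<in>square n. \<phi> (map_prod \<pi> \<pi> s) * ?W s)" for \<phi> :: "nat \<times> nat \<Rightarrow> real"
    unfolding y_def a_def block_avg_def by (rule sum_fibre_avg) simp
  have edge_part: "fst \<beta> * (2 * (\<Sum>e\<in>nsets {1..n} 2. G e)) = fst \<beta> * (\<Sum>s\<in>square n. y s)"
    using average[of "\<lambda>_. 1"] by (simp only: sum_weight_matrix mult_1)
  have "cut_small n \<epsilon> (\<lambda>s. ?W s - y s)" using close by (simp add: y_def a_def)
  then have "\<bar>hom_sum k n E ?W - hom_sum k n E y\<bar> \<le> real ?p * (\<epsilon> * real n ^ k)"
    by (rule counting_lemma[OF E(1) n W y])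
  then have "(real n)\<^sup>2 * hom_sum k n E ?W \<le> (real n)\<^sup>2 * (hom_sum k n E y + real ?p * (\<epsilon> * real n ^ k))"
    by (intro mult_left_mono) auto
  also have "\<dots> \<le> real n ^ k * (\<Sum>s\<in>square n. y s ^ ?p) + (real n)\<^sup>2 * (real ?p * (\<epsilon> * real n ^ k))"
    using hom_sum_le_power_sum[OF E n, of y] y by (simp add: algebra_simps)
  finally have "(real n)\<^sup>2 * (hom_sum k n E ?W / real n ^ k)
      \<le> (\<Sum>s\<in>square n. y s ^ ?p) + (real n)\<^sup>2 * (real ?p * \<epsilon>)"
    using n by (simp add: field_simps)
  then have "snd \<beta> * ((real n)\<^sup>2 * (hom_sum k n E ?W / real n ^ k))
      \<le> snd \<beta> * ((\<Sum>s\<in>square n. y s ^ ?p) + (real n)\<^sup>2 * (real ?p * \<epsilon>))"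
    using b by (rule mult_left_mono)
  then have 1: "(real n)\<^sup>2 * hamiltonian k E \<beta> n G
      \<le> (\<Sum>s\<in>square n. fst \<beta> * y s + snd \<beta> * y s ^ ?p) + (real n)\<^sup>2 * (snd \<beta> * real ?p * \<epsilon>)"
    unfolding hamiltonian_eq[OF n E(1)] edge_part
    by (simp add: sum.distrib sum_distrib_left[symmetric] algebra_simps)
  have 2: "(\<Sum>s\<in>square n. fst \<beta> * y s + snd \<beta> * y s ^ ?p)
      = (\<Sum>s\<in>square n. linearized_objective \<mu> ?p \<beta> (y s) (\<tau> (map_prod \<pi> \<pi> s)))
        + (\<Sum>s\<in>square n. \<tau> (map_prod \<pi> \<pi> s) * y s - cumulant \<mu> (\<tau> (map_prod \<pi> \<pi> s))) / 2"
    unfolding sum_divide_distrib sum.distrib[symmetric] by (rule sum.cong) (auto simp: linearized_objective_def)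
  have 3: "(\<Sum>s\<in>square n. linearized_objective \<mu> ?p \<beta> (y s) (\<tau> (map_prod \<pi> \<pi> s))) \<le> (real n)\<^sup>2 * (L + \<delta> - c * \<eta>)"
  proof -
    have "(\<Sum>s\<in>square n. linearized_objective \<mu> ?p \<beta> (y s) (\<tau> (map_prod \<pi> \<pi> s)))
        \<le> (\<Sum>s\<in>square n. L + \<delta> - (if \<eta> \<le> \<bar>y s - u\<bar> then c else 0))"
      unfolding \<tau>_def y_def by (rule sum_mono) (rule sel(2)[OF a])
    also have "\<dots> = (real n)\<^sup>2 * (L + \<delta>) - c * real (card {s \<in> square n. \<eta> \<le> \<bar>y s - u\<bar>})"
      unfolding sum_subtractf by (simp add: card_cartesian_product power2_eq_square sum.If_cases Int_def)
    also have "\<dots> \<le> (real n)\<^sup>2 * (L + \<delta>) - c * (\<eta> * (real n)\<^sup>2)"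
    proof -
      have "cut_small n \<eta> (\<lambda>s. ?W s - y s)"
        using close \<epsilon>(2) unfolding cut_small_def y_def a_def by (meson mult_right_mono order_trans zero_le_power2)
      then have "\<eta> * (real n)\<^sup>2 \<le> real (card {s \<in> square n. \<eta> \<le> \<bar>y s - u\<bar>})"
        by (rule many_deviating_pairs[OF \<eta> u y far])
      then have "c * (\<eta> * (real n)\<^sup>2) \<le> c * real (card {s \<in> square n. \<eta> \<le> \<bar>y s - u\<bar>})"
        by (rule mult_left_mono) (use c in simp)
      then show ?thesis by linarith
    qed
    finally show ?thesis by (simp add: algebra_simps)
  qed
  have 4: "(\<Sum>s\<in>square n. \<tau> (map_prod \<pi> \<pi> s) * y s - cumulant \<mu> (\<tau> (map_prod \<pi> \<pi> s))) / 2
      \<le> (\<Sum>e\<in>nsets {1..n} 2. t e * G e - cumulant \<mu> (t e)) + real n * B"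
  proof -
    let ?h = "\<lambda>e. t e * G e - cumulant \<mu> (t e)"
    have "(\<Sum>s\<in>square n. \<tau> (map_prod \<pi> \<pi> s) * y s - cumulant \<mu> (\<tau> (map_prod \<pi> \<pi> s)))
        = (\<Sum>s\<in>square n. \<tau> (map_prod \<pi> \<pi> s) * ?W s - cumulant \<mu> (\<tau> (map_prod \<pi> \<pi> s)))"
      using average[of \<tau>] by (simp only: sum_subtractf)
    also have "\<dots> \<le> (\<Sum>s\<in>square n. (if fst s = snd s then 0 else ?h {fst s, snd s}) + (if fst s = snd s then B else 0))"
    proof (rule sum_mono)
      fix s assume s: "s \<in> square n"
      show "\<tau> (map_prod \<pi> \<pi> s) * ?W s - cumulant \<mu> (\<tau> (map_prod \<pi> \<pi> s))
          \<le> (if fst s = snd s then 0 else ?h {fst s, snd s}) + (if fst s = snd s then B else 0)"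
      proof (cases "fst s = snd s")
        \<comment> \<open>The diagonal carries no weight, only the normalization of its tilt.\<close>
        case True
        then show ?thesis using B[OF \<tau>, of "map_prod \<pi> \<pi> s"] weight_matrix_eq[OF s, of G] by simp
      next
        case False
        then have "{fst s, snd s} \<in> nsets {1..n} 2" using s by auto
        then have "t {fst s, snd s} = \<tau> (map_prod \<pi> \<pi> s)" using t_edge by (cases s) auto
        then show ?thesis using False weight_matrix_eq[OF s, of G] by simp
      qed
    qed
    also have "\<dots> = 2 * (\<Sum>e\<in>nsets {1..n} 2. ?h e) + (\<Sum>s\<in>square n. if fst s = snd s then B else 0)"
      unfolding sum.distrib sum_offdiagonal_eq_sum_edges[of ?h] ..
    also have "(\<Sum>s\<in>square n. if fst s = snd s then B else 0) = (\<Sum>i=1..n. \<Sum>j=1..n. if i = j then B else 0)"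
      by (simp only: sum.cartesian_product split_def)
    also have "\<dots> = real n * B" by simp
    finally have "(\<Sum>s\<in>square n. \<tau> (map_prod \<pi> \<pi> s) * y s - cumulant \<mu> (\<tau> (map_prod \<pi> \<pi> s)))
        \<le> 2 * (\<Sum>e\<in>nsets {1..n} 2. ?h e) + real n * B" .
    moreover have "0 \<le> real n * B" using B[OF \<tau>, of undefined] by simp
    ultimately show ?thesis by linarith
  qed
  have "(real n)\<^sup>2 * hamiltonian k E \<beta> n G
      \<le> (real n)\<^sup>2 * (L + \<delta> - c * \<eta> + snd \<beta> * real ?p * \<epsilon>) + real n * B
        + (\<Sum>e\<in>nsets {1..n} 2. t e * G e - cumulant \<mu> (t e))"
    using 1 2 3 4 by (simp add: algebra_simps)
  then have "exp ((real n)\<^sup>2 * hamiltonian k E \<beta> n G)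
      \<le> exp ((real n)\<^sup>2 * (L + \<delta> - c * \<eta> + snd \<beta> * real ?p * \<epsilon>) + real n * B) * tilt \<mu> n t G"
    unfolding tilt_def exp_add[symmetric] by simp
  then show ?thesis using t_mem by blast
qed

definition deviation :: "nat \<Rightarrow> real \<Rightarrow> real \<Rightarrow> wgraph set" where
  "deviation n \<eta> u = {G \<in> space (graph_law \<mu> n). \<not> cut_small n \<eta> (\<lambda>s. weight_matrix n G s - u)}"

lemma deviation_sets: "deviation n \<eta> u \<in> sets (graph_law \<mu> n)"
proof -
  have "deviation n \<eta> u = space (graph_law \<mu> n) -
      (\<Inter>A\<in>Pow {1..n}. \<Inter>B\<in>Pow {1..n}. {G \<in> space (graph_law \<mu> n).
        \<bar>\<Sum>s\<in>A \<times> B. weight_matrix n G s - u\<bar> \<le> \<eta> * (real n)\<^sup>2})"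
    by (auto simp: deviation_def cut_small_def)
  also have "\<dots> \<in> sets (graph_law \<mu> n)"
    by (intro sets.Diff sets.top sets.finite_INT) auto
  finally show ?thesis .
qed

lemma emeasure_exp_graph_law:
  assumes n: "0 < n" and E: "E \<subseteq> nsets {1..k} 2" and A: "A \<in> sets (graph_law \<mu> n)"
  shows "emeasure (exp_graph_law \<mu> k E \<beta> n) A
    = ennreal ((\<integral>G. exp ((real n)\<^sup>2 * hamiltonian k E \<beta> n G) * indicator A G \<partial>graph_law \<mu> n)
        / (\<integral>G. exp ((real n)\<^sup>2 * hamiltonian k E \<beta> n G) \<partial>graph_law \<mu> n))"
proof -
  let ?P = "graph_law \<mu> n" and ?f = "\<lambda>G. (real n)\<^sup>2 * hamiltonian k E \<beta> n G"
  let ?Z = "\<integral>G. exp (?f G) \<partial>?P"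
  have Z: "0 < ?Z"
    using exp_hamiltonian_integrable[OF n E, of \<beta>] prob_space.prob_space[OF prob_space_graph_law, of n]
      prob_space_graph_law[of n]
    by (intro order_le_neq_trans integral_nonneg) (auto simp: prob_space.emeasure_space_1 integral_nonneg_eq_0_iff_AE prob_space.AE_False)
  have dens: "exp ((real n)\<^sup>2 * (hamiltonian k E \<beta> n G - psi \<mu> k E \<beta> n)) = exp (?f G) / ?Z" for G
  proof -
    have "(real n)\<^sup>2 * psi \<mu> k E \<beta> n = ln ?Z" using n by (simp add: psi_def)
    then show ?thesis using Z by (simp add: right_diff_distrib exp_diff)
  qed
  have int: "integrable ?P (\<lambda>G. exp (?f G) / ?Z * indicator A G)"
    using exp_hamiltonian_integrable[OF n E] A by (intro integrable_real_mult_indicator integrable_divide) auto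
  note [measurable] = hamiltonian_measurable[OF n E, of \<beta>] A
  have "emeasure (exp_graph_law \<mu> k E \<beta> n) A = (\<integral>\<^sup>+G. ennreal (exp (?f G) / ?Z) * indicator A G \<partial>?P)"
    unfolding exp_graph_law_def dens by (rule emeasure_density) measurable
  also have "\<dots> = (\<integral>\<^sup>+G. ennreal (exp (?f G) / ?Z * indicator A G) \<partial>?P)"
    by (rule nn_integral_cong) (auto simp: indicator_def)
  also have "\<dots> = ennreal (\<integral>G. exp (?f G) / ?Z * indicator A G \<partial>?P)"
    using int Z by (intro nn_integral_eq_integral) auto
  also have "(\<integral>G. exp (?f G) / ?Z * indicator A G \<partial>?P) = (\<integral>G. exp (?f G) * indicator A G \<partial>?P) / ?Z"
    by simp
  finally show ?thesis .
qed

text \<open>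
  A union bound over the block tilts, each of which integrates to \<open>1\<close>, compared with the lower bound for
  the partition function.
\<close>

lemma deviation_probability:
  assumes E: "E \<subseteq> nsets {1..k} 2" "E \<noteq> {}" and b: "0 \<le> snd \<beta>"
    and max: "is_maximizer \<mu> (card E) \<beta> (tilted_mean \<mu> \<theta>)"
    and unique: "\<And>v. is_maximizer \<mu> (card E) \<beta> v \<Longrightarrow> v = tilted_mean \<mu> \<theta>"
    and \<eta>: "0 < \<eta>"
  shows "\<exists>D a c. 0 < c \<and> (\<forall>n>0. emeasure (exp_graph_law \<mu> k E \<beta> n) (deviation n (3 * \<eta>) (tilted_mean \<mu> \<theta>))
    \<le> ennreal (D * exp (a * real n - c * (real n)\<^sup>2)))"
proof -
  let ?u = "tilted_mean \<mu> \<theta>" and ?L = "dual_objective \<mu> (card E) \<beta> \<theta>" and ?p = "real (card E)"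
  have u: "?u \<in> {0..1}"
    using tilted_mean_nonneg[of \<theta>] moment_antimono[of 0 \<theta>] moment_pos[of \<theta>] by (simp add: tilted_mean_def)
  obtain c where c: "0 < c" and cover: "\<And>\<delta>. 0 < \<delta> \<Longrightarrow> \<exists>\<Theta>. finite \<Theta> \<and> (\<forall>m\<in>{0..1}. \<exists>t\<in>\<Theta>.
    linearized_objective \<mu> (card E) \<beta> m t \<le> ?L + \<delta> - (if \<eta> \<le> \<bar>m - ?u\<bar> then c else 0))"
    using separating_tilts[OF max unique \<eta>] by blast
  \<comment> \<open>The gain is \<open>c * \<eta>\<close>; a quarter each is spent on the counting error and on \<open>\<delta>\<close>. The summand \<open>1\<close> covers \<open>\<beta>\<^sub>2 = 0\<close>.\<close>
  define \<epsilon> where "\<epsilon> = min \<eta> (c * \<eta> / (4 * (snd \<beta> * ?p + 1)))"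
  have pos: "0 < snd \<beta> * ?p + 1" using b by (simp add: add_nonneg_pos)
  have \<epsilon>: "0 < \<epsilon>" "\<epsilon> \<le> \<eta>" using c \<eta> pos by (auto simp: \<epsilon>_def)
  have "snd \<beta> * ?p * \<epsilon> \<le> (snd \<beta> * ?p + 1) * (c * \<eta> / (4 * (snd \<beta> * ?p + 1)))"
    using b \<epsilon> by (intro mult_mono) (auto simp: \<epsilon>_def)
  also have "\<dots> = c * \<eta> / 4" using pos by (subst times_divide_eq_right) (simp add: divide_eq_eq)
  finally have small: "snd \<beta> * ?p * \<epsilon> \<le> c * \<eta> / 4" .
  obtain m where m: "1 < real m * \<epsilon>\<^sup>2" using reals_Archimedean3[of "\<epsilon>\<^sup>2"] \<epsilon> by auto
  obtain \<Theta> where \<Theta>: "finite \<Theta>" "\<And>a. a \<in> {0..1} \<Longrightarrow> \<exists>t\<in>\<Theta>.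
    linearized_objective \<mu> (card E) \<beta> a t \<le> ?L + c * \<eta> / 4 - (if \<eta> \<le> \<bar>a - ?u\<bar> then c else 0)"
    using cover[of "c * \<eta> / 4"] c \<eta> by auto
  define B where "B = (\<Sum>t\<in>\<Theta>. \<bar>cumulant \<mu> t\<bar>)"
  have B: "\<bar>cumulant \<mu> t\<bar> \<le> B" if "t \<in> \<Theta>" for t
    unfolding B_def using \<Theta>(1) that by (intro member_le_sum) auto
  define K :: nat where "K = 4 ^ m"
  define C where "C = \<bar>fst \<beta>\<bar> + snd \<beta> * (real k)\<^sup>2"
  define D where "D = real (card \<Theta> ^ (K * K))"
  have bound: "emeasure (exp_graph_law \<mu> k E \<beta> n) (deviation n (3 * \<eta>) ?u)
      \<le> ennreal (D * exp ((ln (real K) + B + C) * real n - (c * \<eta> / 2) * (real n)\<^sup>2))" if n: "0 < n" for n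
  proof -
    let ?P = "graph_law \<mu> n" and ?f = "\<lambda>G. (real n)\<^sup>2 * hamiltonian k E \<beta> n G"
    let ?A = "deviation n (3 * \<eta>) ?u"
    let ?T = "step_tilts n K \<Theta>"
    define r where "r = (real n)\<^sup>2 * (?L + c * \<eta> / 4 - c * \<eta> + snd \<beta> * ?p * \<epsilon>) + real n * B"
    have finT: "finite ?T" by (rule card_step_tilts(1)[OF \<Theta>(1)])
    have "(\<integral>G. exp (?f G) * indicator ?A G \<partial>?P) \<le> (\<integral>G. exp r * (\<Sum>t\<in>?T. tilt \<mu> n t G) \<partial>?P)"
    proof (rule integral_mono_AE)
      show "integrable ?P (\<lambda>G. exp (?f G) * indicator ?A G)"
        using exp_hamiltonian_integrable[OF n E(1)] deviation_sets by (intro integrable_real_mult_indicator) auto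
      show "integrable ?P (\<lambda>G. exp r * (\<Sum>t\<in>?T. tilt \<mu> n t G))"
        by (intro integrable_mult_right Bochner_Integration.integrable_sum tilt_integrable)
      show "AE G in ?P. exp (?f G) * indicator ?A G \<le> exp r * (\<Sum>t\<in>?T. tilt \<mu> n t G)"
        using AE_unit_weights
      proof eventually_elim
        case (elim G)
        have tilt_nonneg: "0 \<le> tilt \<mu> n t G" for t by (simp add: tilt_def)
        show ?case
        proof (cases "G \<in> ?A")
          case True
          then have far: "\<not> cut_small n (3 * \<eta>) (\<lambda>s. weight_matrix n G s - ?u)" by (simp add: deviation_def)
          obtain t where t: "t \<in> ?T" "exp (?f G) \<le> exp r * tilt \<mu> n t G"
            using deviation_exponent_bound[OF n E b elim u \<eta> far \<epsilon> m c \<Theta>(2) B] unfolding r_def K_def by blast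
          have "tilt \<mu> n t G \<le> (\<Sum>t\<in>?T. tilt \<mu> n t G)"
            using t(1) finT tilt_nonneg by (intro member_le_sum) auto
          then have "exp r * tilt \<mu> n t G \<le> exp r * (\<Sum>t\<in>?T. tilt \<mu> n t G)" by simp
          from order_trans[OF t(2) this] show ?thesis using True by simp
        next
          case False
          then show ?thesis using tilt_nonneg by (simp add: sum_nonneg)
        qed
      qed
    qed
    also have "\<dots> = exp r * real (card ?T)"
      using tilt_integrable tilt_integral by (simp add: Bochner_Integration.integral_sum)
    also have "\<dots> \<le> exp r * (real K ^ n * D)"
    proof -
      have "real (card ?T) \<le> real (K ^ n * card \<Theta> ^ (K * K))"
        using card_step_tilts(2)[OF \<Theta>(1), of n K] by (rule of_nat_mono)
      then show ?thesis by (intro mult_left_mono) (auto simp: D_def)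
    qed
    also have "real K ^ n = exp (real n * ln (real K))"
      by (simp add: K_def exp_of_nat_mult)
    finally have num: "(\<integral>G. exp (?f G) * indicator ?A G \<partial>?P) \<le> D * exp (r + real n * ln (real K))"
      by (simp add: exp_add mult_ac)
    define q where "q = (real n)\<^sup>2 * ?L - real n * C"
    have den: "exp q \<le> (\<integral>G. exp (?f G) \<partial>?P)"
      unfolding q_def C_def by (rule partition_function_lower_bound[OF n E(1) b])
    have D: "0 \<le> D" by (simp add: D_def)
    have "(\<integral>G. exp (?f G) * indicator ?A G \<partial>?P) / (\<integral>G. exp (?f G) \<partial>?P) \<le> D * exp (r + real n * ln (real K)) / exp q"
      using num den D by (intro frac_le) auto
    also have "\<dots> = D * exp (r + real n * ln (real K) - q)"
      by (simp add: exp_diff)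
    also have "\<dots> \<le> D * exp ((ln (real K) + B + C) * real n - (c * \<eta> / 2) * (real n)\<^sup>2)"
    proof -
      have "(real n)\<^sup>2 * (snd \<beta> * ?p * \<epsilon>) \<le> (real n)\<^sup>2 * (c * \<eta> / 4)"
        using small by (rule mult_left_mono) simp
      then have "r + real n * ln (real K) - q \<le> (ln (real K) + B + C) * real n - (c * \<eta> / 2) * (real n)\<^sup>2"
        by (simp add: r_def q_def algebra_simps)
      then show ?thesis using D by (intro mult_left_mono) auto
    qed
    finally show ?thesis
      unfolding emeasure_exp_graph_law[OF n E(1) deviation_sets] by (rule ennreal_leI)
  qed
  moreover have "0 < c * \<eta> / 2" using c \<eta> by simp
  ultimately show ?thesis by blast
qed

end

lemma summable_gaussian_decay:
  fixes D a c :: real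
  assumes "0 < c"
  shows "summable (\<lambda>n. D * exp (a * real n - c * (real n)\<^sup>2))"
proof (rule summable_mult, rule summable_comparison_test_ev)
  obtain N where N: "(a + 1) / c \<le> real N" using real_arch_simple by blast
  show "\<forall>\<^sub>F n in sequentially. norm (exp (a * real n - c * (real n)\<^sup>2)) \<le> exp (- 1) ^ n"
    using eventually_ge_at_top[of N]
  proof eventually_elim
    case (elim n)
    then have "(a + 1) / c \<le> real n" using N by linarith
    then have "a + 1 \<le> c * real n" using assms by (simp add: field_simps)
    then have "(a + 1) * real n \<le> c * real n * real n" by (rule mult_right_mono) simp
    then have "a * real n - c * (real n)\<^sup>2 \<le> real n * (- 1)" by (simp add: power2_eq_square algebra_simps)
    then show ?case by (simp only: exp_of_nat_mult[symmetric] real_norm_def abs_exp_cancel exp_le_cancel_iff)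
  qed
  show "summable (\<lambda>n. exp (- 1 :: real) ^ n)" by (rule summable_geometric) simp
qed

context edge_weight
begin

text \<open>
  The bound on the deviation probabilities is summable, and the Borel--Cantelli lemma does not ask how
  the graphs of different sizes are coupled.
\<close>

theorem almost_sure_convergence:
  assumes E: "E \<subseteq> nsets {1..k} 2" "E \<noteq> {}" and b: "0 \<le> snd \<beta>"
    and max: "is_maximizer \<mu> (card E) \<beta> (tilted_mean \<mu> \<theta>)"
    and unique: "\<And>v. is_maximizer \<mu> (card E) \<beta> v \<Longrightarrow> v = tilted_mean \<mu> \<theta>"
    and Q: "Q \<in> joint_laws (exp_graph_law \<mu> k E \<beta>)"
  shows "AE G in Q. (\<lambda>n. class_dist (graphon_class (graphon_of n (G n)))
                                  (graphon_class (\<lambda>x y. tilted_mean \<mu> \<theta>))) \<longlonglongrightarrow> 0"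
proof -
  let ?P = "exp_graph_law \<mu> k E \<beta>" and ?u = "tilted_mean \<mu> \<theta>"
  interpret Q: prob_space Q using Q by (simp add: joint_laws_def)
  have setsQ [measurable_cong]: "sets Q = sets (PiM UNIV ?P)" and marginal: "\<And>n. distr Q (?P n) (\<lambda>\<omega>. \<omega> n) = ?P n"
    using Q by (auto simp: joint_laws_def)
  have coord: "(\<lambda>\<omega>. \<omega> n) \<in> Q \<rightarrow>\<^sub>M ?P n" for n
    by (subst measurable_cong_sets[OF setsQ refl]) (rule measurable_component_singleton, simp)
  have setsP: "sets (?P n) = sets (graph_law \<mu> n)" and spaceP: "space (?P n) = space (graph_law \<mu> n)" for n
    by (auto simp: exp_graph_law_def)
  have one: "AE G in Q. \<forall>\<^sub>F n in sequentially. cut_small n (3 * \<eta>) (\<lambda>s. weight_matrix n (G n) s - ?u)"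
    if \<eta>: "0 < \<eta>" for \<eta>
  proof -
    define A where "A n = (\<lambda>\<omega>. \<omega> n) -` deviation n (3 * \<eta>) ?u \<inter> space Q" for n
    have dev: "deviation n (3 * \<eta>) ?u \<in> sets (?P n)" for n using deviation_sets setsP by simp
    have A [measurable]: "A n \<in> sets Q" for n unfolding A_def by (rule measurable_sets[OF coord dev])
    have emA: "emeasure Q (A n) = emeasure (?P n) (deviation n (3 * \<eta>) ?u)" for n
      using emeasure_distr[OF coord dev, of n] marginal[of n] by (simp add: A_def)
    obtain D a c where c: "0 < c" and bd: "\<And>n. 0 < n \<Longrightarrow>
        emeasure (?P n) (deviation n (3 * \<eta>) ?u) \<le> ennreal (D * exp (a * real n - c * (real n)\<^sup>2))"
      using deviation_probability[OF E b max unique \<eta>] by blast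
    have "summable (\<lambda>n. measure Q (A n))"
    proof (rule summable_comparison_test_ev)
      show "summable (\<lambda>n. \<bar>D\<bar> * exp (a * real n - c * (real n)\<^sup>2))" by (rule summable_gaussian_decay[OF c])
      show "\<forall>\<^sub>F n in sequentially. norm (measure Q (A n)) \<le> \<bar>D\<bar> * exp (a * real n - c * (real n)\<^sup>2)"
        using eventually_gt_at_top[of 0]
      proof eventually_elim
        case (elim n)
        have "ennreal (measure Q (A n)) \<le> ennreal (D * exp (a * real n - c * (real n)\<^sup>2))"
          using bd[OF elim] emA[of n] by (simp add: Q.emeasure_eq_measure)
        also have "\<dots> \<le> ennreal (\<bar>D\<bar> * exp (a * real n - c * (real n)\<^sup>2))"
          by (intro ennreal_leI mult_right_mono) auto
        finally show ?case by simp
      qed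
    qed
    then have "AE \<omega> in Q. \<forall>\<^sub>F n in sequentially. \<omega> \<in> space Q - A n"
      by (intro borel_cantelli_AE1) (auto simp: Q.emeasure_eq_measure)
    then show ?thesis
    proof eventually_elim
      case (elim \<omega>)
      then show ?case
      proof eventually_elim
        case (elim n)
        then have "\<omega> n \<in> space (graph_law \<mu> n)" using measurable_space[OF coord[of n]] spaceP by auto
        then show ?case using elim by (auto simp: A_def deviation_def)
      qed
    qed
  qed
  have "AE G in Q. \<forall>j::nat. \<forall>\<^sub>F n in sequentially.
      cut_small n (3 * (1 / real (Suc j))) (\<lambda>s. weight_matrix n (G n) s - ?u)"
    unfolding AE_all_countable by (intro allI one) simp
  then show ?thesis
  proof eventually_elim
    case (elim G)
    let ?d = "\<lambda>n. class_dist (graphon_class (graphon_of n (G n))) (graphon_class (\<lambda>x y. ?u))"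
    show ?case
      unfolding LIMSEQ_iff
    proof (intro allI impI)
      fix e :: real assume e: "0 < e"
      obtain j where j: "inverse (real (Suc j)) < e / 3" using reals_Archimedean[of "e / 3"] e by auto
      have "\<forall>\<^sub>F n in sequentially. norm (?d n - 0) < e"
        using elim[rule_format, of j] eventually_gt_at_top[of 0]
      proof eventually_elim
        case (elim n)
        have "?d n \<in> {0..3 * (1 / real (Suc j))}" by (rule class_dist_constant_bounds[OF elim(2,1)])
        then show ?case using j by (simp add: inverse_eq_divide)
      qed
      then show "\<exists>no. \<forall>n\<ge>no. norm (?d n - 0) < e" by (simp add: eventually_sequentially)
    qed
  qed
qed

end


section \<open>Convergence far from the origin\<close>

text \<open>
  In the region \<open>\<bar>\<beta>\<^sub>2\<bar> < \<bar>\<beta>\<^sub>1\<bar>\<close>, so \<open>\<bar>\<beta>\<bar> \<rightarrow> \<infinity>\<close> means \<open>\<beta>\<^sub>1 \<rightarrow> -\<infinity>\<close>.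
\<close>

lemma eventually_far_in_region:
  "eventually P far_in_region \<longleftrightarrow> (\<exists>R. \<forall>\<beta>\<in>region. fst \<beta> \<le> R \<longrightarrow> P \<beta>)"
proof
  assume "eventually P far_in_region"
  then obtain b where b: "\<And>\<beta>. b \<le> norm \<beta> \<Longrightarrow> \<beta> \<in> region \<Longrightarrow> P \<beta>"
    unfolding far_in_region_def eventually_inf_principal eventually_at_infinity by blast
  have "P \<beta>" if "\<beta> \<in> region" "fst \<beta> \<le> - \<bar>b\<bar>" for \<beta>
  proof -
    have "norm (fst \<beta>) \<le> norm \<beta>" by (metis norm_fst_le prod.collapse)
    then show ?thesis using that by (intro b) auto
  qed
  then show "\<exists>R. \<forall>\<beta>\<in>region. fst \<beta> \<le> R \<longrightarrow> P \<beta>" by blast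
next
  assume "\<exists>R. \<forall>\<beta>\<in>region. fst \<beta> \<le> R \<longrightarrow> P \<beta>"
  then obtain R where R: "\<And>\<beta>. \<beta> \<in> region \<Longrightarrow> fst \<beta> \<le> R \<Longrightarrow> P \<beta>" by blast
  have "P \<beta>" if \<beta>: "2 * \<bar>R\<bar> \<le> norm \<beta>" "\<beta> \<in> region" for \<beta>
  proof -
    have "norm \<beta> \<le> \<bar>fst \<beta>\<bar> + \<bar>snd \<beta>\<bar>" using norm_Pair_le[of "fst \<beta>" "snd \<beta>"] by simp
    then show ?thesis using \<beta> by (intro R) (auto simp: region_def)
  qed
  then show "eventually P far_in_region"
    unfolding far_in_region_def eventually_inf_principal eventually_at_infinity by blast
qed

lemma admissible_imp_locale:
  assumes "admissible p \<mu>" "2 \<le> p"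
  shows "admissible_weight \<mu> p"
  using assms unfolding admissible_def
  by (intro admissible_weight.intro symmetric_weight.intro edge_weight.intro edge_weight_axioms.intro
      symmetric_weight_axioms.intro admissible_weight_axioms.intro) auto

context admissible_weight
begin

lemma opt_u_and_theta:
  assumes \<delta>: "0 < \<delta>"
  shows "\<exists>R<0. \<forall>\<beta>\<in>region. fst \<beta> \<le> R \<longrightarrow> (\<exists>\<theta>. is_maximizer \<mu> p \<beta> (tilted_mean \<mu> \<theta>)
    \<and> (\<forall>u. is_maximizer \<mu> p \<beta> u \<longrightarrow> u = tilted_mean \<mu> \<theta>) \<and> opt_u \<mu> p \<beta> = tilted_mean \<mu> \<theta>
    \<and> opt_theta \<mu> p \<beta> = \<theta> \<and> \<theta> = 2 * (fst \<beta> + snd \<beta> * (real p * tilted_mean \<mu> \<theta> ^ (p - 1)))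
    \<and> tilted_mean \<mu> \<theta> \<le> \<delta>)"
proof -
  obtain R where R: "R < 0" "\<And>\<beta>. \<beta> \<in> region \<Longrightarrow> fst \<beta> \<le> R \<Longrightarrow>
    \<exists>\<theta>. is_maximizer \<mu> p \<beta> (tilted_mean \<mu> \<theta>) \<and> (\<forall>u. is_maximizer \<mu> p \<beta> u \<longrightarrow> u = tilted_mean \<mu> \<theta>)
       \<and> stationarity \<mu> p \<beta> \<theta> = 0 \<and> tilted_mean \<mu> \<theta> \<le> \<delta>"
    using unique_maximizer[OF \<delta>] by blast
  have "\<exists>\<theta>. is_maximizer \<mu> p \<beta> (tilted_mean \<mu> \<theta>)
    \<and> (\<forall>u. is_maximizer \<mu> p \<beta> u \<longrightarrow> u = tilted_mean \<mu> \<theta>) \<and> opt_u \<mu> p \<beta> = tilted_mean \<mu> \<theta>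
    \<and> opt_theta \<mu> p \<beta> = \<theta> \<and> \<theta> = 2 * (fst \<beta> + snd \<beta> * (real p * tilted_mean \<mu> \<theta> ^ (p - 1)))
    \<and> tilted_mean \<mu> \<theta> \<le> \<delta>" if \<beta>: "\<beta> \<in> region" "fst \<beta> \<le> R" for \<beta>
  proof -
    from R(2)[OF \<beta>] obtain \<theta> where \<theta>: "is_maximizer \<mu> p \<beta> (tilted_mean \<mu> \<theta>)"
      "\<forall>u. is_maximizer \<mu> p \<beta> u \<longrightarrow> u = tilted_mean \<mu> \<theta>"
      "stationarity \<mu> p \<beta> \<theta> = 0" "tilted_mean \<mu> \<theta> \<le> \<delta>"
      by (elim exE conjE)
    have u: "opt_u \<mu> p \<beta> = tilted_mean \<mu> \<theta>"
      unfolding opt_u_def by (rule the_equality) (fact \<theta>(1), rule \<theta>(2)[rule_format])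
    have "opt_theta \<mu> p \<beta> = \<theta>"
      unfolding opt_theta_def is_dual_def u deriv_cumulant tilted_mean_eq_iff by simp
    moreover have "\<theta> = 2 * (fst \<beta> + snd \<beta> * (real p * tilted_mean \<mu> \<theta> ^ (p - 1)))"
      using \<theta>(3) by (simp add: stationarity_def)
    ultimately show ?thesis using \<theta> u by (intro exI[of _ \<theta>] conjI)
  qed
  then show ?thesis using R(1) by blast
qed

lemma eventually_erdos_renyi:
  assumes E: "E \<subseteq> nsets {1..k} 2" "p = card E"
  shows "\<forall>\<^sub>F \<beta> in far_in_region.
               (\<exists>!u. is_maximizer \<mu> p \<beta> u) \<and>
               opt_u \<mu> p \<beta> \<in> {0<..<1} \<and>
               (\<exists>!\<theta>. is_dual \<mu> (opt_u \<mu> p \<beta>) \<theta>) \<and>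
               (\<forall>Q \<in> joint_laws (exp_graph_law \<mu> k E \<beta>). AE G in Q.
                  (\<lambda>n. class_dist (graphon_class (graphon_of n (G n)))
                                  (graphon_class (\<lambda>x y. opt_u \<mu> p \<beta>))) \<longlonglongrightarrow> 0)"
proof -
  obtain R where R: "\<And>\<beta>. \<beta> \<in> region \<Longrightarrow> fst \<beta> \<le> R \<Longrightarrow> \<exists>\<theta>. is_maximizer \<mu> p \<beta> (tilted_mean \<mu> \<theta>)
    \<and> (\<forall>u. is_maximizer \<mu> p \<beta> u \<longrightarrow> u = tilted_mean \<mu> \<theta>) \<and> opt_u \<mu> p \<beta> = tilted_mean \<mu> \<theta>"
    using opt_u_and_theta[of 1] by (metis zero_less_one)
  show ?thesis
    unfolding eventually_far_in_region
  proof (intro exI[of _ R] ballI impI)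
    fix \<beta> assume \<beta>: "\<beta> \<in> region" "fst \<beta> \<le> R"
    from R[OF \<beta>] obtain \<theta> where max: "is_maximizer \<mu> p \<beta> (tilted_mean \<mu> \<theta>)"
      and all: "\<forall>u. is_maximizer \<mu> p \<beta> u \<longrightarrow> u = tilted_mean \<mu> \<theta>" and u: "opt_u \<mu> p \<beta> = tilted_mean \<mu> \<theta>"
      by (elim exE conjE)
    note unique = all[rule_format]
    have "E \<noteq> {}" using E p by auto
    moreover have "0 \<le> snd \<beta>" using \<beta> by (simp add: region_def)
    ultimately have conv: "\<forall>Q \<in> joint_laws (exp_graph_law \<mu> k E \<beta>). AE G in Q.
        (\<lambda>n. class_dist (graphon_class (graphon_of n (G n))) (graphon_class (\<lambda>x y. opt_u \<mu> p \<beta>))) \<longlonglongrightarrow> 0"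
      unfolding u
      using almost_sure_convergence[OF E(1), of \<beta> \<theta>, folded E(2), OF _ _ max unique] by (intro ballI)
    have dual: "\<exists>!\<theta>. is_dual \<mu> (opt_u \<mu> p \<beta>) \<theta>"
      unfolding is_dual_def u deriv_cumulant tilted_mean_eq_iff by blast
    have "\<exists>!u. is_maximizer \<mu> p \<beta> u" by (rule ex1I) (fact max, rule unique)
    then show "(\<exists>!u. is_maximizer \<mu> p \<beta> u) \<and> opt_u \<mu> p \<beta> \<in> {0<..<1} \<and> (\<exists>!\<theta>. is_dual \<mu> (opt_u \<mu> p \<beta>) \<theta>) \<and>
        (\<forall>Q \<in> joint_laws (exp_graph_law \<mu> k E \<beta>). AE G in Q.
        (\<lambda>n. class_dist (graphon_class (graphon_of n (G n))) (graphon_class (\<lambda>x y. opt_u \<mu> p \<beta>))) \<longlonglongrightarrow> 0)"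
      using dual conv tilted_mean_pos[of \<theta>] tilted_mean_less_1[of \<theta>] by (simp add: u)
  qed
qed

lemma opt_theta_asymptotics: "((\<lambda>\<beta>. opt_theta \<mu> p \<beta> / (2 * fst \<beta>)) \<longlongrightarrow> 1) far_in_region"
proof (rule tendstoI)
  fix e :: real assume e: "0 < e"
  have pp: "0 < real p" using p by simp
  define \<delta> where "\<delta> = min 1 (e / (2 * real p))"
  have \<delta>: "0 < \<delta>" using e pp by (simp add: \<delta>_def)
  obtain R where R: "R < 0" "\<And>\<beta>. \<beta> \<in> region \<Longrightarrow> fst \<beta> \<le> R \<Longrightarrow> \<exists>\<theta>. opt_theta \<mu> p \<beta> = \<theta>
    \<and> \<theta> = 2 * (fst \<beta> + snd \<beta> * (real p * tilted_mean \<mu> \<theta> ^ (p - 1))) \<and> tilted_mean \<mu> \<theta> \<le> \<delta>"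
    using opt_u_and_theta[OF \<delta>] by metis
  show "\<forall>\<^sub>F \<beta> in far_in_region. dist (opt_theta \<mu> p \<beta> / (2 * fst \<beta>)) 1 < e"
    unfolding eventually_far_in_region
  proof (intro exI[of _ R] ballI impI)
    fix \<beta> assume \<beta>: "\<beta> \<in> region" "fst \<beta> \<le> R"
    have b: "fst \<beta> < 0" "0 \<le> snd \<beta>" "snd \<beta> \<le> - fst \<beta>" using \<beta> by (auto simp: region_def)
    obtain \<theta> where \<theta>: "opt_theta \<mu> p \<beta> = \<theta>" "\<theta> = 2 * (fst \<beta> + snd \<beta> * (real p * tilted_mean \<mu> \<theta> ^ (p - 1)))"
      "tilted_mean \<mu> \<theta> \<le> \<delta>" using R(2)[OF \<beta>] by (elim exE conjE)
    define w where "w = real p * tilted_mean \<mu> \<theta> ^ (p - 1)"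
    have m: "0 \<le> tilted_mean \<mu> \<theta>" "tilted_mean \<mu> \<theta> \<le> 1" using tilted_mean_nonneg[of \<theta>] tilted_mean_less_1[of \<theta>] by auto
    have "tilted_mean \<mu> \<theta> ^ (p - 1) \<le> tilted_mean \<mu> \<theta>"
      using power_decreasing[of 1 "p - 1" "tilted_mean \<mu> \<theta>"] p m by simp
    also have "\<dots> \<le> e / (2 * real p)" using \<theta>(3) by (simp add: \<delta>_def)
    finally have "w \<le> real p * (e / (2 * real p))" unfolding w_def by (rule mult_left_mono) simp
    then have w: "0 \<le> w" "w \<le> e / 2" using pp m by (auto simp: w_def)
    have "opt_theta \<mu> p \<beta> / (2 * fst \<beta>) - 1 = (snd \<beta> / fst \<beta>) * w"
      using b \<theta>(1,2) unfolding w_def[symmetric] by (simp add: field_simps)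
    then have "dist (opt_theta \<mu> p \<beta> / (2 * fst \<beta>)) 1 = \<bar>snd \<beta> / fst \<beta>\<bar> * w"
      using w by (simp add: dist_real_def abs_mult)
    also have "\<bar>snd \<beta> / fst \<beta>\<bar> \<le> 1" unfolding abs_divide using b by (subst pos_divide_le_eq) auto
    then have "\<bar>snd \<beta> / fst \<beta>\<bar> * w \<le> 1 * w" using w(1) by (rule mult_right_mono)
    finally show "dist (opt_theta \<mu> p \<beta> / (2 * fst \<beta>)) 1 < e" using w e by simp
  qed
qed

end


section \<open>Non-universality of the density\<close>

definition fair_average :: "nat \<Rightarrow> real measure" where
  "fair_average m = distr (measure_pmf (binomial_pmf m (1 / 2))) borel (\<lambda>j. real j / real m)"

definition logistic :: "real \<Rightarrow> real" where
  "logistic x = exp x / (1 + exp x)"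

lemma binomial_half_symmetric: "map_pmf (\<lambda>j. m - j) (binomial_pmf m (1 / 2)) = binomial_pmf m (1 / 2)"
proof (rule pmf_eqI)
  fix i
  have S: "set_pmf (binomial_pmf m (1 / 2)) = {..m}" by (simp add: set_pmf_binomial)
  show "pmf (map_pmf (\<lambda>j. m - j) (binomial_pmf m (1 / 2))) i = pmf (binomial_pmf m (1 / 2)) i"
  proof (cases "i \<le> m")
    case True
    have "pmf (map_pmf (\<lambda>j. m - j) (binomial_pmf m (1 / 2))) (m - (m - i)) = pmf (binomial_pmf m (1 / 2)) (m - i)"
      by (rule pmf_map_inj) (auto simp: S inj_on_def)
    then show ?thesis using True binomial_symmetric[OF True] by (simp add: pmf_binomial flip: power_add)
  next
    case False
    then have "i \<notin> set_pmf (map_pmf (\<lambda>j. m - j) (binomial_pmf m (1 / 2)))" by auto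
    moreover have "i \<notin> set_pmf (binomial_pmf m (1 / 2))" using False by (simp add: S)
    ultimately show ?thesis by (simp only: set_pmf_iff not_not)
  qed
qed

lemma cumulant_fair_average:
  assumes m: "0 < m"
  shows "cumulant (fair_average m) \<theta> = real m * ln ((1 + exp (\<theta> / real m)) / 2)"
proof -
  have "(\<integral>x. exp (\<theta> * x) \<partial>fair_average m) = (\<integral>j. exp (\<theta> * (real j / real m)) \<partial>measure_pmf (binomial_pmf m (1 / 2)))"
    unfolding fair_average_def by (rule integral_distr) auto
  also have "\<dots> = (\<Sum>j\<le>m. exp (\<theta> * (real j / real m)) * pmf (binomial_pmf m (1 / 2)) j)"
    by (rule integral_measure_pmf_real) (auto simp: set_pmf_binomial)
  also have "\<dots> = (\<Sum>j\<le>m. of_nat (m choose j) * (exp (\<theta> / real m) / 2) ^ j * (1 / 2) ^ (m - j))"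
  proof (rule sum.cong)
    fix j
    have "exp (\<theta> * (real j / real m)) = exp (\<theta> / real m) ^ j"
      by (simp add: exp_of_nat_mult[symmetric] mult.commute)
    then show "exp (\<theta> * (real j / real m)) * pmf (binomial_pmf m (1 / 2)) j
        = of_nat (m choose j) * (exp (\<theta> / real m) / 2) ^ j * (1 / 2) ^ (m - j)"
      by (simp add: pmf_binomial power_divide)
  qed simp
  also have "\<dots> = ((1 + exp (\<theta> / real m)) / 2) ^ m"
    by (simp add: binomial_ring[symmetric] add_divide_distrib add.commute)
  finally have mgf: "(\<integral>x. exp (\<theta> * x) \<partial>fair_average m) = ((1 + exp (\<theta> / real m)) / 2) ^ m" .
  show ?thesis unfolding cumulant_def mgf by (rule ln_realpow)
qed

lemma DERIV_logistic: "(logistic has_real_derivative logistic x * (1 - logistic x)) (at x)"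
proof -
  have "1 + exp x \<noteq> 0" using exp_gt_zero[of x] by linarith
  then show ?thesis
    unfolding logistic_def[abs_def] by (auto intro!: derivative_eq_intros simp: field_simps power2_eq_square)
qed

lemma fair_average_derivatives:
  assumes m: "0 < m"
  shows "deriv (cumulant (fair_average m)) = (\<lambda>\<theta>. logistic (\<theta> / real m))"
    and "(deriv ^^ 2) (cumulant (fair_average m)) = (\<lambda>\<theta>. logistic (\<theta> / real m) * (1 - logistic (\<theta> / real m)) / real m)"
    and "(deriv ^^ 3) (cumulant (fair_average m))
      = (\<lambda>\<theta>. logistic (\<theta> / real m) * (1 - logistic (\<theta> / real m)) * (1 - 2 * logistic (\<theta> / real m)) / (real m)\<^sup>2)"
proof -
  have s: "((\<lambda>\<theta>. logistic (\<theta> / real m)) has_real_derivative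
      logistic (\<theta> / real m) * (1 - logistic (\<theta> / real m)) / real m) (at \<theta>)" for \<theta>
    using DERIV_chain2[OF DERIV_logistic DERIV_cdivide[OF DERIV_ident, of "real m"], of \<theta>] by simp
  show 1: "deriv (cumulant (fair_average m)) = (\<lambda>\<theta>. logistic (\<theta> / real m))"
  proof (rule ext, rule DERIV_imp_deriv)
    fix \<theta>
    have pos: "0 < 1 + exp (\<theta> / real m)" by (simp add: add_pos_pos)
    have "((\<lambda>\<theta>. (1 + exp (\<theta> / real m)) / 2) has_real_derivative exp (\<theta> / real m) * (1 / real m) / 2) (at \<theta>)"
      using m by (auto intro!: derivative_eq_intros)
    from DERIV_cmult[OF DERIV_chain2[OF DERIV_ln_divide this], of "real m"] pos
    have "((\<lambda>\<theta>. real m * ln ((1 + exp (\<theta> / real m)) / 2)) has_real_derivative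
        real m * (1 / ((1 + exp (\<theta> / real m)) / 2) * (exp (\<theta> / real m) * (1 / real m) / 2))) (at \<theta>)"
      by simp
    moreover have "real m * (1 / ((1 + exp (\<theta> / real m)) / 2) * (exp (\<theta> / real m) * (1 / real m) / 2))
        = logistic (\<theta> / real m)"
      using m by (simp add: logistic_def)
    ultimately show "(cumulant (fair_average m) has_real_derivative logistic (\<theta> / real m)) (at \<theta>)"
      unfolding cumulant_fair_average[OF m, abs_def] by simp
  qed
  show 2: "(deriv ^^ 2) (cumulant (fair_average m)) = (\<lambda>\<theta>. logistic (\<theta> / real m) * (1 - logistic (\<theta> / real m)) / real m)"
    unfolding numeral_2_eq_2 by (simp add: 1) (rule ext, rule DERIV_imp_deriv, rule s)
  have "(deriv ^^ 3) (cumulant (fair_average m)) = deriv ((deriv ^^ 2) (cumulant (fair_average m)))"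
    by (simp add: numeral_3_eq_3 numeral_2_eq_2)
  also have "\<dots> = (\<lambda>\<theta>. logistic (\<theta> / real m) * (1 - logistic (\<theta> / real m)) * (1 - 2 * logistic (\<theta> / real m)) / (real m)\<^sup>2)"
    unfolding 2
    by (rule ext, rule DERIV_imp_deriv) (rule derivative_eq_intros s refl | use m in \<open>simp add: field_simps power2_eq_square\<close>)+
  finally show "(deriv ^^ 3) (cumulant (fair_average m))
      = (\<lambda>\<theta>. logistic (\<theta> / real m) * (1 - logistic (\<theta> / real m)) * (1 - 2 * logistic (\<theta> / real m)) / (real m)\<^sup>2)" .
qed

text \<open>
  After division by positive factors the equation is linear in \<open>s = K'(\<theta>)\<close>, with the solution
  \<open>s = (p - 1) / p\<close>.
\<close>

lemma fair_average_inflection: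
  assumes m: "0 < m" and p: "2 \<le> p"
  shows "\<exists>!\<theta>. (deriv ^^ 3) (cumulant (fair_average m)) \<theta> * deriv (cumulant (fair_average m)) \<theta>
              = - (real p - 2) * ((deriv ^^ 2) (cumulant (fair_average m)) \<theta>)\<^sup>2"
proof -
  have "((deriv ^^ 3) (cumulant (fair_average m)) \<theta> * deriv (cumulant (fair_average m)) \<theta>
              = - (real p - 2) * ((deriv ^^ 2) (cumulant (fair_average m)) \<theta>)\<^sup>2) \<longleftrightarrow> \<theta> = real m * ln (real p - 1)" for \<theta>
  proof -
    let ?s = "logistic (\<theta> / real m)"
    have e: "0 < 1 + exp (\<theta> / real m)" by (simp add: add_pos_pos)
    have s: "0 < ?s" "?s < 1" using e by (auto simp: logistic_def)
    have "((deriv ^^ 3) (cumulant (fair_average m)) \<theta> * deriv (cumulant (fair_average m)) \<theta>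
              = - (real p - 2) * ((deriv ^^ 2) (cumulant (fair_average m)) \<theta>)\<^sup>2)
        \<longleftrightarrow> ?s * (1 - ?s) * (1 - 2 * ?s) * ?s = - (real p - 2) * (?s * (1 - ?s))\<^sup>2"
      unfolding fair_average_derivatives[OF m] using m by (simp add: power_divide field_simps)
    also have "\<dots> \<longleftrightarrow> ?s\<^sup>2 * (1 - ?s) * ((real p - 1) - real p * ?s) = 0"
      by (simp add: algebra_simps power2_eq_square)
    also have "\<dots> \<longleftrightarrow> real p * ?s = real p - 1" using s by auto
    also have "\<dots> \<longleftrightarrow> exp (\<theta> / real m) = real p - 1"
      unfolding logistic_def using e by (simp add: field_simps)
    also have "\<dots> \<longleftrightarrow> \<theta> / real m = ln (real p - 1)"
      using p by (metis diff_gt_0_iff_gt exp_ln ln_exp less_le_trans one_less_numeral_iff of_nat_1 of_nat_less_iff semiring_norm(76) numeral_le_real_of_nat_iff)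
    also have "\<dots> \<longleftrightarrow> \<theta> = real m * ln (real p - 1)" using m by (auto simp: field_simps)
    finally show ?thesis .
  qed
  then show ?thesis by auto
qed

lemma fair_average_admissible:
  assumes m: "0 < m" and p: "2 \<le> p"
  shows "admissible p (fair_average m)"
proof -
  let ?B = "binomial_pmf m (1 / 2)"
  have S: "set_pmf ?B = {..m}" by (simp add: set_pmf_binomial)
  have AE: "(AE x in fair_average m. P x) \<longleftrightarrow> (\<forall>j\<le>m. P (real j / real m))" if "{x. P x} \<in> sets borel" for P
    unfolding fair_average_def using that
    by (subst AE_distr_iff) (auto simp: AE_measure_pmf_iff S)
  have supp: "real j / real m \<in> topological_support (fair_average m)" if j: "j \<le> m" for j
    unfolding topological_support_def
  proof (intro CollectI allI impI)
    fix U :: "real set" assume U: "open U" "real j / real m \<in> U"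
    have "emeasure (fair_average m) U = emeasure (measure_pmf ?B) ((\<lambda>j. real j / real m) -` U)"
      unfolding fair_average_def using U by (subst emeasure_distr) auto
    moreover have "j \<in> set_pmf ?B \<inter> (\<lambda>j. real j / real m) -` U" using U j S by auto
    then have "measure (measure_pmf ?B) ((\<lambda>j. real j / real m) -` U) \<noteq> 0"
      unfolding measure_pmf_zero_iff by blast
    ultimately show "emeasure (fair_average m) U \<noteq> 0"
      by (simp add: measure_pmf.emeasure_eq_measure)
  qed
  have "distr (fair_average m) borel (\<lambda>x. 1 - x) = distr (measure_pmf ?B) borel (\<lambda>j. 1 - real j / real m)"
    unfolding fair_average_def by (subst distr_distr) (auto simp: o_def)
  also have "\<dots> = distr (measure_pmf ?B) borel (\<lambda>j. real (m - j) / real m)"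
    by (rule distr_cong_AE) (use m in \<open>auto simp: AE_measure_pmf_iff S of_nat_diff field_simps\<close>)
  also have "\<dots> = distr (measure_pmf (map_pmf (\<lambda>j. m - j) ?B)) borel (\<lambda>j. real j / real m)"
    unfolding map_pmf_rep_eq by (subst distr_distr) (auto simp: o_def)
  also have "\<dots> = fair_average m" by (simp add: binomial_half_symmetric fair_average_def)
  finally have "distr (fair_average m) borel (\<lambda>x. 1 - x) = fair_average m" .
  moreover have "prob_space (fair_average m)"
    unfolding fair_average_def by (rule prob_space.prob_space_distr) (auto intro: measure_pmf.prob_space_axioms)
  moreover have "\<not> (\<exists>c. AE x in fair_average m. x = c)"
  proof
    assume "\<exists>c. AE x in fair_average m. x = c"
    then obtain c where "\<forall>j\<le>m. real j / real m = c" using AE[of "\<lambda>x. x = c" for c] by auto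
    then have "real 0 / real m = real m / real m" by (metis le0 order_refl)
    then show False using m by simp
  qed
  moreover have "\<forall>j\<le>m. real j / real m \<in> {0..1}" using m by (auto simp: divide_le_eq)
  then have "AE x in fair_average m. x \<in> {0..1}" by (subst AE) (auto simp: set_eq_iff)
  moreover have "0 \<in> topological_support (fair_average m)" using supp[of 0] by simp
  moreover have "1 \<in> topological_support (fair_average m)" using supp[of m] m by simp
  moreover have "sets (fair_average m) = sets borel" by (simp add: fair_average_def)
  ultimately show ?thesis unfolding admissible_def using fair_average_inflection[OF m p] by blast
qed

lemma opt_u_fair_average:
  assumes m: "0 < m" and p: "2 \<le> p"
  shows "\<exists>T. \<forall>t\<ge>T. opt_u (fair_average m) p (- t, 0) = logistic (- (2 * t) / real m)"
proof -
  interpret admissible_weight "fair_average m" p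
    by (rule admissible_imp_locale[OF fair_average_admissible[OF m p] p])
  obtain R where R: "R < 0" "\<And>\<beta>. \<beta> \<in> region \<Longrightarrow> fst \<beta> \<le> R \<Longrightarrow>
    \<exists>\<theta>. opt_u (fair_average m) p \<beta> = tilted_mean (fair_average m) \<theta>
      \<and> \<theta> = 2 * (fst \<beta> + snd \<beta> * (real p * tilted_mean (fair_average m) \<theta> ^ (p - 1)))"
    using opt_u_and_theta[OF zero_less_one] by metis
  have "opt_u (fair_average m) p (- t, 0) = logistic (- (2 * t) / real m)" if "- R \<le> t" for t
  proof -
    have "(- t, 0) \<in> region" "fst (- t, 0 :: real) \<le> R" using that R(1) by (auto simp: region_def)
    from R(2)[OF this] have "opt_u (fair_average m) p (- t, 0) = tilted_mean (fair_average m) (- (2 * t))" by auto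
    then show ?thesis using fair_average_derivatives(1)[OF m] deriv_cumulant by metis
  qed
  then show ?thesis by blast
qed

lemma logistic_ratio_small:
  assumes "2 \<le> t"
  shows "logistic (- (2 * t)) / logistic (- t) \<le> 1 / 2"
proof -
  define y where "y = exp (- t)"
  have "5 \<le> exp t" using exp_lower_Taylor_quadratic[of t] mult_mono[of 2 t 2 t] assms by (simp add: power2_eq_square)
  then have y: "0 < y" "y \<le> 1 / 5" unfolding y_def exp_minus by (auto simp: field_simps)
  have "exp (- (2 * t)) = y * y" unfolding y_def by (simp flip: exp_add)
  then have "logistic (- (2 * t)) / logistic (- t) = (y * y / (1 + y * y)) / (y / (1 + y))"
    unfolding logistic_def y_def[symmetric] by simp
  also have "\<dots> = y * (1 + y) / (1 + y * y)" using y by simp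
  also have "\<dots> \<le> y * (1 + y) / 1" using y by (intro divide_left_mono) (auto intro: add_pos_nonneg)
  also have "\<dots> \<le> (1 / 5) * (1 + 1 / 5)" using y unfolding div_by_1 by (intro mult_mono) auto
  finally show ?thesis by simp
qed

text \<open>
  Without interaction the dual of the maximizer is \<open>2 \<beta>\<^sub>1\<close> for either law.
\<close>

lemma opt_u_not_universal:
  assumes p: "2 \<le> p"
  shows "\<not> ((\<lambda>\<beta>. opt_u (fair_average 1) p \<beta> / opt_u (fair_average 2) p \<beta>) \<longlongrightarrow> 1) far_in_region"
proof
  assume "((\<lambda>\<beta>. opt_u (fair_average 1) p \<beta> / opt_u (fair_average 2) p \<beta>) \<longlongrightarrow> 1) far_in_region"
  from tendstoD[OF this, of "1 / 2"] obtain R where R: "\<And>\<beta>. \<beta> \<in> region \<Longrightarrow> fst \<beta> \<le> R \<Longrightarrow>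
      dist (opt_u (fair_average 1) p \<beta> / opt_u (fair_average 2) p \<beta>) 1 < 1 / 2"
    unfolding eventually_far_in_region by auto
  obtain T1 where T1: "\<And>t. T1 \<le> t \<Longrightarrow> opt_u (fair_average 1) p (- t, 0) = logistic (- (2 * t) / real 1)"
    using opt_u_fair_average[OF _ p, of 1] by auto
  obtain T2 where T2: "\<And>t. T2 \<le> t \<Longrightarrow> opt_u (fair_average 2) p (- t, 0) = logistic (- (2 * t) / real 2)"
    using opt_u_fair_average[OF _ p, of 2] by auto
  \<comment> \<open>From \<open>t = 2\<close> on, the ratio of the two densities is at most \<open>1/2\<close>.\<close>
  define t where "t = Max {2, T1, T2, - R}"
  have t: "2 \<le> t" "T1 \<le> t" "T2 \<le> t" "- R \<le> t" unfolding t_def by (auto intro: Max_ge)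
  have "(- t, 0) \<in> region" "fst (- t, 0 :: real) \<le> R" using t by (auto simp: region_def)
  from R[OF this] show False
    unfolding T1[OF t(2)] T2[OF t(3)] dist_real_def using logistic_ratio_small[OF t(1)] by simp
qed

theorem theorem4:
  fixes k p :: nat and E :: "nat set set"
  assumes simple_graph: "E \<subseteq> nsets {1..k} 2"
    and p: "p = card E" "p \<ge> 2"
  shows "(\<forall>\<mu>. admissible p \<mu> \<longrightarrow>
            (\<forall>\<^sub>F \<beta> in far_in_region.
               (\<exists>!u. is_maximizer \<mu> p \<beta> u) \<and>
               opt_u \<mu> p \<beta> \<in> {0<..<1} \<and>
               (\<exists>!\<theta>. is_dual \<mu> (opt_u \<mu> p \<beta>) \<theta>) \<and>
               (\<forall>Q \<in> joint_laws (exp_graph_law \<mu> k E \<beta>). AE G in Q.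
                  (\<lambda>n. class_dist (graphon_class (graphon_of n (G n)))
                                  (graphon_class (\<lambda>x y. opt_u \<mu> p \<beta>))) \<longlonglongrightarrow> 0)) \<and>
            ((\<lambda>\<beta>. opt_theta \<mu> p \<beta> / (2 * fst \<beta>)) \<longlongrightarrow> 1) far_in_region) \<and>
         (\<exists>\<mu> \<nu>. admissible p \<mu> \<and> admissible p \<nu> \<and>
            \<not> ((\<lambda>\<beta>. opt_u \<mu> p \<beta> / opt_u \<nu> p \<beta>) \<longlongrightarrow> 1) far_in_region)"
proof (intro conjI allI impI)
  fix \<mu> assume "admissible p \<mu>"
  then interpret admissible_weight \<mu> p by (rule admissible_imp_locale[OF _ p(2)])
  show "\<forall>\<^sub>F \<beta> in far_in_region.
               (\<exists>!u. is_maximizer \<mu> p \<beta> u) \<and>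
               opt_u \<mu> p \<beta> \<in> {0<..<1} \<and>
               (\<exists>!\<theta>. is_dual \<mu> (opt_u \<mu> p \<beta>) \<theta>) \<and>
               (\<forall>Q \<in> joint_laws (exp_graph_law \<mu> k E \<beta>). AE G in Q.
                  (\<lambda>n. class_dist (graphon_class (graphon_of n (G n)))
                                  (graphon_class (\<lambda>x y. opt_u \<mu> p \<beta>))) \<longlonglongrightarrow> 0)"
    by (rule eventually_erdos_renyi[OF assms(1,2)])
  show "((\<lambda>\<beta>. opt_theta \<mu> p \<beta> / (2 * fst \<beta>)) \<longlongrightarrow> 1) far_in_region"
    by (rule opt_theta_asymptotics)
next
  have "admissible p (fair_average 1)" "admissible p (fair_average 2)"
    using fair_average_admissible[OF _ p(2)] by auto
  then show "\<exists>\<mu> \<nu>. admissible p \<mu> \<and> admissible p \<nu> \<and>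
            \<not> ((\<lambda>\<beta>. opt_u \<mu> p \<beta> / opt_u \<nu> p \<beta>) \<longlongrightarrow> 1) far_in_region"
    using opt_u_not_universal[OF p(2)] by blast
qed

end
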